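(* Let $k$ be an algebraically closed field and let $A=kQ/I$ be a triangular finite-dimensional basic $k$-algebra whose Tits form $q_A$ is slender and admits a maximal omnipresent root $v$. Then $q_A$ is weakly non-negative. Moreover, $v(i)\le 12$ for every vertex $i\in Q_0$.
   Context: $A=kQ/I$ with $Q$ a finite quiver and $I$ an admissible ideal of the path algebra $kQ$; $A$ is triangular if $Q$ has no oriented cycles. For vertices $i,j$ let $I(i,j)$ be the part of $I$ spanned by (combinations of) paths from $i$ to $j$, and let $r(i,j)$ be the number of elements of $R\cap I(i,j)$, where $R$ is a minimal set of generators of $I$ contained in $\bigcup_{i,j}I(i,j)$. The Tits form is $q_A:\mathbb{Z}^{Q_0}\to\mathbb{Z}$, $q_A(v)=\sum_{i\in Q_0}v(i)^2-\sum_{(i\to j)\in Q_1}v(i)v(j)+\sum_{i,j\in Q_0}r(i,j)v(i)v(j)$. For a unit form $q(x)=\sum_i x_i^2+\sum_{i<j}q_{ij}x_ix_j$ on $\mathbb{Z}^n$, its symmetric bilinear form is $q(x,y)=q(x+y)-q(x)-q(y)$, so $q(e_i,e_j)=q_{ij}$ for $i\neq j$ ($e_i$ the canonical basis vectors). $q$ is slender if $q(e_i,e_j)\ge -1$ for all $i\ne j$. A root of $q$ is a vector $v\in\mathbb{Z}^n$ with non-negative coordinates and $q(v)=1$; it is omnipresent if $v(i)>0$ for all $i$, and maximal if every root $w\ge v$ (coordinatewise) satisfies $w=v$. $q$ is weakly non-negative if $q(v)\ge 0$ for all $v\in\mathbb{N}^n$. *)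

theory Defs
  imports "HOL-Computational_Algebra.Polynomial"
begin

text \<open>A finite quiver is given by a vertex set Q0, an arrow set Q1 and source/target maps s, t.
A path is a triple (i, as, j): start vertex i, list of arrows as (traversed left to right),
end vertex j.  The trivial path e_i is (i, [], i).\<close>

definition quiver :: "'v set \<Rightarrow> 'a set \<Rightarrow> ('a \<Rightarrow> 'v) \<Rightarrow> ('a \<Rightarrow> 'v) \<Rightarrow> bool" where
  "quiver Q0 Q1 s t \<longleftrightarrow> finite Q0 \<and> finite Q1 \<and> (\<forall>\<alpha>\<in>Q1. s \<alpha> \<in> Q0 \<and> t \<alpha> \<in> Q0)"

definition is_path :: "'v set \<Rightarrow> 'a set \<Rightarrow> ('a \<Rightarrow> 'v) \<Rightarrow> ('a \<Rightarrow> 'v) \<Rightarrow> 'v \<times> 'a list \<times> 'v \<Rightarrow> bool" where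
  "is_path Q0 Q1 s t p = (case p of (i, as, j) \<Rightarrow>
     i \<in> Q0 \<and> j \<in> Q0 \<and> set as \<subseteq> Q1 \<and>
     (if as = [] then i = j
      else s (hd as) = i \<and> t (last as) = j \<and>
           (\<forall>k. Suc k < length as \<longrightarrow> t (as ! k) = s (as ! Suc k))))"

definition triangular :: "'v set \<Rightarrow> 'a set \<Rightarrow> ('a \<Rightarrow> 'v) \<Rightarrow> ('a \<Rightarrow> 'v) \<Rightarrow> bool" where
  "triangular Q0 Q1 s t \<longleftrightarrow> \<not> (\<exists>i as. as \<noteq> [] \<and> is_path Q0 Q1 s t (i, as, i))"

definition path_alg :: "'v set \<Rightarrow> 'a set \<Rightarrow> ('a \<Rightarrow> 'v) \<Rightarrow> ('a \<Rightarrow> 'v)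
    \<Rightarrow> ('v \<times> 'a list \<times> 'v \<Rightarrow> 'k::field) set" where
  "path_alg Q0 Q1 s t = {f. finite {p. f p \<noteq> 0} \<and> (\<forall>p. f p \<noteq> 0 \<longrightarrow> is_path Q0 Q1 s t p)}"

definition pmult :: "'v set \<Rightarrow> 'a set \<Rightarrow> ('a \<Rightarrow> 'v) \<Rightarrow> ('a \<Rightarrow> 'v)
    \<Rightarrow> ('v \<times> 'a list \<times> 'v \<Rightarrow> 'k::field) \<Rightarrow> ('v \<times> 'a list \<times> 'v \<Rightarrow> 'k)
    \<Rightarrow> ('v \<times> 'a list \<times> 'v \<Rightarrow> 'k)" where
  "pmult Q0 Q1 s t f g = (\<lambda>(i, as, j).
     if is_path Q0 Q1 s t (i, as, j) then
       (\<Sum>k\<le>length as. (let m = (if k = 0 then i else t (as ! (k - 1)))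
                        in f (i, take k as, m) * g (m, drop k as, j)))
     else 0)"

definition is_ideal :: "'v set \<Rightarrow> 'a set \<Rightarrow> ('a \<Rightarrow> 'v) \<Rightarrow> ('a \<Rightarrow> 'v)
    \<Rightarrow> ('v \<times> 'a list \<times> 'v \<Rightarrow> 'k::field) set \<Rightarrow> bool" where
  "is_ideal Q0 Q1 s t I \<longleftrightarrow>
     I \<subseteq> path_alg Q0 Q1 s t \<and> (\<lambda>_. 0) \<in> I \<and>
     (\<forall>f\<in>I. \<forall>g\<in>I. (\<lambda>p. f p + g p) \<in> I) \<and>
     (\<forall>c. \<forall>f\<in>I. (\<lambda>p. c * f p) \<in> I) \<and>
     (\<forall>f\<in>I. \<forall>g\<in>path_alg Q0 Q1 s t. pmult Q0 Q1 s t f g \<in> I \<and> pmult Q0 Q1 s t g f \<in> I)"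

definition ideal_gen :: "'v set \<Rightarrow> 'a set \<Rightarrow> ('a \<Rightarrow> 'v) \<Rightarrow> ('a \<Rightarrow> 'v)
    \<Rightarrow> ('v \<times> 'a list \<times> 'v \<Rightarrow> 'k::field) set \<Rightarrow> ('v \<times> 'a list \<times> 'v \<Rightarrow> 'k) set" where
  "ideal_gen Q0 Q1 s t R = \<Inter>{J. is_ideal Q0 Q1 s t J \<and> R \<subseteq> J}"

text \<open>The m-th power of the arrow ideal: the span of all paths of length at least m.\<close>
definition arrow_pow :: "'v set \<Rightarrow> 'a set \<Rightarrow> ('a \<Rightarrow> 'v) \<Rightarrow> ('a \<Rightarrow> 'v) \<Rightarrow> nat
    \<Rightarrow> ('v \<times> 'a list \<times> 'v \<Rightarrow> 'k::field) set" where
  "arrow_pow Q0 Q1 s t m =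
     {f \<in> path_alg Q0 Q1 s t. \<forall>p. f p \<noteq> 0 \<longrightarrow> length (fst (snd p)) \<ge> m}"

definition admissible :: "'v set \<Rightarrow> 'a set \<Rightarrow> ('a \<Rightarrow> 'v) \<Rightarrow> ('a \<Rightarrow> 'v)
    \<Rightarrow> ('v \<times> 'a list \<times> 'v \<Rightarrow> 'k::field) set \<Rightarrow> bool" where
  "admissible Q0 Q1 s t I \<longleftrightarrow> is_ideal Q0 Q1 s t I \<and>
     (\<exists>m\<ge>2. arrow_pow Q0 Q1 s t m \<subseteq> I) \<and> I \<subseteq> arrow_pow Q0 Q1 s t 2"

definition Iij :: "('v \<times> 'a list \<times> 'v \<Rightarrow> 'k::field) set \<Rightarrow> 'v \<Rightarrow> 'v
    \<Rightarrow> ('v \<times> 'a list \<times> 'v \<Rightarrow> 'k) set" where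
  "Iij I i j = {f \<in> I. \<forall>p. f p \<noteq> 0 \<longrightarrow> fst p = i \<and> snd (snd p) = j}"

definition minimal_relations :: "'v set \<Rightarrow> 'a set \<Rightarrow> ('a \<Rightarrow> 'v) \<Rightarrow> ('a \<Rightarrow> 'v)
    \<Rightarrow> ('v \<times> 'a list \<times> 'v \<Rightarrow> 'k::field) set \<Rightarrow> ('v \<times> 'a list \<times> 'v \<Rightarrow> 'k) set \<Rightarrow> bool" where
  "minimal_relations Q0 Q1 s t I R \<longleftrightarrow>
     R \<subseteq> (\<Union>i\<in>Q0. \<Union>j\<in>Q0. Iij I i j) \<and>
     ideal_gen Q0 Q1 s t R = I \<and>
     (\<forall>R'. R' \<subset> R \<longrightarrow> ideal_gen Q0 Q1 s t R' \<noteq> I)"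

definition tits_form :: "'v set \<Rightarrow> 'a set \<Rightarrow> ('a \<Rightarrow> 'v) \<Rightarrow> ('a \<Rightarrow> 'v)
    \<Rightarrow> ('v \<times> 'a list \<times> 'v \<Rightarrow> 'k::field) set \<Rightarrow> ('v \<times> 'a list \<times> 'v \<Rightarrow> 'k) set
    \<Rightarrow> ('v \<Rightarrow> int) \<Rightarrow> int" where
  "tits_form Q0 Q1 s t I R v =
     (\<Sum>i\<in>Q0. (v i)\<^sup>2) - (\<Sum>\<alpha>\<in>Q1. v (s \<alpha>) * v (t \<alpha>))
     + (\<Sum>i\<in>Q0. \<Sum>j\<in>Q0. int (card (R \<inter> Iij I i j)) * v i * v j)"

text \<open>Vectors in \<int>^X are functions vanishing outside X.\<close>

definition unit_vec :: "'v \<Rightarrow> 'v \<Rightarrow> int" where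
  "unit_vec i = (\<lambda>j. if j = i then 1 else 0)"

definition bilin :: "(('v \<Rightarrow> int) \<Rightarrow> int) \<Rightarrow> ('v \<Rightarrow> int) \<Rightarrow> ('v \<Rightarrow> int) \<Rightarrow> int" where
  "bilin q x y = q (\<lambda>j. x j + y j) - q x - q y"

definition slender :: "'v set \<Rightarrow> (('v \<Rightarrow> int) \<Rightarrow> int) \<Rightarrow> bool" where
  "slender X q \<longleftrightarrow> (\<forall>i\<in>X. \<forall>j\<in>X. i \<noteq> j \<longrightarrow> bilin q (unit_vec i) (unit_vec j) \<ge> -1)"

definition is_root :: "'v set \<Rightarrow> (('v \<Rightarrow> int) \<Rightarrow> int) \<Rightarrow> ('v \<Rightarrow> int) \<Rightarrow> bool" where
  "is_root X q v \<longleftrightarrow> (\<forall>i\<in>X. v i \<ge> 0) \<and> (\<forall>i. i \<notin> X \<longrightarrow> v i = 0) \<and> q v = 1"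

definition omnipresent :: "'v set \<Rightarrow> ('v \<Rightarrow> int) \<Rightarrow> bool" where
  "omnipresent X v \<longleftrightarrow> (\<forall>i\<in>X. v i > 0)"

definition maximal_root :: "'v set \<Rightarrow> (('v \<Rightarrow> int) \<Rightarrow> int) \<Rightarrow> ('v \<Rightarrow> int) \<Rightarrow> bool" where
  "maximal_root X q v \<longleftrightarrow> is_root X q v \<and>
     (\<forall>w. is_root X q w \<and> (\<forall>i\<in>X. v i \<le> w i) \<longrightarrow> w = v)"

definition weakly_nonneg :: "'v set \<Rightarrow> (('v \<Rightarrow> int) \<Rightarrow> int) \<Rightarrow> bool" where
  "weakly_nonneg X q \<longleftrightarrow>
     (\<forall>v. (\<forall>i\<in>X. v i \<ge> 0) \<and> (\<forall>i. i \<notin> X \<longrightarrow> v i = 0) \<longrightarrow> q v \<ge> 0)"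

definition alg_closed_type :: "'k::field itself \<Rightarrow> bool" where
  "alg_closed_type _ \<longleftrightarrow> (\<forall>p :: 'k poly. degree p > 0 \<longrightarrow> (\<exists>x. poly p x = 0))"

end

(*
A maximal omnipresent root v of the unit form q satisfies c = b(v, -) >= 0, and an isotropic
vector z >= 0 with c(z) = 0 would make v + z a larger root.  Slenderness turns a negative value
of q into an isotropic vector z with b(z, e_i) < 0 for some vertex i, and a transvection along z
then produces a root above v; so q is weakly non-negative.

For the bound let a be a vertex with c(e_a) = 0 and write v = v(a) e_a + (sum of roots avoiding a)
with as few roots as possible.  Since b(v, v) = 2, exactly two of these roots have c = 1 and all
others have c = 0.  Unless an isotropic vector splits off from v, every root y involved satisfies
b(e_a, y) = -1, and the products of distinct roots are >= 0.  The matrix G = 2 b - 1 of the roots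
with c = 0 has diagonal 3 and odd entries >= -1, and it is strictly copositive.  Minimising G over
the standard simplex with minimal support yields a positive definite principal submatrix with
entries 3 and 1, -1: a system of equiangular lines with angle arccos (1/3).  The pillar method of
Lemmens and Seidel bounds the minimum of G from below by 1/41, or by 1/(2n - 3) for n lines, except
for one configuration of seven lines with minimum 1/59, coming from the root lattice E8.  The number
of roots is 2 v(a) - 2 and G takes a value <= 12 on their multiplicity vector, which forces
v(a) <= 12; in the exceptional case the fundamental weight of E8 at the branching vertex gives
v(a) <= 6 + 6.
*)

theory Submission
  imports Defs "HOL-Library.Function_Algebras" "HOL-Library.Multiset" "HOL-Analysis.Analysis"
begin

section \<open>Unit forms and maximal roots\<close>

text \<open>The obstacle is that \<open>q\<close> is controlled only on the non-negative orthant, so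
  no positive definite lattice is at hand. Passing to a minimiser of minimal support is what turns
  copositivity into definiteness and brings in line systems. \<open>G\<close> is twice the Gram
  matrix of the roots projected orthogonally to \<open>e_a\<close>; it takes odd values because
  \<open>b\<close> is integral, and values >= -1 because in a shortest decomposition no product of
  distinct roots with c = 0 is negative. The number 12 arises as follows. Let W = 2 v(a) - 2, and
  let d be the product of the two roots with c = 1. Testing \<open>q\<close> on vectors near
  \<open>v\<close> gives 0 <= d <= 3, and \<open>G\<close> has the value 4 d <= 12 on the
  multiplicities. The bound 1/(2 n - 3) with n <= W then reads W^2 <= 12 (2 W - 3), which fails for
  W >= 24, that is for v(a) >= 13; also 41 * 12 < 24^2. Since 59 * 12 > 24^2, the exceptional
  configuration survives this estimate and needs an argument of its own. It consists of cliques of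
  sizes 4, 2, 1, one less than the arm lengths 5, 3, 2 of the E8 diagram, and its weights 6, 10, 15
  are 30/5, 30/3, 30/2.\<close>

definition bform :: "'i set \<Rightarrow> ('i \<Rightarrow> 'i \<Rightarrow> 'r::comm_ring_1) \<Rightarrow> ('i \<Rightarrow> 'r) \<Rightarrow> ('i \<Rightarrow> 'r) \<Rightarrow> 'r" where
  "bform X A x y = (\<Sum>i\<in>X. \<Sum>j\<in>X. A i j * x i * y j)"

definition smul :: "'r::comm_ring_1 \<Rightarrow> ('i \<Rightarrow> 'r) \<Rightarrow> 'i \<Rightarrow> 'r" where
  "smul c x = (\<lambda>i. c * x i)"

lemma smul_apply [simp]: "smul c x i = c * x i"
  by (simp add: smul_def)

definition unitv :: "'i \<Rightarrow> 'i \<Rightarrow> 'r::comm_ring_1" where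
  "unitv i = (\<lambda>j. if j = i then 1 else 0)"

lemma unitv_apply: "unitv i j = (if j = i then 1 else 0)"
  by (simp add: unitv_def)

lemma bform_add_left: "bform X A (x + y) z = bform X A x z + bform X A y z"
  by (simp add: bform_def algebra_simps sum.distrib)

lemma bform_add_right: "bform X A z (x + y) = bform X A z x + bform X A z y"
  by (simp add: bform_def algebra_simps sum.distrib)

lemma bform_smul_left: "bform X A (smul c x) z = c * bform X A x z"
  by (simp add: bform_def algebra_simps sum_distrib_left)

lemma bform_smul_right: "bform X A z (smul c x) = c * bform X A z x"
  by (simp add: bform_def algebra_simps sum_distrib_left)

lemma bform_commute:
  assumes "\<And>i j. A i j = A j i"
  shows "bform X A x y = bform X A y x"
proof -
  have "bform X A x y = (\<Sum>j\<in>X. \<Sum>i\<in>X. A i j * x i * y j)"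
    unfolding bform_def by (rule sum.swap)
  also have "\<dots> = bform X A y x"
    unfolding bform_def by (intro sum.cong refl) (simp add: assms[of _ j for j] mult_ac)
  finally show ?thesis .
qed

lemma bform_unitv_left:
  assumes "finite X" "i \<in> X"
  shows "bform X A (unitv i) y = (\<Sum>j\<in>X. A i j * y j)"
proof -
  have "bform X A (unitv i) y = (\<Sum>k\<in>X. if k = i then (\<Sum>j\<in>X. A k j * y j) else 0)"
    unfolding bform_def by (rule sum.cong) (auto simp: unitv_apply)
  then show ?thesis using assms by simp
qed

lemma bform_expand_left:
  assumes "finite X"
  shows "bform X A x y = (\<Sum>i\<in>X. x i * bform X A (unitv i) y)"
proof -
  have "(\<Sum>i\<in>X. x i * bform X A (unitv i) y) = (\<Sum>i\<in>X. x i * (\<Sum>j\<in>X. A i j * y j))"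
    using assms by (intro sum.cong) (auto simp: bform_unitv_left)
  then show ?thesis by (simp add: bform_def sum_distrib_left mult_ac)
qed

lemma bform_unitv_unitv:
  assumes "finite X" "i \<in> X" "j \<in> X"
  shows "bform X A (unitv i) (unitv j) = A i j"
  using assms by (simp add: bform_unitv_left unitv_apply if_distrib[of "\<lambda>x. _ * x"] cong: if_cong)

lemma bform_cong:
  "(\<And>i. i \<in> X \<Longrightarrow> x i = x' i) \<Longrightarrow> (\<And>i. i \<in> X \<Longrightarrow> y i = y' i) \<Longrightarrow> bform X A x y = bform X A x' y'"
  unfolding bform_def by (intro sum.cong) auto

definition orthant :: "'i set \<Rightarrow> ('i \<Rightarrow> int) set" where
  "orthant X = {x. (\<forall>i\<in>X. 0 \<le> x i) \<and> (\<forall>i. i \<notin> X \<longrightarrow> x i = 0)}"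

lemma orthant_add: "x \<in> orthant X \<Longrightarrow> y \<in> orthant X \<Longrightarrow> x + y \<in> orthant X"
  by (auto simp: orthant_def)

lemma orthant_smul: "0 \<le> c \<Longrightarrow> x \<in> orthant X \<Longrightarrow> smul c x \<in> orthant X"
  by (auto simp: orthant_def)

lemma orthant_unitv: "i \<in> X \<Longrightarrow> unitv i \<in> orthant X"
  by (auto simp: orthant_def unitv_apply)

lemma orthant_zero: "0 \<in> orthant X"
  by (auto simp: orthant_def)

lemma orthant_nonneg: "x \<in> orthant X \<Longrightarrow> 0 \<le> x i"
  by (cases "i \<in> X") (auto simp: orthant_def)

lemma orthant_diff: "x \<in> orthant X \<Longrightarrow> y \<in> orthant X \<Longrightarrow> (\<And>i. y i \<le> x i) \<Longrightarrow> x - y \<in> orthant X"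
  by (auto simp: orthant_def fun_diff_def)

lemma orthant_sum_mset: "(\<And>y. y \<in># Y \<Longrightarrow> y \<in> orthant X) \<Longrightarrow> \<Sum>\<^sub># Y \<in> orthant X"
  by (induction Y) (auto simp: orthant_zero intro: orthant_add)

section \<open>Integral unit forms and their bilinear forms\<close>

text \<open>\<open>M\<close> is not assumed symmetric, because the matrix of a Tits form records
  arrows and relations with their direction. Symmetry enters only through \<open>b\<close>, with
  \<open>b x x = 2 * q x\<close>.\<close>

locale unit_form =
  fixes X :: "'v set" and M :: "'v \<Rightarrow> 'v \<Rightarrow> int"
  assumes finX: "finite X"
    and unit: "\<And>i. i \<in> X \<Longrightarrow> M i i = 1"
begin

definition q :: "('v \<Rightarrow> int) \<Rightarrow> int" where "q x = bform X M x x"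

definition b :: "('v \<Rightarrow> int) \<Rightarrow> ('v \<Rightarrow> int) \<Rightarrow> int" where
  "b x y = bform X M x y + bform X M y x"

lemma b_commute: "b x y = b y x" by (simp add: b_def)

lemma b_self: "b x x = 2 * q x" by (simp add: b_def q_def)

lemma b_add_left: "b (x + y) z = b x z + b y z"
  by (simp add: b_def bform_add_left bform_add_right)

lemma b_add_right: "b z (x + y) = b z x + b z y"
  by (simp add: b_def bform_add_left bform_add_right)

lemma b_smul_left: "b (smul c x) z = c * b x z"
  by (simp add: b_def bform_smul_left bform_smul_right algebra_simps)

lemma b_smul_right: "b z (smul c x) = c * b z x"
  by (simp add: b_def bform_smul_left bform_smul_right algebra_simps)

lemma b_zero_left [simp]: "b 0 z = 0" by (simp add: b_def bform_def)
lemma b_zero_right [simp]: "b z 0 = 0" by (simp add: b_def bform_def)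

lemma b_diff_left: "b (x - y) z = b x z - b y z"
  using b_add_left[of "x - y" y z] by simp

lemma b_diff_right: "b z (x - y) = b z x - b z y"
  using b_add_right[of z "x - y" y] by simp

lemma b_sum_mset_left: "b (\<Sum>\<^sub># Y) z = (\<Sum>y\<in>#Y. b y z)"
  by (induction Y) (simp_all only: sum_mset.empty sum_mset.add_mset image_mset_empty image_mset_add_mset b_zero_left b_add_left)

lemma b_sum_mset_right: "b z (\<Sum>\<^sub># Y) = (\<Sum>y\<in>#Y. b z y)"
  by (induction Y) (simp_all only: sum_mset.empty sum_mset.add_mset image_mset_empty image_mset_add_mset b_zero_right b_add_right)

lemma q_zero [simp]: "q 0 = 0" by (simp add: q_def bform_def)

lemma q_add: "q (x + y) = q x + q y + b x y"
  by (simp add: q_def b_def bform_add_left bform_add_right)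

lemma q_diff: "q (x - y) = q x + q y - b x y"
  using q_add[of "x - y" y] by (simp add: b_diff_left b_self)

lemma q_smul: "q (smul c x) = c\<^sup>2 * q x"
  by (simp add: q_def bform_smul_left bform_smul_right power2_eq_square)

lemma q_unitv: "i \<in> X \<Longrightarrow> q (unitv i) = 1"
  by (simp add: q_def bform_unitv_unitv finX unit)

lemma b_unitv: "i \<in> X \<Longrightarrow> j \<in> X \<Longrightarrow> b (unitv i) (unitv j) = M i j + M j i"
  by (simp add: b_def bform_unitv_unitv finX)

lemma b_expand: "b x y = (\<Sum>i\<in>X. x i * b (unitv i) y)"
proof -
  have swap: "bform X M y x = bform X (\<lambda>i j. M j i) x y" for x y
    unfolding bform_def by (subst sum.swap) (simp add: mult_ac)
  have "b x y = bform X (\<lambda>i j. M i j + M j i) x y" for x y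
    unfolding b_def swap[of y x] by (simp add: bform_def algebra_simps sum.distrib)
  then show ?thesis by (simp add: bform_expand_left[OF finX, of _ x])
qed

lemmas b_simps = b_add_left b_add_right b_smul_left b_smul_right b_diff_left b_diff_right

end

section \<open>Consequences of maximality of an omnipresent root\<close>

locale max_root_form = unit_form X M for X :: "'v set" and M +
  fixes v :: "'v \<Rightarrow> int"
  assumes v_orthant: "v \<in> orthant X"
    and v_root: "q v = 1"
    and v_pos: "\<And>i. i \<in> X \<Longrightarrow> 0 < v i"
    and v_max: "\<And>w. w \<in> orthant X \<Longrightarrow> q w = 1 \<Longrightarrow> v \<le> w \<Longrightarrow> w = v"
begin

text \<open>If the product were -k with k > 0, then \<open>k v + e_i\<close> would be a root
  strictly above \<open>v\<close>, since k^2 + 1 - k * k = 1.\<close>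

lemma b_v_unitv_nonneg:
  assumes i: "i \<in> X"
  shows "0 \<le> b v (unitv i)"
proof (rule ccontr)
  assume "\<not> ?thesis"
  then obtain k where k: "b v (unitv i) = - k" "0 < k" by (metis add.inverse_inverse neg_0_less_iff_less not_le)
  define r where "r = smul k v + unitv i"
  have "q r = 1"
    by (simp add: r_def q_add q_smul q_unitv[OF i] b_simps k v_root power2_eq_square)
  moreover have "r \<in> orthant X"
    using k i v_orthant by (auto simp: r_def intro!: orthant_add orthant_smul orthant_unitv)
  moreover have "v \<le> r"
  proof (intro le_funI)
    fix j
    show "v j \<le> r j"
      using mult_right_mono[of 1 k "v j"] k orthant_nonneg[OF v_orthant, of j]
      by (cases "j = i") (auto simp: r_def unitv_apply)
  qed
  ultimately have "r = v" using v_max by blast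
  moreover have "v i \<le> k * v i" using k v_pos[OF i] by simp
  ultimately show False by (auto simp: r_def unitv_apply fun_eq_iff dest!: spec[of _ i])
qed

lemma b_v_nonneg:
  assumes "z \<in> orthant X"
  shows "0 \<le> b v z"
proof -
  have "b v z = (\<Sum>i\<in>X. z i * b v (unitv i))"
    using b_expand[of z v] by (simp add: b_commute)
  also have "\<dots> \<ge> 0"
    using b_v_unitv_nonneg assms by (auto intro!: sum_nonneg mult_nonneg_nonneg simp: orthant_def)
  finally show ?thesis .
qed

text \<open>The root below is the image of \<open>unitv i\<close> under a transvection along the isotropic vector
  \<open>z\<close>; its coefficients solve \<open>q r = 1\<close>, an equation that is linear in the coefficient of \<open>z\<close>.\<close>
lemma isotropic_b_unitv_nonneg:
  assumes z: "z \<in> orthant X" "q z = 0" and i: "i \<in> X"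
  shows "0 \<le> b z (unitv i)"
proof (rule ccontr)
  assume "\<not> ?thesis"
  then obtain m where m: "b z (unitv i) = - m" "0 < m" by (metis add.inverse_inverse neg_0_less_iff_less not_le)
  define B c where "B = b v z" and "c = b v (unitv i)"
  have Bc: "0 \<le> B" "0 \<le> c" by (simp_all add: B_def c_def b_v_nonneg z b_v_unitv_nonneg i)
  \<comment> \<open>With this choice of \<alpha> and \<gamma> the coefficient of \<beta> in
    \<open>q r\<close> is \<alpha> * B - \<gamma> * m = -m, and m divides \<alpha>^2 + \<gamma>^2 +
    \<alpha> * \<gamma> * c - 1; \<beta> is the quotient.\<close>
  define \<alpha> \<gamma> \<beta> where "\<alpha> = m * m" and "\<gamma> = 1 + m * B"
    and "\<beta> = m * m * m + 2 * B + m * B * B + m * (1 + m * B) * c"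
  have pos: "1 \<le> \<alpha>" "0 \<le> \<beta>" "1 \<le> \<gamma>"
    using m Bc by (auto simp: \<alpha>_def \<beta>_def \<gamma>_def int_one_le_iff_zero_less)
  define r where "r = smul \<alpha> v + smul \<beta> z + smul \<gamma> (unitv i)"
  have "q r = \<alpha>\<^sup>2 + \<gamma>\<^sup>2 + \<alpha> * \<beta> * B + \<alpha> * \<gamma> * c - \<beta> * \<gamma> * m"
    by (simp add: r_def q_add q_smul q_unitv[OF i] b_simps m v_root z B_def c_def algebra_simps)
  also have "\<dots> = 1"
    by (simp add: \<alpha>_def \<beta>_def \<gamma>_def power2_eq_square algebra_simps)
  finally have "q r = 1" .
  moreover have "r \<in> orthant X"
    using pos i v_orthant z by (auto simp: r_def intro!: orthant_add orthant_smul orthant_unitv)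
  moreover have le: "v j \<le> \<alpha> * v j" "0 \<le> \<beta> * z j" for j
    using mult_right_mono[of 1 \<alpha> "v j"] pos orthant_nonneg[OF v_orthant, of j] orthant_nonneg[OF z(1), of j]
    by auto
  then have "v \<le> r"
  proof (intro le_funI)
    fix j
    show "v j \<le> r j" using le[of j] pos by (cases "j = i") (auto simp: r_def unitv_apply)
  qed
  ultimately have "r = v" using v_max by blast
  then show False using le[of i] pos by (auto simp: r_def unitv_apply fun_eq_iff dest!: spec[of _ i])
qed

lemma isotropic_b_nonneg:
  assumes z: "z \<in> orthant X" "q z = 0" and y: "y \<in> orthant X"
  shows "0 \<le> b z y"
proof -
  have "b z y = (\<Sum>i\<in>X. y i * b z (unitv i))"
    using b_expand[of y z] by (simp add: b_commute)
  also have "\<dots> \<ge> 0"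
    using isotropic_b_unitv_nonneg[OF z] y by (auto intro!: sum_nonneg mult_nonneg_nonneg simp: orthant_def)
  finally show ?thesis .
qed

lemma isotropic_b_v_pos:
  assumes z: "z \<in> orthant X" "q z = 0" "z \<noteq> 0"
  shows "0 < b v z"
proof (rule ccontr)
  assume "\<not> ?thesis"
  then have "b v z = 0" using b_v_nonneg[OF z(1)] by simp
  then have "q (v + z) = 1" by (simp add: q_add v_root z)
  then have "v + z = v" using z v_orthant
    using orthant_nonneg[OF z(1)] by (intro v_max orthant_add) (auto simp: le_fun_def)
  then show False using z(3) by simp
qed

end

section \<open>Slenderness and weak non-negativity\<close>

locale slender_max_root_form = max_root_form X M v for X :: "'v set" and M v +
  assumes slender: "\<And>i j. i \<in> X \<Longrightarrow> j \<in> X \<Longrightarrow> i \<noteq> j \<Longrightarrow> - 1 \<le> M i j + M j i"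
begin

text \<open>In a vector \<open>w\<close> of minimal height with \<open>q w < 0\<close> a maximal subroot \<open>y\<close> would have to
  satisfy \<open>w = y + unitv j\<close> with \<open>b y (unitv j) \<le> -3\<close>; slenderness forbids this unless
  there is an isotropic vector below \<open>w\<close>.\<close>
lemma isotropic_below_minimal_negative:
  assumes w: "w \<in> orthant X" "q w < 0"
    and minimal: "\<And>y. y \<in> orthant X \<Longrightarrow> y \<le> w \<Longrightarrow> y \<noteq> w \<Longrightarrow> 0 \<le> q y"
  shows "\<exists>z\<in>orthant X. z \<le> w \<and> z \<noteq> w \<and> q z = 0 \<and> z \<noteq> 0"
proof (rule ccontr)
  assume none: "\<not> ?thesis"
  have pos: "1 \<le> q y" if "y \<in> orthant X" "y \<le> w" "y \<noteq> w" "y \<noteq> 0" for y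
    using minimal[OF that(1-3)] none that by (metis int_one_le_iff_zero_less less_le)
  have below: "w - unitv i \<in> orthant X" "w - unitv i \<le> w" "w - unitv i \<noteq> w" if "i \<in> X" "0 < w i" for i
    using that w(1) by (auto simp: orthant_def unitv_apply le_fun_def fun_diff_def fun_eq_iff intro!: exI[of _ i])
  \<comment> \<open>Here \<open>q w + 1 - b w (unitv i)\<close> is non-negative by minimality while
    \<open>q w\<close> is at most -1.\<close>
  have bw: "b w (unitv i) \<le> 0" if "i \<in> X" "0 < w i" for i
    using minimal[OF below[OF that]] w(2) by (simp add: q_diff q_unitv that)
  define height :: "('v \<Rightarrow> int) \<Rightarrow> int" where "height y = sum y X" for y
  define roots where "roots = {y \<in> orthant X. y \<le> w \<and> q y = 1}"
  have "roots \<subseteq> {y. \<forall>i. (i \<in> X \<longrightarrow> y i \<in> (\<Union>i\<in>X. {0..w i})) \<and> (i \<notin> X \<longrightarrow> y i = 0)}"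
    by (fastforce simp: roots_def orthant_def le_fun_def)
  moreover have "finite \<dots>"
    using finX by (intro finite_set_of_finite_funs) auto
  ultimately have fin: "finite roots" by (rule finite_subset)
  have "w \<noteq> 0" using w(2) by auto
  then obtain i where i: "i \<in> X" "0 < w i" using w(1) by (auto simp: orthant_def fun_eq_iff less_le)
  then have "unitv i \<in> roots" using w(1) orthant_nonneg[OF w(1)]
    by (auto simp: roots_def orthant_unitv q_unitv le_fun_def unitv_apply int_one_le_iff_zero_less)
  then have "Max (height ` roots) \<in> height ` roots" using fin by (intro Max_in) auto
  then obtain y where y: "y \<in> roots" and "height y = Max (height ` roots)" by auto
  then have ymax: "height y' \<le> height y" if "y' \<in> roots" for y' using that fin by simp
  have yc: "y \<in> orthant X" "y \<le> w" "q y = 1" using y by (auto simp: roots_def)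
  have "w - y \<in> orthant X" using yc w(1) by (intro orthant_diff) (auto simp: le_fun_def)
  have "b w y = (\<Sum>i\<in>X. y i * b w (unitv i))" using b_expand[of y w] by (simp add: b_commute)
  also have "\<dots> \<le> 0"
  proof (rule sum_nonpos)
    fix i assume "i \<in> X"
    then show "y i * b w (unitv i) \<le> 0"
      using bw[of i] orthant_nonneg[OF yc(1), of i] le_funD[OF yc(2), of i]
      by (cases "y i = 0") (auto simp: mult_le_0_iff)
  qed
  finally have "b y (w - y) \<le> - 2" by (simp add: b_diff_right b_self yc b_commute)
  moreover have "b y (w - y) = (\<Sum>i\<in>X. (w - y) i * b y (unitv i))"
    using b_expand[of "w - y" y] by (simp add: b_commute)
  ultimately have "(\<Sum>i\<in>X. (w - y) i * b y (unitv i)) < 0" by simp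
  then obtain j where j: "j \<in> X" "(w - y) j * b y (unitv j) < 0" by (meson not_le sum_nonneg)
  then have j': "y j < w j" "b y (unitv j) \<le> - 1"
    using yc(2) by (auto simp: fun_diff_def le_fun_def mult_less_0_iff not_less dest: spec[of _ j])
  have yj: "y + unitv j \<in> orthant X" "y + unitv j \<le> w" "y + unitv j \<noteq> 0"
    using yc j j' orthant_nonneg[OF yc(1), of j]
    by (auto simp: orthant_add orthant_unitv le_fun_def unitv_apply fun_eq_iff intro!: exI[of _ j])
  have q_yj: "q (y + unitv j) = 2 + b y (unitv j)" by (simp add: q_add yc q_unitv j)
  have "y + unitv j = w"
  proof (rule ccontr)
    assume "y + unitv j \<noteq> w"
    then have "q (y + unitv j) = 1" using pos[OF yj(1,2) _ yj(3)] j' q_yj by simp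
    then have "y + unitv j \<in> roots" using yj by (simp add: roots_def)
    then have "height (y + unitv j) \<le> height y" by (rule ymax)
    then show False using j finX by (simp add: height_def sum.distrib unitv_def)
  qed
  then have b3: "b y (unitv j) \<le> - 3" and w_eq: "w = y + unitv j" using q_yj w(2) by auto
  \<comment> \<open>Removing from \<open>w\<close> a vertex k with \<open>b y (unitv k) > 0\<close>
    leaves a non-zero vector below \<open>w\<close> with value at most 3 - 3 - 1 + 1 = 0; the last 1
    is slenderness for j and k.\<close>
  have "(\<Sum>k\<in>X. y k * b y (unitv k)) = 2" using b_expand[of y y] by (simp add: b_commute b_self yc)
  then have "\<not> (\<Sum>k\<in>X. y k * b y (unitv k)) \<le> 0" by simp
  then obtain k where k: "k \<in> X" "0 < y k * b y (unitv k)" by (meson not_le sum_nonpos)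
  then have k': "0 < y k" "1 \<le> b y (unitv k)"
    using orthant_nonneg[OF yc(1), of k] by (auto simp: zero_less_mult_iff)
  have "k \<noteq> j" using b3 k' by auto
  have "w k > 0" using k' orthant_nonneg[OF yc(1), of j] w_eq by (cases "k = j") (auto simp: unitv_apply)
  note below_k = below[OF k(1) this]
  have "w - unitv k \<noteq> 0"
    using \<open>k \<noteq> j\<close> orthant_nonneg[OF yc(1), of j] by (auto simp: w_eq fun_eq_iff fun_diff_def unitv_apply intro!: exI[of _ j])
  then have "1 \<le> q (w - unitv k)" by (rule pos[OF below_k])
  moreover have "q (w - unitv k) = 3 + b y (unitv j) - b y (unitv k) - b (unitv j) (unitv k)"
    by (simp add: w_eq q_diff q_add q_unitv j k yc b_simps)
  moreover have "- 1 \<le> b (unitv j) (unitv k)" using slender \<open>k \<noteq> j\<close> j k by (simp add: b_unitv)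
  ultimately show False using b3 k' by simp
qed

text \<open>Induction on the height supplies a minimal negative \<open>w\<close>. Subtracting the
  isotropic \<open>z\<close> below it changes the value by \<open>- b w z\<close>, which is at most
  0, so \<open>w - z\<close> would be a smaller negative vector.\<close>

lemma weakly_nonneg_q: "w \<in> orthant X \<Longrightarrow> 0 \<le> q w"
proof (induction "nat (sum w X)" arbitrary: w rule: less_induct)
  case less
  show ?case
  proof (rule ccontr)
    assume neg: "\<not> 0 \<le> q w"
    have smaller: "0 \<le> q y" if y: "y \<in> orthant X" "y \<le> w" "y \<noteq> w" for y
    proof (rule less.hyps[OF _ y(1)])
      obtain i where i: "y i \<noteq> w i" using y(3) by auto
      then have "i \<in> X" using y(1) less.prems by (cases "i \<in> X") (auto simp: orthant_def)
      then have "sum y X < sum w X"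
        using finX y(2) i by (intro sum_strict_mono_ex1) (auto simp: le_fun_def less_le)
      moreover have "0 \<le> sum y X" using y(1) by (auto simp: orthant_def intro: sum_nonneg)
      ultimately show "nat (sum y X) < nat (sum w X)" by simp
    qed
    then obtain z where z: "z \<in> orthant X" "z \<le> w" "z \<noteq> w" "q z = 0" "z \<noteq> 0"
      using isotropic_below_minimal_negative[OF less.prems] neg by (metis not_le)
    have wz: "w - z \<in> orthant X" using z less.prems by (intro orthant_diff) (auto simp: le_fun_def)
    moreover have "w - z \<le> w" "w - z \<noteq> w"
      using orthant_nonneg[OF z(1)] z(5) by (auto simp: le_fun_def fun_diff_def fun_eq_iff)
    ultimately have "0 \<le> q (w - z)" by (rule smaller)
    moreover have "0 \<le> b z w" by (rule isotropic_b_nonneg[OF z(1,4) less.prems])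
    ultimately show False using neg z(4) by (simp add: q_diff b_commute)
  qed
qed

end

section \<open>Minimising a quadratic form over the simplex\<close>

text \<open>The index type may be infinite; the simplex is a closed part of a product of intervals
  and points, which is compact by Tychonoff.\<close>

lemma compact_simplex:
  fixes D :: "'i set"
  assumes "finite D"
  shows "compact {x :: 'i \<Rightarrow> real. (\<forall>i\<in>D. 0 \<le> x i) \<and> (\<forall>i. i \<notin> D \<longrightarrow> x i = 0) \<and> sum x D = 1}"
    (is "compact ?K")
proof -
  define B where "B = PiE (UNIV :: 'i set) (\<lambda>i. if i \<in> D then {0..1::real} else {0})"
  have "compactin (product_topology (\<lambda>i::'i. euclidean :: real topology) UNIV) B"
    unfolding B_def compactin_PiE by auto
  then have B: "compact B" by (simp add: euclidean_product_topology flip: compactin_euclidean_iff)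
  have "closed {x :: 'i \<Rightarrow> real. sum x D = 1}"
    by (intro closed_Collect_eq continuous_intros continuous_on_product_coordinates)
  then have "compact (B \<inter> {x. sum x D = 1})" by (rule compact_Int_closed[OF B])
  moreover have "?K = B \<inter> {x. sum x D = 1}"
  proof -
    have "x i \<le> 1" if "\<forall>i\<in>D. 0 \<le> x i" "sum x D = 1" "i \<in> D" for x :: "'i \<Rightarrow> real" and i
      using member_le_sum[of i D x] that assms by auto
    then show ?thesis by (fastforce simp: B_def PiE_def Pi_def split: if_splits)
  qed
  ultimately show ?thesis by simp
qed

lemma continuous_on_bform:
  fixes A :: "'i \<Rightarrow> 'i \<Rightarrow> real"
  shows "continuous_on K (\<lambda>x. bform D A x x)"
  unfolding bform_def
  by (intro continuous_intros; rule continuous_on_subset[OF continuous_on_product_coordinates]) auto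

definition supp_in :: "'i set \<Rightarrow> ('i \<Rightarrow> 'r::zero) \<Rightarrow> 'i set" where
  "supp_in D x = {i\<in>D. x i \<noteq> 0}"

definition probs :: "'i set \<Rightarrow> ('i \<Rightarrow> real) set" where
  "probs D = {x. (\<forall>i\<in>D. 0 \<le> x i) \<and> (\<forall>i. i \<notin> D \<longrightarrow> x i = 0) \<and> sum x D = 1}"

text \<open>Homogeneity of degree two. In this shape the bound can be applied to perturbed
  minimisers without renormalising them.\<close>

lemma bform_simplex_bound:
  assumes le: "\<And>y. y \<in> probs D \<Longrightarrow> l \<le> bform D A y y"
    and y: "\<And>i. i \<in> D \<Longrightarrow> 0 \<le> y i" and "finite D"
  shows "l * (sum y D)\<^sup>2 \<le> bform D A y y"
proof (cases "sum y D = 0")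
  case True
  then have "y i = 0" if "i \<in> D" for i using sum_nonneg_eq_0_iff[OF \<open>finite D\<close>, of y] y that by auto
  then have "bform D A y y = 0" by (simp add: bform_def)
  then show ?thesis using True by simp
next
  case False
  then have pos: "0 < sum y D" using sum_nonneg[of D y] y by (simp add: less_le)
  define z where "z = (\<lambda>i. if i \<in> D then y i / sum y D else 0)"
  have "z \<in> probs D" using y pos by (auto simp: probs_def z_def simp flip: sum_divide_distrib)
  then have "l \<le> bform D A z z" by (rule le)
  moreover have "bform D A y y = (sum y D)\<^sup>2 * bform D A z z"
  proof -
    have "bform D A y y = bform D A (smul (sum y D) z) (smul (sum y D) z)"
      using pos by (intro bform_cong) (auto simp: z_def)
    then show ?thesis by (simp add: bform_smul_left bform_smul_right power2_eq_square)
  qed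
  ultimately show ?thesis using pos by (simp add: mult.commute)
qed

text \<open>Compactness gives a minimiser. Choosing the smallest support among all minimisers later
  forces the zeros of the shifted form on that support to lie on a single line.\<close>

lemma exists_minimal_support_minimizer:
  fixes A :: "'i \<Rightarrow> 'i \<Rightarrow> real"
  assumes "finite D" "D \<noteq> {}"
  obtains x where "x \<in> probs D"
    and "\<And>y. (\<And>i. i \<in> D \<Longrightarrow> 0 \<le> y i) \<Longrightarrow> bform D A x x * (sum y D)\<^sup>2 \<le> bform D A y y"
    and "\<And>y. y \<in> probs D \<Longrightarrow> bform D A y y = bform D A x x \<Longrightarrow> card (supp_in D x) \<le> card (supp_in D y)"
proof -
  have "compact (probs D)" unfolding probs_def by (rule compact_simplex[OF assms(1)])
  moreover obtain d where "d \<in> D" using assms(2) by auto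
  then have "unitv d \<in> probs D" using assms(1) by (auto simp: probs_def unitv_def)
  then have "probs D \<noteq> {}" by auto
  ultimately obtain x0 where x0: "x0 \<in> probs D" "\<And>y. y \<in> probs D \<Longrightarrow> bform D A x0 x0 \<le> bform D A y y"
    using continuous_attains_inf[OF _ _ continuous_on_bform[of "probs D" D A]] by auto
  define P where "P x \<longleftrightarrow> x \<in> probs D \<and> bform D A x x = bform D A x0 x0" for x
  have "P x0" using x0 by (simp add: P_def)
  then obtain x where x: "P x" "\<And>y. P y \<Longrightarrow> card (supp_in D x) \<le> card (supp_in D y)"
    using ex_has_least_nat[of P x0 "\<lambda>x. card (supp_in D x)"] by auto
  show ?thesis
  proof (rule that[of x])
    show "x \<in> probs D" using x by (simp add: P_def)
    show "bform D A x x * (sum y D)\<^sup>2 \<le> bform D A y y" if "\<And>i. i \<in> D \<Longrightarrow> 0 \<le> y i" for y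
      using x0 x(1) that assms(1) by (intro bform_simplex_bound) (auto simp: P_def)
    show "card (supp_in D x) \<le> card (supp_in D y)" if "y \<in> probs D" "bform D A y y = bform D A x x" for y
      using x that by (simp add: P_def)
  qed
qed

text \<open>Approximate \<open>y\<close> by the integral vectors \<open>\<lfloor>n y\<rfloor>\<close>.\<close>
lemma copositive_real_if_copositive_nat:
  fixes G :: "'i \<Rightarrow> 'i \<Rightarrow> int"
  assumes cop: "\<And>y :: 'i \<Rightarrow> int. (\<And>i. 0 \<le> y i) \<Longrightarrow> 0 \<le> bform D G y y"
    and y: "\<And>i. i \<in> D \<Longrightarrow> 0 \<le> y i"
  shows "0 \<le> bform D (\<lambda>i j. real_of_int (G i j)) y y"
proof -
  define w where "w n i = (if i \<in> D then \<lfloor>real n * y i\<rfloor> else 0)" for n i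
  have lim: "(\<lambda>n. real_of_int (w n i) / real n) \<longlonglongrightarrow> y i" if "i \<in> D" for i
  proof -
    have "(\<lambda>n. real_of_int \<lfloor>real n * y i\<rfloor> / real n) \<longlonglongrightarrow> y i"
      by real_asymp
    then show ?thesis using that by (simp add: w_def)
  qed
  have "(\<lambda>n. bform D (\<lambda>i j. real_of_int (G i j)) (\<lambda>i. real_of_int (w n i) / real n) (\<lambda>i. real_of_int (w n i) / real n))
     \<longlonglongrightarrow> bform D (\<lambda>i j. real_of_int (G i j)) y y"
    unfolding bform_def by (intro tendsto_sum tendsto_mult tendsto_const lim)
  moreover have "0 \<le> bform D (\<lambda>i j. real_of_int (G i j)) (\<lambda>i. real_of_int (w n i) / real n) (\<lambda>i. real_of_int (w n i) / real n)" for n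
  proof -
    have "bform D (\<lambda>i j. real_of_int (G i j)) (\<lambda>i. real_of_int (w n i) / real n) (\<lambda>i. real_of_int (w n i) / real n)
       = real_of_int (bform D G (w n) (w n)) / (real n)\<^sup>2"
      by (simp add: bform_def power2_eq_square sum_divide_distrib)
    moreover have "0 \<le> bform D G (w n) (w n)" using y by (intro cop) (auto simp: w_def)
    ultimately show ?thesis by simp
  qed
  ultimately show ?thesis by (intro LIMSEQ_le_const) auto
qed


text \<open>First-order condition: for small steps the quadratic term, whatever its sign, is
  dominated by the linear one.\<close>

lemma nonneg_slope:
  fixes a c \<delta> :: real
  assumes "0 < \<delta>" and nn: "\<And>\<epsilon>. 0 \<le> \<epsilon> \<Longrightarrow> \<epsilon> \<le> \<delta> \<Longrightarrow> 0 \<le> \<epsilon> * a + \<epsilon>\<^sup>2 * c"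
  shows "0 \<le> a"
proof (rule ccontr)
  assume "\<not> 0 \<le> a"
  define \<epsilon> where "\<epsilon> = min \<delta> (- a / (2 * (\<bar>c\<bar> + 1)))"
  have \<epsilon>: "0 < \<epsilon>" "\<epsilon> \<le> \<delta>" using assms(1) \<open>\<not> 0 \<le> a\<close> by (auto simp: \<epsilon>_def intro!: divide_neg_pos)
  have "\<epsilon> * (\<bar>c\<bar> + 1) \<le> - a / (2 * (\<bar>c\<bar> + 1)) * (\<bar>c\<bar> + 1)"
    by (intro mult_right_mono) (auto simp: \<epsilon>_def)
  also have "\<dots> = - a / 2" by (simp add: field_simps)
  finally have "\<epsilon> * (\<bar>c\<bar> + 1) \<le> - a / 2" .
  moreover have "\<epsilon> * c \<le> \<epsilon> * (\<bar>c\<bar> + 1)" using \<epsilon> by (intro mult_left_mono) auto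
  ultimately have "a + \<epsilon> * c < 0" using \<open>\<not> 0 \<le> a\<close> by simp
  then have "\<epsilon> * (a + \<epsilon> * c) < 0" using \<epsilon> by (simp add: mult_pos_neg)
  then show False using nn[of \<epsilon>] \<epsilon> by (simp add: algebra_simps power2_eq_square)
qed

lemma exists_feasible_step:
  fixes x w :: "'i \<Rightarrow> real"
  assumes "finite D" "\<And>i. i \<in> D \<Longrightarrow> 0 \<le> x i" "\<And>i. i \<in> D \<Longrightarrow> w i < 0 \<Longrightarrow> 0 < x i"
  shows "\<exists>\<delta>>0. \<forall>e. 0 \<le> e \<longrightarrow> e \<le> \<delta> \<longrightarrow> (\<forall>i\<in>D. 0 \<le> x i + e * w i)"
  using assms
proof (induction D)
  case empty
  then show ?case by (intro exI[of _ 1]) auto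
next
  case (insert a D)
  then obtain \<delta> where \<delta>: "0 < \<delta>" "\<And>e i. 0 \<le> e \<Longrightarrow> e \<le> \<delta> \<Longrightarrow> i \<in> D \<Longrightarrow> 0 \<le> x i + e * w i"
    by (metis insertCI)
  obtain \<delta>' where \<delta>': "0 < \<delta>'" "\<And>e. 0 \<le> e \<Longrightarrow> e \<le> \<delta>' \<Longrightarrow> 0 \<le> x a + e * w a"
  proof (cases "w a < 0")
    case True
    then have "0 < x a" using insert.prems by simp
    show thesis
    proof (rule that[of "x a / (- w a)"])
      show "0 < x a / (- w a)" using True \<open>0 < x a\<close> by (intro divide_pos_pos) auto
      show "0 \<le> x a + e * w a" if "e \<le> x a / (- w a)" for e
        using that True by (simp add: field_simps)
    qed
  next
    case False
    then show thesis using insert.prems(1)[of a] by (intro that[of 1]) auto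
  qed
  show ?case using \<delta> \<delta>' by (intro exI[of _ "min \<delta> \<delta>'"]) auto
qed

section \<open>First- and second-order conditions at a minimiser of minimal support\<close>

locale copositive_minimum =
  fixes D :: "'i set" and A :: "'i \<Rightarrow> 'i \<Rightarrow> real" and x :: "'i \<Rightarrow> real" and l :: real
  assumes finD: "finite D" and symA: "\<And>i j. A i j = A j i"
    and x_probs: "x \<in> probs D" and l_eq: "bform D A x x = l"
    and l_le: "\<And>y. (\<And>i. i \<in> D \<Longrightarrow> 0 \<le> y i) \<Longrightarrow> l * (sum y D)\<^sup>2 \<le> bform D A y y"
    and l_supp: "\<And>y. y \<in> probs D \<Longrightarrow> bform D A y y = l \<Longrightarrow> card (supp_in D x) \<le> card (supp_in D y)"
begin

lemma x_nonneg: "0 \<le> x i" using x_probs by (cases "i \<in> D") (auto simp: probs_def)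

definition row :: "'i \<Rightarrow> real" where "row i = (\<Sum>j\<in>D. A i j * x j)"

lemma bform_row: "bform D A w x = (\<Sum>i\<in>D. w i * row i)"
  by (simp add: bform_def row_def sum_distrib_left mult_ac)

text \<open>The form \<open>bform D A y y - l * (sum y D)^2\<close> is non-negative on the orthant
  and vanishes at \<open>x\<close>. Expanding it around \<open>x\<close> leaves one linear and one
  quadratic term.\<close>

lemma bform_shift:
  "bform D A (x + smul e w) (x + smul e w) - l * (sum (x + smul e w) D)\<^sup>2
    = e * (2 * (\<Sum>i\<in>D. w i * (row i - l))) + e\<^sup>2 * (bform D A w w - l * (sum w D)\<^sup>2)"
proof -
  have 1: "sum (x + smul e w) D = 1 + e * sum w D"
    using x_probs by (simp add: probs_def sum.distrib sum_distrib_left)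
  have "bform D A x w = bform D A w x" by (rule bform_commute[OF symA])
  moreover have "bform D A w x = (\<Sum>i\<in>D. w i * row i)" by (rule bform_row)
  ultimately have "bform D A (x + smul e w) (x + smul e w)
      = l + 2 * e * (\<Sum>i\<in>D. w i * row i) + e\<^sup>2 * bform D A w w"
    by (simp add: bform_add_left bform_add_right bform_smul_left bform_smul_right l_eq
        power2_eq_square algebra_simps)
  moreover have "(\<Sum>i\<in>D. w i * (row i - l)) = (\<Sum>i\<in>D. w i * row i) - l * sum w D"
    by (simp add: algebra_simps sum_subtractf sum_distrib_left)
  ultimately show ?thesis unfolding 1 by (simp only:) (simp add: power2_eq_square algebra_simps)
qed

lemma shift_nonneg:
  assumes "\<And>i. i \<in> D \<Longrightarrow> 0 \<le> x i + e * w i"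
  shows "0 \<le> e * (2 * (\<Sum>i\<in>D. w i * (row i - l))) + e\<^sup>2 * (bform D A w w - l * (sum w D)\<^sup>2)"
  using l_le[of "x + smul e w"] assms bform_shift[of e w] by simp

text \<open>All Kuhn-Tucker conditions at once: a direction may decrease only coordinates at which
  \<open>x\<close> is positive. Unit vectors then give \<open>row_ge\<close>, and their negatives on
  the support give \<open>row_eq\<close>.\<close>

lemma slope_nonneg:
  assumes "\<And>i. i \<in> D \<Longrightarrow> w i < 0 \<Longrightarrow> 0 < x i"
  shows "0 \<le> (\<Sum>i\<in>D. w i * (row i - l))"
proof -
  have "\<exists>\<delta>>0. \<forall>e. 0 \<le> e \<longrightarrow> e \<le> \<delta> \<longrightarrow> (\<forall>i\<in>D. 0 \<le> x i + e * w i)"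
    by (rule exists_feasible_step[OF finD x_nonneg assms])
  then obtain \<delta> where "0 < \<delta>"
    and "\<forall>e. 0 \<le> e \<longrightarrow> e \<le> \<delta> \<longrightarrow> (\<forall>i\<in>D. 0 \<le> x i + e * w i)" by auto
  then have "0 \<le> e * (2 * (\<Sum>i\<in>D. w i * (row i - l))) + e\<^sup>2 * (bform D A w w - l * (sum w D)\<^sup>2)"
    if "0 \<le> e" "e \<le> \<delta>" for e using that by (intro shift_nonneg) blast
  then have "0 \<le> 2 * (\<Sum>i\<in>D. w i * (row i - l))"
    by (rule nonneg_slope[OF \<open>0 < \<delta>\<close>])
  then show ?thesis by simp
qed

lemma row_ge: 
  assumes "i \<in> D" shows "l \<le> row i"
proof -
  have "(\<Sum>j\<in>D. unitv i j * (row j - l)) = (\<Sum>j\<in>D. if j = i then row j - l else 0)"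
    by (intro sum.cong) (auto simp: unitv_apply)
  then show ?thesis
    using slope_nonneg[of "unitv i"] assms finD by (auto simp: unitv_apply split: if_splits)
qed

lemma row_eq: 
  assumes "i \<in> supp_in D x" shows "row i = l"
proof -
  have i: "i \<in> D" "0 < x i" using assms x_nonneg[of i] by (auto simp: supp_in_def less_le)
  have "(\<Sum>j\<in>D. smul (-1) (unitv i) j * (row j - l)) = (\<Sum>j\<in>D. if j = i then l - row j else 0)"
    by (intro sum.cong) (auto simp: unitv_apply)
  then have "row i \<le> l"
    using slope_nonneg[of "smul (-1) (unitv i)"] i finD by (simp add: unitv_apply split: if_splits)
  then show ?thesis using row_ge[OF i(1)] by simp
qed

lemma slope_supp: "(\<And>i. i \<notin> supp_in D x \<Longrightarrow> w i = 0) \<Longrightarrow> (\<Sum>i\<in>D. w i * (row i - l)) = 0"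
  using row_eq by (intro sum.neutral) (metis diff_self mult_eq_0_iff)

text \<open>On the support the linear term vanishes, so the shifted form stays 0 along
  \<open>x + e w\<close>. Stop when the first coordinate reaches 0: rescaled to the simplex, the end
  point would be a minimiser of smaller support. Hence it is 0 and \<open>w\<close> is a multiple of
  \<open>x\<close>.\<close>

lemma zero_with_negative_coordinate:
  assumes w: "\<And>i. i \<notin> supp_in D x \<Longrightarrow> w i = 0"
    and F0: "bform D A w w = l * (sum w D)\<^sup>2" and neg: "i0 \<in> D" "w i0 < 0"
  shows "\<exists>c. \<forall>i\<in>D. w i = c * x i"
proof -
  define N where "N = {i\<in>D. w i < 0}"
  define e where "e = Min ((\<lambda>i. x i / (- w i)) ` N)"
  have N: "finite N" "N \<noteq> {}" using finD neg by (auto simp: N_def)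
  then have "e \<in> (\<lambda>i. x i / (- w i)) ` N" unfolding e_def by (intro Min_in) auto
  then obtain i1 where i1: "i1 \<in> N" "e = x i1 / (- w i1)" by auto
  have xN: "0 < x i" if "i \<in> N" for i
    using w[of i] that x_nonneg[of i] by (auto simp: N_def supp_in_def less_le)
  then have "0 < e" using i1 by (auto simp: N_def intro!: divide_pos_pos simp del: divide_minus_right)
  define y where "y = x + smul e w"
  have ynn: "0 \<le> y i" if i: "i \<in> D" for i
  proof (cases "w i < 0")
    case True
    then have "e \<le> x i / (- w i)" unfolding e_def using N i by (intro Min_le) (auto simp: N_def)
    then show ?thesis using True by (simp add: field_simps y_def)
  next
    case False
    then show ?thesis using \<open>0 < e\<close> x_nonneg[of i] by (simp add: y_def)
  qed
  have y1: "y i1 = 0" using i1 by (auto simp: y_def N_def)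
  have Fy: "bform D A y y = l * (sum y D)\<^sup>2"
    using bform_shift[of e w] slope_supp[of w] w F0 by (simp add: y_def)
  have y0: "y i = 0" if "i \<notin> supp_in D x" "i \<in> D" for i
    using w that by (auto simp: y_def supp_in_def)
  have "sum y D = 0"
  proof (rule ccontr)
    assume "sum y D \<noteq> 0"
    define z where "z i = (if i \<in> D then y i / sum y D else 0)" for i
    have "0 < sum y D" using \<open>sum y D \<noteq> 0\<close> ynn by (simp add: less_le sum_nonneg)
    then have "z \<in> probs D"
      using ynn by (auto simp: probs_def z_def simp flip: sum_divide_distrib)
    moreover have "bform D A z z = l"
    proof -
      have "bform D A z z = bform D A (smul (1 / sum y D) y) (smul (1 / sum y D) y)"
        by (intro bform_cong) (auto simp: z_def)
      then show ?thesis using \<open>sum y D \<noteq> 0\<close> Fy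
        by (simp add: bform_smul_left bform_smul_right power2_eq_square)
    qed
    ultimately have "card (supp_in D x) \<le> card (supp_in D z)" by (rule l_supp)
    moreover have "card (supp_in D z) < card (supp_in D x)"
    proof (rule psubset_card_mono)
      show "finite (supp_in D x)" by (simp add: supp_in_def finD)
      have "z i = 0" if "i \<notin> supp_in D x" for i using y0[of i] that by (simp add: z_def)
      then have "supp_in D z \<subseteq> supp_in D x" unfolding supp_in_def by blast
      moreover have "i1 \<in> supp_in D x" "i1 \<notin> supp_in D z"
        using y1 xN[OF i1(1)] i1(1) by (simp_all add: supp_in_def z_def N_def)
      ultimately show "supp_in D z \<subset> supp_in D x" by blast
    qed
    ultimately show False by simp
  qed
  then have "y i = 0" if "i \<in> D" for i using ynn finD that by (simp add: sum_nonneg_eq_0_iff)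
  then have "x i + e * w i = 0" if "i \<in> D" for i using that by (simp add: y_def)
  then have "w i = (- 1 / e) * x i" if "i \<in> D" for i
    using \<open>0 < e\<close> that by (simp add: field_simps add_eq_0_iff)
  then show ?thesis by blast
qed

text \<open>\<open>x\<close> is interior to the face spanned by its support, so a short step in any
  direction of that face stays in the orthant, and the linear term of the step is 0.\<close>

lemma bform_supp_ge:
  assumes w: "\<And>i. i \<notin> supp_in D x \<Longrightarrow> w i = 0"
  shows "l * (sum w D)\<^sup>2 \<le> bform D A w w"
proof -
  have "0 < x i" if "w i < 0" for i
    using w[of i] that x_nonneg[of i] by (auto simp: supp_in_def less_le)
  then have "\<exists>\<delta>>0. \<forall>e. 0 \<le> e \<longrightarrow> e \<le> \<delta> \<longrightarrow> (\<forall>i\<in>D. 0 \<le> x i + e * w i)"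
    by (intro exists_feasible_step[OF finD x_nonneg])
  then obtain \<delta> where "0 < \<delta>" "\<forall>i\<in>D. 0 \<le> x i + \<delta> * w i" by auto
  then have "0 \<le> \<delta>\<^sup>2 * (bform D A w w - l * (sum w D)\<^sup>2)"
    using shift_nonneg[of \<delta> w] slope_supp[of w] w by simp
  then show ?thesis using \<open>0 < \<delta>\<close> by (simp add: zero_le_mult_iff)
qed

lemma zero_multiple:
  assumes w: "\<And>i. i \<notin> supp_in D x \<Longrightarrow> w i = 0" and F0: "bform D A w w = l * (sum w D)\<^sup>2"
  shows "\<exists>c. \<forall>i\<in>D. w i = c * x i"
proof (cases "\<forall>i\<in>D. w i = 0")
  case True
  then show ?thesis by (intro exI[of _ 0]) auto
next
  case False
  then obtain i where i: "i \<in> D" "w i \<noteq> 0" by auto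
  show ?thesis
  proof (cases "w i < 0")
    case True
    then show ?thesis using zero_with_negative_coordinate[OF w F0 i(1)] by simp
  next
    case False
    have "bform D A (smul (-1) w) (smul (-1) w) = l * (sum (smul (-1) w) D)\<^sup>2"
      unfolding bform_smul_left bform_smul_right using F0 by (simp add: sum_negf)
    then have "\<exists>c. \<forall>i\<in>D. smul (-1) w i = c * x i"
      by (rule zero_with_negative_coordinate[of _ i, rotated]) (use w i False in auto)
    then obtain c where "\<forall>i\<in>D. - w i = c * x i" by auto
    then have "\<forall>i\<in>D. w i = (- c) * x i" by (metis minus_mult_left minus_minus)
    then show ?thesis by blast
  qed
qed

end

section \<open>Equiangular lines with angle arccos (1/3)\<close>

lemma bform_diff_left: "bform X A (x - y) z = bform X A x z - bform X A y z"
  using bform_add_left[of X A "x - y" y z] by simp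

lemma bform_diff_right: "bform X A z (x - y) = bform X A z x - bform X A z y"
  using bform_add_right[of X A z "x - y" y] by simp

lemmas bform_linear = bform_add_left bform_add_right bform_diff_left bform_diff_right
  bform_smul_left bform_smul_right

text \<open>The Gram matrix of linearly independent vectors spanning equiangular lines with angle
  \<open>arccos (1/3)\<close>, together with a positive vector \<open>x\<close> having equal products with all of them.\<close>
locale equiangular =
  fixes S :: "'i set" and G :: "'i \<Rightarrow> 'i \<Rightarrow> int" and x :: "'i \<Rightarrow> real" and l :: real
  assumes finS: "finite S" and symG: "\<And>i j. G i j = G j i"
    and diag: "\<And>i. i \<in> S \<Longrightarrow> G i i = 3"
    and offdiag: "\<And>i j. i \<in> S \<Longrightarrow> j \<in> S \<Longrightarrow> odd (G i j) \<and> - 1 \<le> G i j"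
    and pd: "\<And>w i. (\<And>i. i \<notin> S \<Longrightarrow> w i = 0) \<Longrightarrow> w i \<noteq> 0 \<Longrightarrow> 0 < bform S G w w"
    and row: "\<And>i. i \<in> S \<Longrightarrow> (\<Sum>j\<in>S. of_int (G i j) * x j) = l"
    and x_pos: "\<And>i. i \<in> S \<Longrightarrow> 0 < x i" and x_sum: "sum x S = 1" and l_nonneg: "0 \<le> l"
begin

abbreviation ip :: "('i \<Rightarrow> int) \<Rightarrow> ('i \<Rightarrow> int) \<Rightarrow> int" where "ip \<equiv> bform S G"

lemma ip_unitv: "i \<in> S \<Longrightarrow> j \<in> S \<Longrightarrow> ip (unitv i) (unitv j) = G i j"
  by (rule bform_unitv_unitv[OF finS])

lemma ip_commute: "ip u w = ip w u" by (rule bform_commute[OF symG])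

text \<open>The norm 6 - 2 G i j of a difference of two basis vectors is positive.\<close>

lemma G_cases:
  assumes "i \<in> S" "j \<in> S" "i \<noteq> j"
  shows "G i j = 1 \<or> G i j = - 1"
proof -
  have "0 < ip (unitv i - unitv j) (unitv i - unitv j)"
    using assms by (intro pd[of _ i]) (auto simp: unitv_apply fun_diff_def)
  then have "G i j < 3" using assms by (simp add: bform_linear ip_unitv diag symG[of j i])
  moreover have "odd (G i j)" "- 1 \<le> G i j" using offdiag assms by auto
  ultimately show ?thesis by presburger
qed

text \<open>Integral combinations of the row equations. Every linear equation for \<open>x\<close>
  below comes from a well-chosen \<open>w\<close>.\<close>

lemma pairing:
  assumes w: "\<And>i. i \<notin> S \<Longrightarrow> w i = 0"
  shows "(\<Sum>j\<in>S. x j * of_int (ip w (unitv j))) = l * of_int (sum w S)"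
proof -
  have "(\<Sum>j\<in>S. x j * of_int (ip w (unitv j))) = (\<Sum>j\<in>S. \<Sum>i\<in>S. of_int (w i) * (of_int (G i j) * x j))"
  proof (rule sum.cong[OF refl])
    fix j assume "j \<in> S"
    then have "ip w (unitv j) = (\<Sum>i\<in>S. w i * G i j)"
      by (subst bform_expand_left[OF finS]) (simp add: ip_unitv)
    then show "x j * of_int (ip w (unitv j)) = (\<Sum>i\<in>S. of_int (w i) * (of_int (G i j) * x j))"
      by (simp add: sum_distrib_left mult_ac)
  qed
  also have "\<dots> = (\<Sum>i\<in>S. of_int (w i) * (\<Sum>j\<in>S. of_int (G i j) * x j))"
    by (subst sum.swap) (simp add: sum_distrib_left)
  also have "\<dots> = (\<Sum>i\<in>S. of_int (w i) * l)" by (intro sum.cong) (auto simp: row)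
  finally show ?thesis by (simp add: sum_distrib_left mult.commute)
qed

section \<open>Triangles, pillars and the relations between pillars\<close>

definition triangle :: "'i \<Rightarrow> 'i \<Rightarrow> 'i \<Rightarrow> bool" where
  "triangle a b c \<longleftrightarrow> a \<in> S \<and> b \<in> S \<and> c \<in> S \<and> G a b = - 1 \<and> G a c = - 1 \<and> G b c = - 1"

lemma triangle_perm: "triangle a b c \<Longrightarrow> triangle a c b" "triangle a b c \<Longrightarrow> triangle b a c"
  by (auto simp: triangle_def symG)

lemma triangle_distinct: "triangle a b c \<Longrightarrow> a \<noteq> b \<and> a \<noteq> c \<and> b \<noteq> c"
  using diag by (fastforce simp: triangle_def)

text \<open>Up to sign, every vector outside a triangle agrees with one of its three vertices
  in the sign pattern of its products with them (the pillars of Lemmens and Seidel).\<close>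
definition pillar :: "'i \<Rightarrow> 'i \<Rightarrow> 'i \<Rightarrow> 'i set" where
  "pillar a b c = {e \<in> S - {a, b, c}. G e b = - G e a \<and> G e c = - G e a}"

text \<open>With \<epsilon> = \<open>G e a\<close>, this is twice the component of \<epsilon> e
  orthogonal to a, b, c; the factor 2 keeps it integral. Its norm is 8.\<close>

definition shaft :: "'i \<Rightarrow> 'i \<Rightarrow> 'i \<Rightarrow> 'i \<Rightarrow> 'i \<Rightarrow> int" where
  "shaft a b c e = smul (2 * G e a) (unitv e) + (unitv b + unitv c)"

lemma pillar_commute: "pillar a b c = pillar a c b"
  by (auto simp: pillar_def)

lemma shaft_commute: "shaft a b c e = shaft a c b e"
  by (simp add: shaft_def add.commute)

lemma pillarD:
  assumes "triangle a b c" "e \<in> pillar a b c"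
  shows "e \<in> S" "e \<noteq> a" "e \<noteq> b" "e \<noteq> c" "G e a = 1 \<or> G e a = - 1" "G e b = - G e a" "G e c = - G e a"
  using assms G_cases[of e a] by (auto simp: pillar_def triangle_def)

text \<open>The only other sign pattern has three equal signs. As a + b + c has norm 3, the vector
  \<open>w = e - (G e a) (a + b + c)\<close> would then have norm 3 - 6 + 3 = 0.\<close>

lemma pillar_cover:
  assumes "triangle a b c"
  shows "S = {a, b, c} \<union> pillar a b c \<union> pillar b a c \<union> pillar c a b"
proof -
  note abc = assms[unfolded triangle_def]
  have "e \<in> pillar a b c \<union> pillar b a c \<union> pillar c a b" if e: "e \<in> S - {a, b, c}" for e
  proof (rule ccontr)
    assume not: "\<not> ?thesis"
    have pm: "G e a = 1 \<or> G e a = - 1" "G e b = 1 \<or> G e b = - 1" "G e c = 1 \<or> G e c = - 1"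
      using G_cases[of e a] G_cases[of e b] G_cases[of e c] e abc by auto
    then have same: "G e b = G e a \<and> G e c = G e a" using not e by (auto simp: pillar_def)
    define w where "w = unitv e + smul (- G e a) (unitv a + unitv b + unitv c)"
    have "0 < ip w w"
      using e abc pm by (intro pd[of _ e]) (auto simp: w_def unitv_apply)
    moreover have "ip w w = 3 - 3 * (G e a * G e a)"
      using e abc same
      by (simp add: w_def bform_linear ip_unitv diag symG[of a e] symG[of b e] symG[of c e] symG[of b a] symG[of c a] symG[of c b] algebra_simps)
    moreover have "G e a * G e a = 1" using pm by auto
    ultimately show False by simp
  qed
  then have "S - {a, b, c} \<subseteq> pillar a b c \<union> pillar b a c \<union> pillar c a b" by blast
  moreover have "pillar p q r \<subseteq> S" for p q r by (auto simp: pillar_def)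
  moreover have "a \<in> S" "b \<in> S" "c \<in> S" using abc by auto
  ultimately show ?thesis by blast
qed

lemma pillar_disjoint:
  assumes "triangle a b c"
  shows "pillar a b c \<inter> pillar b a c = {}"
proof (rule ccontr)
  assume "\<not> ?thesis"
  then obtain e where e: "e \<in> pillar a b c" "e \<in> pillar b a c" by auto
  then have "G e c = - G e a" "G e c = - G e b" "G e b = - G e a" by (auto simp: pillar_def)
  then show False using pillarD(5)[OF assms e(1)] by auto
qed

lemma shaft_outside: "triangle a b c \<Longrightarrow> e \<in> pillar a b c \<Longrightarrow> i \<notin> S \<Longrightarrow> shaft a b c e i = 0"
  by (auto simp: shaft_def unitv_apply pillar_def triangle_def)

lemma shaft_self: "triangle a b c \<Longrightarrow> e \<in> pillar a b c \<Longrightarrow> shaft a b c e e = 2 * G e a"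
  by (auto simp: shaft_def unitv_apply dest: pillarD)

lemma shaft_other:
  "triangle a b c \<Longrightarrow> e \<in> pillar a b c \<Longrightarrow> f \<noteq> e \<Longrightarrow> f \<noteq> b \<Longrightarrow> f \<noteq> c \<Longrightarrow> shaft a b c e f = 0"
  by (auto simp: shaft_def unitv_apply)

lemma ip_shaft_unitv:
  assumes t: "triangle a b c" and e: "e \<in> pillar a b c" and "f \<in> S"
  shows "ip (shaft a b c e) (unitv f) = 2 * G e a * G e f + G b f + G c f"
  using t pillarD(1)[OF t e] assms(3) by (simp add: shaft_def bform_linear ip_unitv triangle_def)

lemma ip_shaft_triangle:
  assumes t: "triangle a b c" and e: "e \<in> pillar a b c" and f: "f \<in> {a, b, c}"
  shows "ip (shaft a b c e) (unitv f) = 0"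
  using t f pillarD(5-7)[OF t e]
  by (auto simp: ip_shaft_unitv[OF t e] triangle_def symG[of b a] symG[of c a] symG[of c b] diag)

lemma ip_shaft_left:
  assumes t: "triangle a b c" and f: "f \<in> pillar a b c"
  shows "ip w (shaft a b c f) = 2 * G f a * ip w (unitv f) + ip w (unitv b) + ip w (unitv c)"
  by (simp add: shaft_def bform_linear)

lemma shaft_norm:
  assumes t: "triangle a b c" and e: "e \<in> pillar a b c"
  shows "ip (shaft a b c e) (shaft a b c e) = 8"
  using t pillarD[OF t e]
  by (auto simp: ip_shaft_left[OF t e] ip_shaft_triangle[OF t e] ip_shaft_unitv[OF t e] diag symG[of b e] symG[of c e])

text \<open>Two shafts of one pillar have product 0 or -8. As their norm is 8, the value -8 would
  make them opposite, against independence.\<close>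

lemma same_pillar:
  assumes t: "triangle a b c" and e: "e \<in> pillar a b c" and f: "f \<in> pillar a b c" and "e \<noteq> f"
  shows "G e a * G f a * G e f = 1"
proof (rule ccontr)
  assume n: "\<not> ?thesis"
  note E = pillarD[OF t e] and F = pillarD[OF t f]
  have "G e f = 1 \<or> G e f = - 1" using E F assms(4) by (intro G_cases)
  then have m: "G e a * G f a * G e f = - 1" using n E(5) F(5) by auto
  define w where "w = shaft a b c e + shaft a b c f"
  have "0 < ip w w"
  proof (rule pd[of _ e])
    show "w e \<noteq> 0" using E assms(4) by (auto simp: w_def shaft_self[OF t e] shaft_other[OF t f])
  qed (auto simp: w_def shaft_outside[OF t e] shaft_outside[OF t f])
  moreover have "ip (shaft a b c e) (shaft a b c f) = - 8"
    using E F m by (auto simp: ip_shaft_left[OF t f] ip_shaft_triangle[OF t e] ip_shaft_unitv[OF t e] symG[of b f] symG[of c f])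
  moreover have "ip (shaft a b c f) (shaft a b c e) = - 8" using calculation(2) ip_commute by simp
  ultimately show False by (simp add: w_def bform_linear shaft_norm[OF t e] shaft_norm[OF t f])
qed

lemma ip_shaft_pillar:
  assumes t: "triangle a b c" and e: "e \<in> pillar a b c" and f: "f \<in> pillar a b c" and "e \<noteq> f"
  shows "ip (shaft a b c e) (unitv f) = 0"
proof -
  have "G e a * G e f = G f a"
    using same_pillar[OF assms] pillarD(5)[OF t f] by (auto simp: mult_ac)
  then show ?thesis using pillarD(1,6,7)[OF t f]
    by (simp add: ip_shaft_unitv[OF t e] symG[of b f] symG[of c f] mult.assoc)
qed

lemma shaft_orthogonal:
  assumes t: "triangle a b c" and e: "e \<in> pillar a b c" and f: "f \<in> pillar a b c" and "e \<noteq> f"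
  shows "ip (shaft a b c e) (shaft a b c f) = 0"
  by (simp add: ip_shaft_left[OF t f] ip_shaft_pillar[OF assms] ip_shaft_triangle[OF t e])

text \<open>The sign of the angle between shafts of different pillars: their product is 4 times this
  number, a cosine of 1/2 or -1/2.\<close>

definition crs :: "'i \<Rightarrow> 'i \<Rightarrow> 'i \<Rightarrow> 'i \<Rightarrow> int" where
  "crs a e b f = G e a * G f b * G e f"

lemma crs_commute: "crs a e b f = crs b f a e"
  by (simp add: crs_def symG)

lemma crs_cases:
  assumes t: "triangle a b c" and e: "e \<in> pillar a b c" and f: "f \<in> pillar b a c"
  shows "crs a e b f = 1 \<or> crs a e b f = - 1"
proof -
  have "e \<noteq> f" using pillar_disjoint[OF t] e f by auto
  then have "G e f = 1 \<or> G e f = - 1"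
    using pillarD(1)[OF t e] pillarD(1)[OF triangle_perm(2)[OF t] f] by (intro G_cases)
  then show ?thesis
    using pillarD(5)[OF t e] pillarD(5)[OF triangle_perm(2)[OF t] f] by (auto simp: crs_def)
qed

lemma ip_shaft_cross:
  assumes t: "triangle a b c" and e: "e \<in> pillar a b c" and f: "f \<in> pillar b a c"
  shows "ip (shaft a b c e) (unitv f) = 2 * crs a e b f * G f b"
proof -
  note F = pillarD[OF triangle_perm(2)[OF t] f]
  have "G f b * G f b = 1" using F(5) by auto
  then have "crs a e b f * G f b = G e a * G e f" by (simp add: crs_def mult_ac)
  then show ?thesis using F by (simp add: ip_shaft_unitv[OF t e] symG[of b f] symG[of c f])
qed

lemma shaft_cross:
  assumes t: "triangle a b c" and e: "e \<in> pillar a b c" and f: "f \<in> pillar b a c"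
  shows "ip (shaft a b c e) (shaft b a c f) = 4 * crs a e b f" "ip (shaft b a c f) (shaft a b c e) = 4 * crs a e b f"
proof -
  note t' = triangle_perm(2)[OF t]
  have "G f b * G f b = 1" using pillarD(5)[OF t' f] by auto
  then show "ip (shaft a b c e) (shaft b a c f) = 4 * crs a e b f"
    by (simp add: ip_shaft_left[OF t' f] ip_shaft_triangle[OF t e] ip_shaft_cross[OF assms])
  then show "ip (shaft b a c f) (shaft a b c e) = 4 * crs a e b f" by (simp add: ip_commute)
qed

text \<open>Four orthogonal shafts at cosine 1/2 or -1/2 to the shaft of f exhaust its norm: twice
  that shaft equals their signed sum, as 32 + 32 - 64 = 0.\<close>

lemma no_4_1:
  assumes t: "triangle a b c" and E: "e1 \<in> pillar a b c" "e2 \<in> pillar a b c" "e3 \<in> pillar a b c" "e4 \<in> pillar a b c"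
    and d: "distinct [e1, e2, e3, e4]" and f: "f \<in> pillar b a c"
  shows False
proof -
  note t' = triangle_perm(2)[OF t]
  let ?u = "\<lambda>e. smul (crs a e b f) (shaft a b c e)"
  define w where "w = smul 2 (shaft b a c f) - (?u e1 + ?u e2 + ?u e3 + ?u e4)"
  have fd: "f \<noteq> e" if "e \<in> pillar a b c" for e using pillar_disjoint[OF t] f that by auto
  have "0 < ip w w"
  proof (rule pd[of _ f])
    show "w f \<noteq> 0" using pillarD[OF t' f] fd E
      by (auto simp: w_def shaft_self[OF t' f] shaft_other[OF t] fun_diff_def)
  qed (use shaft_outside[OF t] E shaft_outside[OF t' f] in \<open>auto simp: w_def fun_diff_def\<close>)
  moreover have "e2 \<noteq> e1" "e3 \<noteq> e1" "e4 \<noteq> e1" "e3 \<noteq> e2" "e4 \<noteq> e2" "e4 \<noteq> e3" using d by auto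
  then have "ip w w = 32 - 8 * (\<Sum>e\<leftarrow>[e1,e2,e3,e4]. crs a e b f * crs a e b f)"
    using d E f by (simp add: w_def bform_linear shaft_norm[OF t] shaft_norm[OF t'] shaft_orthogonal[OF t]
        shaft_cross[OF t] algebra_simps)
  moreover have "crs a e b f * crs a e b f = 1" if "e \<in> pillar a b c" for e
    using crs_cases[OF t that f] by auto
  ultimately show False using E by simp
qed

text \<open>The two rows of the 2 x 2 matrix of signs attached to e1 and e2, or equivalently its
  columns, must be orthogonal. If the columns were proportional, the combinations
  \<open>f1 + s f2\<close> and \<open>\<plusminus> e1 \<plusminus> e2\<close> of shafts would both
  have norm 16 and product 16, hence coincide.\<close>

lemma crs_2_2:
  assumes t: "triangle a b c" and E: "e1 \<in> pillar a b c" "e2 \<in> pillar a b c" "e1 \<noteq> e2"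
    and F: "f1 \<in> pillar b a c" "f2 \<in> pillar b a c" "f1 \<noteq> f2"
  shows "crs a e1 b f1 * crs a e1 b f2 + crs a e2 b f1 * crs a e2 b f2 = 0"
proof (rule ccontr)
  assume n: "\<not> ?thesis"
  note t' = triangle_perm(2)[OF t]
  note cc = crs_cases[OF t E(1) F(1)] crs_cases[OF t E(1) F(2)] crs_cases[OF t E(2) F(1)] crs_cases[OF t E(2) F(2)]
  define s where "s = crs a e1 b f1 * crs a e1 b f2"
  have s: "crs a e1 b f2 = s * crs a e1 b f1" "crs a e2 b f2 = s * crs a e2 b f1" "s * s = 1"
    using cc n unfolding s_def by auto
  let ?u = "\<lambda>e. smul (crs a e b f1) (shaft a b c e)"
  define w where "w = (shaft b a c f1 + smul s (shaft b a c f2)) - (?u e1 + ?u e2)"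
  have fd: "f1 \<noteq> e" if "e \<in> pillar a b c" for e using pillar_disjoint[OF t] F that by auto
  have "0 < ip w w"
  proof (rule pd[of _ f1])
    show "w f1 \<noteq> 0" using pillarD[OF t' F(1)] fd E F
      by (auto simp: w_def shaft_self[OF t'] shaft_other[OF t] shaft_other[OF t'] fun_diff_def)
  qed (use shaft_outside[OF t] E F shaft_outside[OF t'] in \<open>auto simp: w_def fun_diff_def\<close>)
  moreover have "ip w w = 8 + 8 * (s * s) + 8 * (crs a e1 b f1 * crs a e1 b f1 + crs a e2 b f1 * crs a e2 b f1)
     - 8 * (crs a e1 b f1 * crs a e1 b f1 + crs a e2 b f1 * crs a e2 b f1) * (1 + s * s)"
    using E F by (simp add: w_def bform_linear shaft_norm[OF t] shaft_norm[OF t'] shaft_orthogonal[OF t] shaft_orthogonal[OF t']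
        shaft_cross[OF t] s(1,2) algebra_simps)
  moreover have "crs a e1 b f1 * crs a e1 b f1 = 1" "crs a e2 b f1 * crs a e2 b f1 = 1" using cc by auto
  ultimately show False using s(3) by simp
qed

text \<open>The three signs have product 1. Otherwise the shafts could be signed to have pairwise
  products -4, and their sum would have norm 24 - 24 = 0.\<close>

lemma crs_1_1_1:
  assumes t: "triangle a b c" and e: "e \<in> pillar a b c" and f: "f \<in> pillar b a c" and h: "h \<in> pillar c a b"
  shows "crs a e c h = crs a e b f * crs b f c h"
proof (rule ccontr)
  assume n: "\<not> ?thesis"
  note t2 = triangle_perm(1)[OF t] and tb = triangle_perm(2)[OF t]
  note tc = triangle_perm(2)[OF t2] and tb2 = triangle_perm(1)[OF tb]
  note tc2 = triangle_perm(1)[OF tc]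
  have e': "e \<in> pillar a c b" and f': "f \<in> pillar b c a" and h': "h \<in> pillar c b a"
    using e f h pillar_commute by auto
  let ?p = "shaft a b c e" and ?q = "shaft b a c f" and ?r = "shaft c a b h"
  have ps: "?p = shaft a c b e" "?q = shaft b c a f" "?r = shaft c b a h" by (rule shaft_commute)+
  have pr: "ip ?p ?r = 4 * crs a e c h" "ip ?r ?p = 4 * crs a e c h"
    using shaft_cross[OF t2 e' h] ps by simp_all
  have qr: "ip ?q ?r = 4 * crs b f c h" "ip ?r ?q = 4 * crs b f c h"
    using shaft_cross[OF tb2 f' h'] ps by simp_all
  note cc = crs_cases[OF t e f] crs_cases[OF t2 e' h] crs_cases[OF tb2 f' h']
  define w where "w = ?p - (smul (crs a e b f) ?q + smul (crs a e c h) ?r)"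
  have d: "e \<noteq> f" "e \<noteq> h" using pillar_disjoint[OF t] pillar_disjoint[OF t2] e f e' h by auto
  have "0 < ip w w"
  proof (rule pd[of _ e])
    show "w e \<noteq> 0" using pillarD[OF t e] d f h
      by (auto simp: w_def shaft_self[OF t e] shaft_other[OF tb f] shaft_other[OF tc h] fun_diff_def)
  qed (auto simp: w_def fun_diff_def shaft_outside[OF t e] shaft_outside[OF tb f] shaft_outside[OF tc h])
  moreover have "ip w w = 8 + 8 * (crs a e b f * crs a e b f) + 8 * (crs a e c h * crs a e c h)
     - 8 * (crs a e b f * crs a e b f) - 8 * (crs a e c h * crs a e c h)
     + 8 * (crs a e b f * crs a e c h * crs b f c h)"
    by (simp add: w_def bform_linear shaft_norm[OF t e] shaft_norm[OF tb f] shaft_norm[OF tc h]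
        shaft_cross[OF t e f] pr qr algebra_simps)
  ultimately show False using cc n by auto
qed

text \<open>By \<open>crs_1_1_1\<close> the signs towards h are determined by those towards f. The
  signed sums over the pillar of a and over the other two pillars then both have norm 24 and product
  24.\<close>

lemma no_3_1_1:
  assumes t: "triangle a b c" and E: "e1 \<in> pillar a b c" "e2 \<in> pillar a b c" "e3 \<in> pillar a b c"
    and d: "distinct [e1, e2, e3]" and f: "f \<in> pillar b a c" and h: "h \<in> pillar c a b"
  shows False
proof -
  note t2 = triangle_perm(1)[OF t] and tb = triangle_perm(2)[OF t]
  note tc = triangle_perm(2)[OF t2] and tb2 = triangle_perm(1)[OF tb]
  have f': "f \<in> pillar b c a" and h': "h \<in> pillar c b a" using f h pillar_commute by auto
  have E': "e \<in> pillar a c b" if "e \<in> pillar a b c" for e using that pillar_commute by auto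
  let ?q = "shaft b a c f" and ?r = "shaft c a b h"
  have ps: "\<And>e. shaft a b c e = shaft a c b e" "?q = shaft b c a f" "?r = shaft c b a h" by (rule shaft_commute)+
  have pr: "ip (shaft a b c e) ?r = 4 * crs a e c h" "ip ?r (shaft a b c e) = 4 * crs a e c h"
    if "e \<in> pillar a b c" for e
    using shaft_cross[OF t2 E'[OF that] h] ps by simp_all
  have qr: "ip ?q ?r = 4 * crs b f c h" "ip ?r ?q = 4 * crs b f c h"
    using shaft_cross[OF tb2 f' h'] ps by simp_all
  let ?u = "\<lambda>e. smul (crs a e b f) (shaft a b c e)"
  define k where "k = crs b f c h"
  have kk: "k * k = 1" using crs_cases[OF tb2 f' h'] by (auto simp: k_def)
  have ch: "crs a e c h = crs a e b f * k" if "e \<in> pillar a b c" for e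
    using crs_1_1_1[OF t that f h] by (simp add: k_def)
  define w where "w = (?q + smul k ?r) - (?u e1 + ?u e2 + ?u e3)"
  have fd: "f \<noteq> e" if "e \<in> pillar a b c" for e using pillar_disjoint[OF t] f that by auto
  have "f \<noteq> h" using pillar_disjoint[OF tb2] f' h' by auto
  have "0 < ip w w"
  proof (rule pd[of _ f])
    show "w f \<noteq> 0" using pillarD[OF tb f] fd E \<open>f \<noteq> h\<close>
      by (auto simp: w_def shaft_self[OF tb f] shaft_other[OF t] shaft_other[OF tc h] fun_diff_def)
  qed (use shaft_outside[OF t] E shaft_outside[OF tb f] shaft_outside[OF tc h] in \<open>auto simp: w_def fun_diff_def\<close>)
  moreover have kk': "k * (k * z) = z" for z using kk by (simp flip: mult.assoc)
  have "e2 \<noteq> e1" "e3 \<noteq> e1" "e3 \<noteq> e2" using d by auto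
  then have "ip w w = 8 + 16 * (k * k)
     - 8 * (\<Sum>e\<leftarrow>[e1,e2,e3]. crs a e b f * crs a e b f)"
    using d E f kk by (simp add: w_def bform_linear shaft_norm[OF t] shaft_norm[OF tb f] shaft_norm[OF tc h] shaft_orthogonal[OF t]
        shaft_cross[OF t] pr qr ch flip: k_def) (simp add: algebra_simps kk kk')
  moreover have "crs a e b f * crs a e b f = 1" if "e \<in> pillar a b c" for e
    using crs_cases[OF t that f] by auto
  ultimately show False using E kk by simp
qed


section \<open>Linear equations for the coordinates of \<open>x\<close>\<close>

lemma finite_pillar: "finite (pillar a b c)"
  using finS by (simp add: pillar_def)

lemma sum_cover:
  fixes F :: "'i \<Rightarrow> 'a::comm_monoid_add"
  assumes t: "triangle a b c"
  shows "sum F S = F a + F b + F c + sum F (pillar a b c) + sum F (pillar b a c) + sum F (pillar c a b)"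
proof -
  note t2 = triangle_perm(1)[OF t] and tb = triangle_perm(2)[OF t]
  have d: "pillar a b c \<inter> pillar b a c = {}" "pillar a b c \<inter> pillar c a b = {}" "pillar b a c \<inter> pillar c a b = {}"
    using pillar_disjoint[OF t] pillar_disjoint[OF t2] pillar_disjoint[OF triangle_perm(1)[OF tb]]
    by (simp_all add: pillar_commute)
  have T: "{a, b, c} \<inter> (pillar a b c \<union> pillar b a c \<union> pillar c a b) = {}" by (auto simp: pillar_def)
  have "sum F S = sum F ({a, b, c} \<union> (pillar a b c \<union> pillar b a c \<union> pillar c a b))"
    using pillar_cover[OF t] by (simp add: Un_assoc)
  also have "\<dots> = sum F {a, b, c} + sum F (pillar a b c \<union> pillar b a c \<union> pillar c a b)"
    using T by (intro sum.union_disjoint) (simp_all add: finite_pillar)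
  also have "sum F (pillar a b c \<union> pillar b a c \<union> pillar c a b) = sum F (pillar a b c \<union> pillar b a c) + sum F (pillar c a b)"
    using d by (intro sum.union_disjoint) (auto simp: finite_pillar)
  also have "sum F (pillar a b c \<union> pillar b a c) = sum F (pillar a b c) + sum F (pillar b a c)"
    using d by (intro sum.union_disjoint) (auto simp: finite_pillar)
  finally show ?thesis using triangle_distinct[OF t] by (simp add: add_ac)
qed

lemma sum_unitv: "i \<in> S \<Longrightarrow> sum (unitv i :: 'i \<Rightarrow> int) S = 1"
  using finS by (simp add: unitv_def)

text \<open>Half of \<open>pairing\<close> for a shaft. The coordinates of a, b, c drop out by
  orthogonality, and so do those of the other members of the same pillar.\<close>

lemma pillar_equation:
  assumes t: "triangle a b c" and e: "e \<in> pillar a b c"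
  shows "2 * (of_int (G e a) * x e) + (\<Sum>f\<in>pillar b a c. of_int (crs a e b f) * (of_int (G f b) * x f))
     + (\<Sum>h\<in>pillar c a b. of_int (crs a e c h) * (of_int (G h c) * x h)) = l * (1 + of_int (G e a))"
proof -
  note t2 = triangle_perm(1)[OF t] and abc = t[unfolded triangle_def]
  note E = pillarD[OF t e]
  have e2: "e \<in> pillar a c b" using e by (simp add: pillar_commute)
  have own: "(\<Sum>f\<in>pillar a b c. x f * of_int (ip (shaft a b c e) (unitv f))) = 4 * (of_int (G e a) * x e)"
  proof -
    have "(\<Sum>f\<in>pillar a b c. x f * of_int (ip (shaft a b c e) (unitv f)))
        = (\<Sum>f\<in>pillar a b c. if f = e then 4 * (of_int (G e a) * x e) else 0)"
    proof (rule sum.cong[OF refl])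
      fix f assume f: "f \<in> pillar a b c"
      have "ip (shaft a b c e) (unitv e) = 4 * G e a"
        using E by (simp add: ip_shaft_unitv[OF t e] symG[of b e] symG[of c e] diag)
      then show "x f * of_int (ip (shaft a b c e) (unitv f)) = (if f = e then 4 * (of_int (G e a) * x e) else 0)"
        using ip_shaft_pillar[OF t e f] by (cases "f = e") auto
    qed
    then show ?thesis using e finite_pillar by simp
  qed
  have b: "(\<Sum>f\<in>pillar b a c. x f * of_int (ip (shaft a b c e) (unitv f)))
      = 2 * (\<Sum>f\<in>pillar b a c. of_int (crs a e b f) * (of_int (G f b) * x f))"
    unfolding sum_distrib_left by (intro sum.cong) (simp_all add: ip_shaft_cross[OF t e])
  have c: "(\<Sum>f\<in>pillar c a b. x f * of_int (ip (shaft a b c e) (unitv f)))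
      = 2 * (\<Sum>f\<in>pillar c a b. of_int (crs a e c f) * (of_int (G f c) * x f))"
    unfolding sum_distrib_left by (intro sum.cong)
      (simp_all add: shaft_commute[of a b c] ip_shaft_cross[OF t2 e2])
  have "(\<Sum>j\<in>S. x j * of_int (ip (shaft a b c e) (unitv j))) = l * of_int (sum (shaft a b c e) S)"
    by (rule pairing[OF shaft_outside[OF t e]])
  moreover have "sum (shaft a b c e) S = 2 * G e a + 2"
    using E abc sum_unitv[of e] sum_unitv[of b] sum_unitv[of c]
    by (simp add: shaft_def sum.distrib flip: sum_distrib_left)
  ultimately have "(\<Sum>j\<in>S. x j * of_int (ip (shaft a b c e) (unitv j))) = l * (2 * of_int (G e a) + 2)" by simp
  then show ?thesis
    unfolding sum_cover[OF t] own b c using ip_shaft_triangle[OF t e] by (simp add: algebra_simps)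
qed

lemma ip_triangle_pillar:
  assumes t: "triangle a b c" and e: "e \<in> pillar a b c"
  shows "ip (unitv a) (unitv e) = G e a" "ip (unitv b) (unitv e) = - G e a" "ip (unitv c) (unitv e) = - G e a"
  using t pillarD[OF t e] by (simp_all add: ip_unitv triangle_def symG[of a e] symG[of b e] symG[of c e])

text \<open>Pairing with a + b + c, combined with \<open>sum x S = 1\<close>, eliminates the
  coordinates of the triangle.\<close>

lemma total_equation:
  assumes t: "triangle a b c"
  shows "1 - 3 * l = (\<Sum>e\<in>pillar a b c. (1 + of_int (G e a)) * x e) + (\<Sum>f\<in>pillar b a c. (1 + of_int (G f b)) * x f)
     + (\<Sum>h\<in>pillar c a b. (1 + of_int (G h c)) * x h)"
proof -
  note abc = t[unfolded triangle_def]
  note t2 = triangle_perm(1)[OF t] and tb = triangle_perm(2)[OF t]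
  note tc = triangle_perm(2)[OF t2]
  define w :: "'i \<Rightarrow> int" where "w = unitv a + unitv b + unitv c"
  have "(\<Sum>j\<in>S. x j * of_int (ip w (unitv j))) = l * of_int (sum w S)"
    using abc by (intro pairing) (auto simp: w_def unitv_apply)
  moreover have "sum w S = 3" using abc by (simp add: w_def sum.distrib sum_unitv)
  ultimately have "(\<Sum>j\<in>S. x j * of_int (ip w (unitv j))) = l * 3" by simp
  moreover have "ip w (unitv a) = 1" "ip w (unitv b) = 1" "ip w (unitv c) = 1"
    using abc by (simp_all add: w_def bform_linear ip_unitv diag symG[of b a] symG[of c a] symG[of c b])
  moreover have "(\<Sum>e\<in>pillar a b c. x e * of_int (ip w (unitv e))) = - (\<Sum>e\<in>pillar a b c. of_int (G e a) * x e)"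
    unfolding sum_negf[symmetric] by (intro sum.cong) (simp_all add: w_def bform_linear ip_triangle_pillar[OF t])
  moreover have "(\<Sum>e\<in>pillar b a c. x e * of_int (ip w (unitv e))) = - (\<Sum>e\<in>pillar b a c. of_int (G e b) * x e)"
    unfolding sum_negf[symmetric] by (intro sum.cong) (simp_all add: w_def bform_linear ip_triangle_pillar[OF tb])
  moreover have "(\<Sum>e\<in>pillar c a b. x e * of_int (ip w (unitv e))) = - (\<Sum>e\<in>pillar c a b. of_int (G e c) * x e)"
    unfolding sum_negf[symmetric] by (intro sum.cong) (simp_all add: w_def bform_linear ip_triangle_pillar[OF tc])
  ultimately show ?thesis
    using x_sum unfolding sum_cover[OF t] by (simp add: algebra_simps sum.distrib)
qed

text \<open>Half of \<open>pairing\<close> for a + b, which is orthogonal to the pillars of a and of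
  b. It recovers the coordinates of the triangle in the exceptional case.\<close>

lemma edge_equation:
  assumes t: "triangle a b c"
  shows "x a + x b - x c - (\<Sum>h\<in>pillar c a b. of_int (G h c) * x h) = l"
proof -
  note abc = t[unfolded triangle_def]
  note t2 = triangle_perm(1)[OF t] and tb = triangle_perm(2)[OF t]
  note tc = triangle_perm(2)[OF t2]
  define w :: "'i \<Rightarrow> int" where "w = unitv a + unitv b"
  have "(\<Sum>j\<in>S. x j * of_int (ip w (unitv j))) = l * of_int (sum w S)"
    using abc by (intro pairing) (auto simp: w_def unitv_apply)
  moreover have "sum w S = 2" using abc by (simp add: w_def sum.distrib sum_unitv)
  ultimately have "(\<Sum>j\<in>S. x j * of_int (ip w (unitv j))) = l * 2" by simp
  moreover have "ip w (unitv a) = 2" "ip w (unitv b) = 2" "ip w (unitv c) = - 2"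
    using abc by (simp_all add: w_def bform_linear ip_unitv diag symG[of b a] symG[of c a] symG[of c b])
  moreover have "(\<Sum>e\<in>pillar a b c. x e * of_int (ip w (unitv e))) = 0"
    by (intro sum.neutral ballI) (simp_all add: w_def bform_linear ip_triangle_pillar[OF t])
  moreover have "(\<Sum>e\<in>pillar b a c. x e * of_int (ip w (unitv e))) = 0"
    by (intro sum.neutral ballI) (simp_all add: w_def bform_linear ip_triangle_pillar[OF tb])
  moreover have "(\<Sum>e\<in>pillar c a b. x e * of_int (ip w (unitv e))) = - 2 * (\<Sum>e\<in>pillar c a b. of_int (G e c) * x e)"
    unfolding sum_distrib_left by (intro sum.cong) (simp_all add: w_def bform_linear ip_triangle_pillar[OF tc])
  ultimately show ?thesis
    unfolding sum_cover[OF t] by (simp add: algebra_simps)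
qed

text \<open>A row without -1 dominates the total and gives \<open>1 \<le> l\<close>. Otherwise add
  the rows of j and k with G j k = -1: without triangles no other entry of the sum is negative, and
  entries j and k are 2, so each coordinate is at most \<open>l\<close>.\<close>

lemma bound_no_triangle:
  assumes no: "\<And>a b c. \<not> triangle a b c"
  shows "1 \<le> real (card S) * l \<or> 1 \<le> l"
proof (cases "\<exists>j\<in>S. \<forall>i\<in>S. G j i \<noteq> - 1")
  case True
  then obtain j where j: "j \<in> S" "\<And>i. i \<in> S \<Longrightarrow> G j i \<noteq> - 1" by auto
  have "1 \<le> G j i" if "i \<in> S" for i
    using j that diag[of j] G_cases[of j i] by (cases "i = j") auto
  then have "x i \<le> of_int (G j i) * x i" if "i \<in> S" for i
    using that x_pos[of i] by simp
  then have "sum x S \<le> (\<Sum>i\<in>S. of_int (G j i) * x i)" by (intro sum_mono)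
  then show ?thesis using row[OF j(1)] x_sum by simp
next
  case False
  have "x j \<le> l" if j: "j \<in> S" for j
  proof -
    obtain k where k: "k \<in> S" "G j k = - 1" using False j by auto
    then have "j \<noteq> k" using diag[of j] by auto
    have "(\<Sum>i\<in>S. if i = j \<or> i = k then 2 * x i else 0) \<le> (\<Sum>i\<in>S. of_int (G j i + G k i) * x i)"
    proof (intro sum_mono)
      fix i assume i: "i \<in> S"
      consider "i = j" | "i = k" | "i \<noteq> j" "i \<noteq> k" by auto
      then show "(if i = j \<or> i = k then 2 * x i else 0) \<le> of_int (G j i + G k i) * x i"
      proof cases
        case 3
        then have "\<not> (G j i = - 1 \<and> G k i = - 1)" using no[of j k i] j k i by (auto simp: triangle_def)
        then have "0 \<le> G j i + G k i" using G_cases[of j i] G_cases[of k i] 3 i j k by auto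
        then have "0 \<le> of_int (G j i + G k i) * x i" using x_pos[OF i] by (intro mult_nonneg_nonneg) auto
        then show ?thesis using 3 by simp
      qed (use k j diag symG[of k j] in auto)
    qed
    also have "\<dots> = 2 * l" using row[OF j] row[OF k(1)] by (simp add: algebra_simps sum.distrib)
    also have "(\<Sum>i\<in>S. if i = j \<or> i = k then 2 * x i else 0) = (\<Sum>i\<in>{j, k}. 2 * x i)"
      using finS j k by (intro sum.mono_neutral_cong_right) auto
    finally show ?thesis using \<open>j \<noteq> k\<close> x_pos[OF k(1)] by simp
  qed
  then have "sum x S \<le> real (card S) * l" by (rule sum_bounded_above)
  then show ?thesis using x_sum by simp
qed

text \<open>Origin of 2 n - 3. With one pillar the equations decouple: sign -1 would give coordinate
  0, so every sign is 1, every coordinate of the pillar is \<open>l\<close>, and 1 - 3 l = 2 (n - 3)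
  l.\<close>

lemma bound_one_pillar:
  assumes t: "triangle a b c" and e: "pillar b a c = {}" "pillar c a b = {}"
  shows "(2 * real (card S) - 3) * l = 1"
proof -
  have eq: "2 * (of_int (G e a) * x e) = l * (1 + of_int (G e a))" if "e \<in> pillar a b c" for e
    using pillar_equation[OF t that] e by simp
  have x_eq: "G e a = 1 \<and> x e = l" if "e \<in> pillar a b c" for e
  proof -
    have "G e a = 1 \<or> G e a = - 1" "0 < x e" using pillarD[OF t that] x_pos by auto
    then show ?thesis using eq[OF that] by auto
  qed
  then have "(\<Sum>e\<in>pillar a b c. (1 + of_int (G e a)) * x e) = (\<Sum>e\<in>pillar a b c. 2 * l)" by (intro sum.cong) auto
  then have "1 - 3 * l = 2 * (real (card (pillar a b c)) * l)"
    using total_equation[OF t] e by simp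
  moreover have "card S = 3 + card (pillar a b c)"
    using sum_cover[OF t, of "\<lambda>_. 1 :: nat"] e by simp
  ultimately show ?thesis by (simp add: algebra_simps)
qed

end

section \<open>Linear systems of the finitely many mixed pillar configurations\<close>

text \<open>In this group of lemmas s, r, p are the signs towards the triangle and t, u the signs
  between pillars; the digits in the names are pillar sizes. Fixing the signs makes each system
  linear. The constant 41 is not sharp; what counts later is 41 * 12 < 24^2. The pattern left open
  here is the one with 59 l = 1.\<close>

lemma star_3_1_bound:
  fixes x1 x2 x3 y l s1 s2 s3 r t1 t2 t3 :: real
  assumes "s1 = 1 \<or> s1 = -1" "s2 = 1 \<or> s2 = -1" "s3 = 1 \<or> s3 = -1" "r = 1 \<or> r = -1"
    and "t1 = 1 \<or> t1 = -1" "t2 = 1 \<or> t2 = -1" "t3 = 1 \<or> t3 = -1"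
    and "0 < x1" "0 < x2" "0 < x3" "0 < y"
    and "2 * (s1 * x1) + t1 * (r * y) = l * (1 + s1)" "2 * (s2 * x2) + t2 * (r * y) = l * (1 + s2)"
      "2 * (s3 * x3) + t3 * (r * y) = l * (1 + s3)"
      "2 * (r * y) + (t1 * (s1 * x1) + t2 * (s2 * x2) + t3 * (s3 * x3)) = l * (1 + r)"
      "1 - 3 * l = (1 + s1) * x1 + (1 + s2) * x2 + (1 + s3) * x3 + (1 + r) * y"
  shows "1 \<le> 41 * l \<or> (s1 = 1 \<and> s2 = 1 \<and> s3 = 1 \<and> r = 1 \<and> t1 = -1 \<and> t2 = -1 \<and> t3 = -1)"
  using assms(1-7) by (elim disjE; insert assms(8-), simp)

text \<open>The sign matrix T satisfies T T^t = 2, so X = a - T b / 2, which is at most 2 l + 2 l in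
  each coordinate, and similarly for Y. Right-hand sides in an interval avoid splitting over four
  more signs.\<close>

lemma star_2_2_solution:
  fixes X1 X2 Y1 Y2 a1 a2 b1 b2 l t11 t12 t21 t22 :: real
  assumes "t11 = 1 \<or> t11 = -1" "t12 = 1 \<or> t12 = -1" "t21 = 1 \<or> t21 = -1" "t22 = 1 \<or> t22 = -1"
    and orth: "t11 * t12 + t21 * t22 = 0"
    and bounds: "0 \<le> a1" "a1 \<le> 2 * l" "0 \<le> a2" "a2 \<le> 2 * l" "0 \<le> b1" "b1 \<le> 2 * l" "0 \<le> b2" "b2 \<le> 2 * l"
    and eqs: "2 * X1 + (t11 * Y1 + t12 * Y2) = a1" "2 * X2 + (t21 * Y1 + t22 * Y2) = a2"
      "2 * Y1 + (t11 * X1 + t21 * X2) = b1" "2 * Y2 + (t12 * X1 + t22 * X2) = b2"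
  shows "X1 \<le> 4 * l \<and> X2 \<le> 4 * l \<and> Y1 \<le> 4 * l \<and> Y2 \<le> 4 * l"
  using assms(1-4) orth by (elim disjE) (simp_all, (use eqs bounds in \<open>simp; linarith\<close>)+)

lemma star_2_2_bound:
  fixes x1 x2 y1 y2 l s1 s2 r1 r2 t11 t12 t21 t22 :: real
  assumes s: "s1 = 1 \<or> s1 = -1" "s2 = 1 \<or> s2 = -1" "r1 = 1 \<or> r1 = -1" "r2 = 1 \<or> r2 = -1"
    and t: "t11 = 1 \<or> t11 = -1" "t12 = 1 \<or> t12 = -1" "t21 = 1 \<or> t21 = -1" "t22 = 1 \<or> t22 = -1"
    and orth: "t11 * t12 + t21 * t22 = 0" and l: "0 \<le> l"
    and pos: "0 < x1" "0 < x2" "0 < y1" "0 < y2"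
    and eqs: "2 * (s1 * x1) + (t11 * (r1 * y1) + t12 * (r2 * y2)) = l * (1 + s1)"
      "2 * (s2 * x2) + (t21 * (r1 * y1) + t22 * (r2 * y2)) = l * (1 + s2)"
      "2 * (r1 * y1) + (t11 * (s1 * x1) + t21 * (s2 * x2)) = l * (1 + r1)"
      "2 * (r2 * y2) + (t12 * (s1 * x1) + t22 * (s2 * x2)) = l * (1 + r2)"
    and total: "1 - 3 * l = (1 + s1) * x1 + (1 + s2) * x2 + (1 + r1) * y1 + (1 + r2) * y2"
  shows "1 \<le> 41 * l"
proof -
  have "0 \<le> l * (1 + s) \<and> l * (1 + s) \<le> 2 * l" if "s = 1 \<or> s = -1" for s using that l by auto
  then have "s1 * x1 \<le> 4 * l \<and> s2 * x2 \<le> 4 * l \<and> r1 * y1 \<le> 4 * l \<and> r2 * y2 \<le> 4 * l"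
    by (intro star_2_2_solution[OF t orth _ _ _ _ _ _ _ _ eqs]) (use s in auto)
  moreover have "(1 + s) * x \<le> 8 * l" if "s = 1 \<or> s = -1" "s * x \<le> 4 * l" for s x
    using that l by auto
  ultimately have "(1 + s1) * x1 \<le> 8 * l" "(1 + s2) * x2 \<le> 8 * l" "(1 + r1) * y1 \<le> 8 * l" "(1 + r2) * y2 \<le> 8 * l"
    using s by blast+
  then show ?thesis using total by linarith
qed

lemma star_2_1_1_bound:
  fixes x1 x2 y z l s1 s2 r p t1 t2 u :: real
  assumes "s1 = 1 \<or> s1 = -1" "s2 = 1 \<or> s2 = -1" "r = 1 \<or> r = -1" "p = 1 \<or> p = -1"
    and "t1 = 1 \<or> t1 = -1" "t2 = 1 \<or> t2 = -1" "u = 1 \<or> u = -1"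
    and "0 < x1" "0 < x2" "0 < y" "0 < z"
    and "2 * (s1 * x1) + (t1 * (r * y) + t1 * u * (p * z)) = l * (1 + s1)"
      "2 * (s2 * x2) + (t2 * (r * y) + t2 * u * (p * z)) = l * (1 + s2)"
      "2 * (r * y) + (t1 * (s1 * x1) + t2 * (s2 * x2)) + u * (p * z) = l * (1 + r)"
      "2 * (p * z) + (t1 * u * (s1 * x1) + t2 * u * (s2 * x2)) + u * (r * y) = l * (1 + p)"
      "1 - 3 * l = (1 + s1) * x1 + (1 + s2) * x2 + (1 + r) * y + (1 + p) * z"
  shows "1 \<le> 41 * l"
  using assms(1-7) by (elim disjE; insert assms(8-), simp)

lemma star_2_1_bound:
  fixes x1 x2 y l s1 s2 r t1 t2 :: real
  assumes "s1 = 1 \<or> s1 = -1" "s2 = 1 \<or> s2 = -1" "r = 1 \<or> r = -1"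
    and "t1 = 1 \<or> t1 = -1" "t2 = 1 \<or> t2 = -1"
    and "0 < x1" "0 < x2" "0 < y"
    and "2 * (s1 * x1) + t1 * (r * y) = l * (1 + s1)" "2 * (s2 * x2) + t2 * (r * y) = l * (1 + s2)"
      "2 * (r * y) + (t1 * (s1 * x1) + t2 * (s2 * x2)) = l * (1 + r)"
      "1 - 3 * l = (1 + s1) * x1 + (1 + s2) * x2 + (1 + r) * y"
  shows "1 \<le> 41 * l"
  using assms(1-5) by (elim disjE; insert assms(6-), simp)

lemma star_1_1_1_bound:
  fixes x y z l s r p t u :: real
  assumes "s = 1 \<or> s = -1" "r = 1 \<or> r = -1" "p = 1 \<or> p = -1" "t = 1 \<or> t = -1" "u = 1 \<or> u = -1"
    and "0 < x" "0 < y" "0 < z"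
    and "2 * (s * x) + (t * (r * y) + t * u * (p * z)) = l * (1 + s)"
      "2 * (r * y) + t * (s * x) + u * (p * z) = l * (1 + r)"
      "2 * (p * z) + t * u * (s * x) + u * (r * y) = l * (1 + p)"
      "1 - 3 * l = (1 + s) * x + (1 + r) * y + (1 + p) * z"
  shows "1 \<le> 41 * l"
  using assms(1-5) by (elim disjE; insert assms(6-), simp)

lemma star_1_1_bound:
  fixes x y l s r t :: real
  assumes "s = 1 \<or> s = -1" "r = 1 \<or> r = -1" "t = 1 \<or> t = -1"
    and "0 < x" "0 < y"
    and "2 * (s * x) + t * (r * y) = l * (1 + s)" "2 * (r * y) + t * (s * x) = l * (1 + r)"
      "1 - 3 * l = (1 + s) * x + (1 + r) * y"
  shows "1 \<le> 41 * l"
  using assms(1-3) by (elim disjE; insert assms(4-), simp)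

context equiangular
begin

text \<open>The exclusions above leave the pillar sizes (n,0,0), (1,1,0), (1,1,1), (2,1,0), (2,1,1),
  (2,2,0) and (3,1,0). Only the last contains the exceptional solution.\<close>

lemma bound_sorted_pillars:
  assumes t: "triangle a b c"
    and sorted: "card (pillar c a b) \<le> card (pillar b a c)" "card (pillar b a c) \<le> card (pillar a b c)"
  shows "1 \<le> 41 * l \<or> (2 * real (card S) - 3) * l = 1 \<or> (59 * l = 1 \<and> (\<forall>s\<in>S. 59 * x s \<in> {6, 10, 15}))"
proof (cases "pillar b a c = {}")
  case True
  then have "pillar c a b = {}" using sorted finite_pillar by simp
  then show ?thesis using bound_one_pillar[OF t True] by simp
next
  case False
  note t2 = triangle_perm(1)[OF t] and tb = triangle_perm(2)[OF t]
  note tc = triangle_perm(2)[OF t2] and tb2 = triangle_perm(1)[OF tb]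
  have perm: "pillar a c b = pillar a b c" "pillar b c a = pillar b a c" "pillar c b a = pillar c a b"
    by (simp_all add: pillar_commute)
  have crs_perm: "crs b f a e = crs a e b f" "crs c h a e = crs a e c h" "crs c h b f = crs b f c h" for e f h
    by (rule crs_commute)+
  have sg: "real_of_int (G e a) = 1 \<or> real_of_int (G e a) = - 1" "0 < x e" if "e \<in> pillar a b c" for e
    using pillarD[OF t that] x_pos by auto
  have sgb: "real_of_int (G f b) = 1 \<or> real_of_int (G f b) = - 1" "0 < x f" if "f \<in> pillar b a c" for f
    using pillarD[OF tb that] x_pos by auto
  have sgc: "real_of_int (G h c) = 1 \<or> real_of_int (G h c) = - 1" "0 < x h" if "h \<in> pillar c a b" for h
    using pillarD[OF tc that] x_pos by auto
  have cr: "real_of_int (crs a e b f) = 1 \<or> real_of_int (crs a e b f) = - 1"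
    if "e \<in> pillar a b c" "f \<in> pillar b a c" for e f
    using crs_cases[OF t that] by auto
  have crb: "real_of_int (crs b f c h) = 1 \<or> real_of_int (crs b f c h) = - 1"
    if "f \<in> pillar b a c" "h \<in> pillar c a b" for f h
    using crs_cases[OF tb2, of f h] that by (auto simp: perm)
  have eqa: "2 * (of_int (G e a) * x e) + (\<Sum>f\<in>pillar b a c. of_int (crs a e b f) * (of_int (G f b) * x f))
     + (\<Sum>h\<in>pillar c a b. of_int (crs a e c h) * (of_int (G h c) * x h)) = l * (1 + of_int (G e a))"
    if "e \<in> pillar a b c" for e by (rule pillar_equation[OF t that])
  have eqb: "2 * (of_int (G f b) * x f) + (\<Sum>e\<in>pillar a b c. of_int (crs a e b f) * (of_int (G e a) * x e))
     + (\<Sum>h\<in>pillar c a b. of_int (crs b f c h) * (of_int (G h c) * x h)) = l * (1 + of_int (G f b))"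
    if "f \<in> pillar b a c" for f using pillar_equation[OF tb that] by (simp add: perm crs_perm)
  have eqc: "2 * (of_int (G h c) * x h) + (\<Sum>e\<in>pillar a b c. of_int (crs a e c h) * (of_int (G e a) * x e))
     + (\<Sum>f\<in>pillar b a c. of_int (crs b f c h) * (of_int (G f b) * x f)) = l * (1 + of_int (G h c))"
    if "h \<in> pillar c a b" for h using pillar_equation[OF tc that] by (simp add: perm crs_perm)
  note tot = total_equation[OF t]
  obtain f where f: "f \<in> pillar b a c" using False by auto
  have n0: "card (pillar b a c) \<noteq> 0" using f finite_pillar by auto
  \<comment> \<open>Two such f would give three pairwise orthogonal sign vectors of length
    2.\<close>
  have no2: "f1 = f2" if "e1 \<in> pillar a b c" "e2 \<in> pillar a b c" "e3 \<in> pillar a b c" "distinct [e1, e2, e3]"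
      "f1 \<in> pillar b a c" "f2 \<in> pillar b a c" for e1 e2 e3 f1 f2
  proof (rule ccontr)
    assume ne: "f1 \<noteq> f2"
    have "crs a e1 b f1 * crs a e1 b f2 + crs a e2 b f1 * crs a e2 b f2 = 0"
      "crs a e1 b f1 * crs a e1 b f2 + crs a e3 b f1 * crs a e3 b f2 = 0"
      "crs a e2 b f1 * crs a e2 b f2 + crs a e3 b f1 * crs a e3 b f2 = 0"
      using that ne by (auto intro!: crs_2_2[OF t])
    then have "crs a e1 b f1 * crs a e1 b f2 = 0" by linarith
    then show False using crs_cases[OF t that(1,5)] crs_cases[OF t that(1,6)] by auto
  qed
  have "card (pillar a b c) \<le> 3"
  proof (rule ccontr)
    assume "\<not> ?thesis"
    then obtain T where "T \<subseteq> pillar a b c" "card T = 4" using obtain_subset_with_card_n[of 4 "pillar a b c"] by auto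
    then have "card T = Suc 3" by simp
    then obtain e1 T' where "T = insert e1 T'" "e1 \<notin> T'" "card T' = 3" unfolding card_Suc_eq by blast
    then obtain e2 e3 e4 where "distinct [e1, e2, e3, e4]" "{e1, e2, e3, e4} \<subseteq> pillar a b c"
      using \<open>T \<subseteq> pillar a b c\<close> by (auto simp: card_3_iff)
    then show False using no_4_1[OF t, of e1 e2 e3 e4 f] f by auto
  qed
  then consider "card (pillar a b c) = 1" | "card (pillar a b c) = 2" | "card (pillar a b c) = 3"
    using n0 sorted by linarith
  then show ?thesis
  proof cases
    case 1
    then obtain e where A: "pillar a b c = {e}" by (auto simp: card_1_singleton_iff)
    have B: "pillar b a c = {f}" using f 1 n0 sorted by (auto simp: card_1_singleton_iff dest!: le_antisym)
    have ef: "e \<in> pillar a b c" "f \<in> pillar b a c" using A B by auto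
    show ?thesis
    proof (cases "pillar c a b = {}")
      case True
      have "1 \<le> 41 * l"
        by (rule star_1_1_bound[OF sg(1)[OF ef(1)] sgb(1)[OF ef(2)] cr[OF ef] sg(2)[OF ef(1)] sgb(2)[OF ef(2)]])
          (use eqa[OF ef(1)] eqb[OF ef(2)] tot in \<open>simp_all add: A B True\<close>)
      then show ?thesis ..
    next
      case False
      then have "card (pillar c a b) = 1" using sorted B finite_pillar[of c a b] by (simp add: le_Suc_eq)
      then obtain h where C: "pillar c a b = {h}" by (auto simp: card_1_singleton_iff)
      have h: "h \<in> pillar c a b" using C by simp
      have ch: "crs a e c h = crs a e b f * crs b f c h" by (rule crs_1_1_1[OF t ef h])
      have "1 \<le> 41 * l"
        by (rule star_1_1_1_bound[OF sg(1)[OF ef(1)] sgb(1)[OF ef(2)] sgc(1)[OF h] cr[OF ef] crb[OF ef(2) h]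
              sg(2)[OF ef(1)] sgb(2)[OF ef(2)] sgc(2)[OF h]])
          (use eqa[OF ef(1)] eqb[OF ef(2)] eqc[OF h] tot in \<open>simp_all add: A B C ch\<close>)
      then show ?thesis ..
    qed
  next
    case 2
    then obtain e1 e2 where A: "pillar a b c = {e1, e2}" "e1 \<noteq> e2" by (auto simp: card_2_iff)
    have e: "e1 \<in> pillar a b c" "e2 \<in> pillar a b c" using A by auto
    have "card (pillar b a c) = 1 \<or> card (pillar b a c) = 2" using n0 2 sorted by linarith
    then show ?thesis
    proof
      assume "card (pillar b a c) = 1"
      then have B: "pillar b a c = {f}" using f by (auto simp: card_1_singleton_iff)
      show ?thesis
      proof (cases "pillar c a b = {}")
        case True
        have "1 \<le> 41 * l"
          by (rule star_2_1_bound[OF sg(1)[OF e(1)] sg(1)[OF e(2)] sgb(1)[OF f] cr[OF e(1) f] cr[OF e(2) f]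
                sg(2)[OF e(1)] sg(2)[OF e(2)] sgb(2)[OF f]])
            (use eqa[OF e(1)] eqa[OF e(2)] eqb[OF f] tot A(2) in \<open>simp_all add: A(1) B True\<close>)
        then show ?thesis ..
      next
        case False
        then have "card (pillar c a b) = 1" using sorted B finite_pillar[of c a b] by (simp add: le_Suc_eq)
        then obtain h where C: "pillar c a b = {h}" by (auto simp: card_1_singleton_iff)
        have h: "h \<in> pillar c a b" using C by simp
        have ch: "crs a e1 c h = crs a e1 b f * crs b f c h" "crs a e2 c h = crs a e2 b f * crs b f c h"
          using crs_1_1_1[OF t _ f h] e by auto
        have "1 \<le> 41 * l"
          by (rule star_2_1_1_bound[OF sg(1)[OF e(1)] sg(1)[OF e(2)] sgb(1)[OF f] sgc(1)[OF h] cr[OF e(1) f] cr[OF e(2) f]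
                crb[OF f h] sg(2)[OF e(1)] sg(2)[OF e(2)] sgb(2)[OF f] sgc(2)[OF h]])
            (use eqa[OF e(1)] eqa[OF e(2)] eqb[OF f] eqc[OF h] tot A(2) in \<open>simp_all add: A(1) B C ch\<close>)
        then show ?thesis ..
      qed
    next
      assume "card (pillar b a c) = 2"
      then obtain f1 f2 where B: "pillar b a c = {f1, f2}" "f1 \<noteq> f2" by (auto simp: card_2_iff)
      have f: "f1 \<in> pillar b a c" "f2 \<in> pillar b a c" using B by auto
      have orth: "crs a e1 b f1 * crs a e1 b f2 + crs a e2 b f1 * crs a e2 b f2 = 0"
        by (rule crs_2_2[OF t e A(2) f B(2)])
      \<comment> \<open>An h in the third pillar would make the signs towards f1 and f2 proportional
        by \<open>crs_1_1_1\<close>, contradicting \<open>orth\<close>.\<close>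
      have C: "pillar c a b = {}"
      proof (rule ccontr)
        assume "\<not> ?thesis"
        then obtain h where h: "h \<in> pillar c a b" by auto
        have "crs a e b f1 * crs b f1 c h = crs a e b f2 * crs b f2 c h" if "e \<in> pillar a b c" for e
          using crs_1_1_1[OF t that f(1) h] crs_1_1_1[OF t that f(2) h] by simp
        from this[OF e(1)] this[OF e(2)] show False
          using orth crs_cases[OF t e(1) f(1)] crs_cases[OF t e(1) f(2)] crs_cases[OF t e(2) f(1)]
            crs_cases[OF t e(2) f(2)] crs_cases[OF tb2, of f1 h]
            crs_cases[OF tb2, of f2 h] f h by (auto simp: perm)
      qed
      have "real_of_int (crs a e1 b f1) * real_of_int (crs a e1 b f2) + real_of_int (crs a e2 b f1) * real_of_int (crs a e2 b f2) = 0"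
        using orth by (simp flip: of_int_mult of_int_add)
      then have "1 \<le> 41 * l"
        by (intro star_2_2_bound[OF sg(1)[OF e(1)] sg(1)[OF e(2)] sgb(1)[OF f(1)] sgb(1)[OF f(2)]
              cr[OF e(1) f(1)] cr[OF e(1) f(2)] cr[OF e(2) f(1)] cr[OF e(2) f(2)] _ l_nonneg
              sg(2)[OF e(1)] sg(2)[OF e(2)] sgb(2)[OF f(1)] sgb(2)[OF f(2)]])
          (use eqa[OF e(1)] eqa[OF e(2)] eqb[OF f(1)] eqb[OF f(2)] tot A(2) B(2) in \<open>simp_all add: A(1) B(1) C\<close>)
      then show ?thesis ..
    qed
  next
    case 3
    then obtain e1 e2 e3 where A: "pillar a b c = {e1, e2, e3}" and d: "distinct [e1, e2, e3]" by (auto simp: card_3_iff)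
    have e: "e1 \<in> pillar a b c" "e2 \<in> pillar a b c" "e3 \<in> pillar a b c" using A by auto
    have B: "pillar b a c = {f}" using f no2[OF e d] by auto
    have C: "pillar c a b = {}" using no_3_1_1[OF t e d f] by auto
    note E1 = eqa[OF e(1)] and E2 = eqa[OF e(2)] and E3 = eqa[OF e(3)]
    have F: "2 * (of_int (G f b) * x f) + (of_int (crs a e1 b f) * (of_int (G e1 a) * x e1)
        + of_int (crs a e2 b f) * (of_int (G e2 a) * x e2) + of_int (crs a e3 b f) * (of_int (G e3 a) * x e3))
        = l * (1 + of_int (G f b))"
      using eqb[OF f] d by (simp add: A C)
    have T: "1 - 3 * l = (1 + of_int (G e1 a)) * x e1 + (1 + of_int (G e2 a)) * x e2 + (1 + of_int (G e3 a)) * x e3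
        + (1 + of_int (G f b)) * x f"
      using tot d by (simp add: A B C)
    have "1 \<le> 41 * l \<or> real_of_int (G e1 a) = 1 \<and> real_of_int (G e2 a) = 1 \<and> real_of_int (G e3 a) = 1 \<and> real_of_int (G f b) = 1
       \<and> real_of_int (crs a e1 b f) = - 1 \<and> real_of_int (crs a e2 b f) = - 1 \<and> real_of_int (crs a e3 b f) = - 1"
      by (rule star_3_1_bound[OF sg(1)[OF e(1)] sg(1)[OF e(2)] sg(1)[OF e(3)] sgb(1)[OF f]
            cr[OF e(1) f] cr[OF e(2) f] cr[OF e(3) f] sg(2)[OF e(1)] sg(2)[OF e(2)] sg(2)[OF e(3)] sgb(2)[OF f] _ _ _ F T])
        (use E1 E2 E3 in \<open>simp_all add: B C\<close>)
    then show ?thesis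
    proof
      assume "1 \<le> 41 * l" then show ?thesis ..
    next
      assume signs: "real_of_int (G e1 a) = 1 \<and> real_of_int (G e2 a) = 1 \<and> real_of_int (G e3 a) = 1 \<and> real_of_int (G f b) = 1
       \<and> real_of_int (crs a e1 b f) = - 1 \<and> real_of_int (crs a e2 b f) = - 1 \<and> real_of_int (crs a e3 b f) = - 1"
      have r: "2 * x e1 - x f = 2 * l" "2 * x e2 - x f = 2 * l" "2 * x e3 - x f = 2 * l"
        "2 * x f - (x e1 + x e2 + x e3) = 2 * l" "1 - 3 * l = 2 * x e1 + 2 * x e2 + 2 * x e3 + 2 * x f"
        using signs E1 E2 E3 F T by (simp_all add: B C)
      \<comment> \<open>Here a, e1, e2, e3 and b, f form cliques with entry 1, and c is alone. The
        weights 6, 10, 15 are constant on them: 4 * 6 + 2 * 10 + 15 = 59.\<close>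
      have "x a + x b - x c = l" using edge_equation[OF t] by (simp add: C)
      moreover have "x a + x c - x b - x f = l" using edge_equation[OF t2] signs by (simp add: perm B)
      moreover have "x b + x c - x a - (x e1 + x e2 + x e3) = l" using edge_equation[OF tb2] signs d by (simp add: perm A)
      ultimately have "59 * l = 1" "59 * x a = 6" "59 * x b = 10" "59 * x c = 15" "59 * x e1 = 6" "59 * x e2 = 6"
        "59 * x e3 = 6" "59 * x f = 10" using r by linarith+
      then have "59 * l = 1 \<and> (\<forall>s\<in>S. 59 * x s \<in> {6, 10, 15})"
        by (subst pillar_cover[OF t]) (simp add: A B C)
      then show ?thesis by simp
    qed
  qed
qed

lemma bound_triangle:
  assumes t: "triangle a b c"
  shows "1 \<le> 41 * l \<or> (2 * real (card S) - 3) * l = 1 \<or> (59 * l = 1 \<and> (\<forall>s\<in>S. 59 * x s \<in> {6, 10, 15}))"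
proof -
  note t2 = triangle_perm(1)[OF t] and tb = triangle_perm(2)[OF t]
  note tc = triangle_perm(2)[OF t2] and tb2 = triangle_perm(1)[OF tb]
  note tc2 = triangle_perm(1)[OF tc]
  have perm: "pillar a c b = pillar a b c" "pillar b c a = pillar b a c" "pillar c b a = pillar c a b"
    by (simp_all add: pillar_commute)
  note bounds = bound_sorted_pillars[OF t] bound_sorted_pillars[OF t2] bound_sorted_pillars[OF tb]
    bound_sorted_pillars[OF tb2] bound_sorted_pillars[OF tc] bound_sorted_pillars[OF tc2]
  show ?thesis
    using bounds[unfolded perm] by (meson nat_le_linear)
qed

lemma l_bound:
  "1 \<le> 41 * l \<or> 1 \<le> (2 * real (card S) - 3) * l \<or> (59 * l = 1 \<and> (\<forall>s\<in>S. 59 * x s \<in> {6, 10, 15}))"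
proof (cases "\<exists>a b c. triangle a b c")
  case True
  then show ?thesis using bound_triangle by fastforce
next
  case False
  then consider "1 \<le> real (card S) * l" | "1 \<le> l" using bound_no_triangle by blast
  then show ?thesis
  proof cases
    case 1
    show ?thesis
    \<comment> \<open>For n <= 2 the factor 2 n - 3 is smaller than n; there the constant 41 takes
      over.\<close>
    proof (cases "card S \<le> 2")
      case True
      then have "real (card S) * l \<le> 2 * l" using l_nonneg by (intro mult_right_mono) auto
      then show ?thesis using 1 l_nonneg by simp
    next
      case False
      then have "real (card S) * l \<le> (2 * real (card S) - 3) * l" using l_nonneg by (intro mult_right_mono) auto
      then show ?thesis using 1 by simp
    qed
  qed (use l_nonneg in simp)
qed

end

section \<open>A lower bound for strictly copositive forms\<close>

text \<open>The weights of the exceptional third case are the coefficients of the fundamental weight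
  of \<open>E\<^sub>8\<close> at the branching vertex, for the basis attached to a star of three cliques.\<close>
definition e8_weights :: "'i set \<Rightarrow> ('i \<Rightarrow> 'i \<Rightarrow> int) \<Rightarrow> ('i \<Rightarrow> int) \<Rightarrow> bool" where
  "e8_weights D G n \<longleftrightarrow> (\<forall>i\<in>D. n i \<in> {0, 6, 10, 15}) \<and> sum n D = 59 \<and>
     (\<forall>i\<in>D. 1 \<le> (\<Sum>j\<in>D. G i j * n j)) \<and> bform D G n n = 59"

text \<open>On the support of a minimiser of minimal support \<open>G\<close> is positive definite
  on integral vectors, so \<open>l_bound\<close> applies. Since \<open>cop\<close> speaks of
  integral vectors only, the limit argument yields just \<open>0 \<le> l\<close>; this is why
  \<open>equiangular\<close> assumes no more.\<close>

theorem copositive_lower_bound: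
  fixes D :: "'i set" and G :: "'i \<Rightarrow> 'i \<Rightarrow> int" and z :: "'i \<Rightarrow> real"
  assumes finD: "finite D" and symG: "\<And>i j. G i j = G j i"
    and diag: "\<And>i. i \<in> D \<Longrightarrow> G i i = 3"
    and offdiag: "\<And>i j. i \<in> D \<Longrightarrow> j \<in> D \<Longrightarrow> odd (G i j) \<and> - 1 \<le> G i j"
    and cop: "\<And>y i. (\<And>i. 0 \<le> y i) \<Longrightarrow> i \<in> D \<Longrightarrow> y i \<noteq> 0 \<Longrightarrow> 0 < bform D G y y"
    and z: "\<And>i. i \<in> D \<Longrightarrow> 0 \<le> z i"
  defines "T \<equiv> sum z D" and "K \<equiv> bform D (\<lambda>i j. real_of_int (G i j)) z z"
  shows "T\<^sup>2 \<le> 41 * K \<or> T\<^sup>2 \<le> (2 * real (card D) - 3) * K \<or> (T\<^sup>2 \<le> 59 * K \<and> (\<exists>n. e8_weights D G n))"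
proof (cases "D = {}")
  case True
  then show ?thesis by (simp add: T_def K_def bform_def)
next
  case False
  let ?A = "\<lambda>i j. real_of_int (G i j)"
  obtain x where x: "x \<in> probs D"
    and xmin: "\<And>y. (\<And>i. i \<in> D \<Longrightarrow> 0 \<le> y i) \<Longrightarrow> bform D ?A x x * (sum y D)\<^sup>2 \<le> bform D ?A y y"
    and xsupp: "\<And>y. y \<in> probs D \<Longrightarrow> bform D ?A y y = bform D ?A x x \<Longrightarrow> card (supp_in D x) \<le> card (supp_in D y)"
    using exists_minimal_support_minimizer[OF finD False, of ?A] by metis
  define l where "l = bform D ?A x x"
  define S where "S = supp_in D x"
  interpret copositive_minimum D ?A x l
    using x xmin xsupp by unfold_locales (auto simp: finD symG l_def)
  have SD: "S \<subseteq> D" "finite S" using finD by (auto simp: S_def supp_in_def)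
  have cop0: "0 \<le> bform D G y y" if "\<And>i. 0 \<le> y i" for y
  proof (cases "\<exists>i\<in>D. y i \<noteq> 0")
    case True
    then show ?thesis using cop[of y] that by force
  next
    case False
    then show ?thesis by (simp add: bform_def)
  qed
  have l0: "0 \<le> l" unfolding l_def by (rule copositive_real_if_copositive_nat[OF cop0 x_nonneg])
  have S_out: "x j = 0" if "j \<in> D - S" for j using that by (auto simp: S_def supp_in_def)
  have bform_S: "bform S G w w = bform D G w w" if "\<And>i. i \<notin> S \<Longrightarrow> w i = 0" for w
  proof -
    have "bform D G w w = (\<Sum>i\<in>S. \<Sum>j\<in>D. G i j * w i * w j)"
      unfolding bform_def using SD finD that by (intro sum.mono_neutral_right) auto
    also have "\<dots> = (\<Sum>i\<in>S. \<Sum>j\<in>S. G i j * w i * w j)"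
      using SD finD that by (intro sum.cong[OF refl] sum.mono_neutral_right) auto
    finally show ?thesis by (simp add: bform_def)
  qed
  have bform_int: "bform D ?A (\<lambda>i. real_of_int (w i)) (\<lambda>i. real_of_int (w i)) = real_of_int (bform D G w w)" for w
    by (simp add: bform_def)
  \<comment> \<open>The shifted form shows that \<open>G\<close> is non-negative here. An integral
    zero is a multiple of \<open>x\<close>, hence of constant sign, which \<open>cop\<close>
    forbids.\<close>
  have pd: "0 < bform S G w w" if w: "\<And>i. i \<notin> S \<Longrightarrow> w i = 0" and i: "w i \<noteq> 0" for w i
  proof (rule ccontr)
    assume n: "\<not> ?thesis"
    have i': "i \<in> D" using i w SD by blast
    have ge: "l * (\<Sum>i\<in>D. real_of_int (w i))\<^sup>2 \<le> real_of_int (bform D G w w)"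
      using bform_supp_ge[of "\<lambda>i. real_of_int (w i)"] w by (simp add: S_def bform_int)
    moreover have "0 \<le> l * (\<Sum>i\<in>D. real_of_int (w i))\<^sup>2" using l0 by simp
    ultimately have "real_of_int (bform D G w w) = l * (\<Sum>i\<in>D. real_of_int (w i))\<^sup>2" "bform D G w w = 0"
      using n bform_S[OF w] by auto
    then obtain c where c: "\<And>i. i \<in> D \<Longrightarrow> real_of_int (w i) = c * x i"
      using zero_multiple[of "\<lambda>i. real_of_int (w i)"] w by (auto simp: S_def bform_int)
    define s :: int where "s = (if 0 \<le> c then 1 else - 1)"
    have "w j = 0" if "j \<notin> D" for j using w SD that by blast
    then have "0 \<le> real_of_int (smul s w j)" for j
      using c[of j] x_nonneg[of j] by (cases "j \<in> D") (auto simp: s_def mult_nonpos_nonneg)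
    then have "0 < bform D G (smul s w) (smul s w)"
      using i i' by (intro cop[of _ i]) (auto simp: s_def)
    then show False using \<open>bform D G w w = 0\<close> by (simp add: bform_smul_left bform_smul_right)
  qed
  interpret equiangular S G x l
  proof
    show "(\<Sum>j\<in>S. of_int (G i j) * x j) = l" if "i \<in> S" for i
    proof -
      have "(\<Sum>j\<in>S. of_int (G i j) * x j) = (\<Sum>j\<in>D. of_int (G i j) * x j)"
        using SD finD S_out by (intro sum.mono_neutral_left) auto
      also have "\<dots> = l" using row_eq[of i] that by (simp add: S_def copositive_minimum.row_def[OF copositive_minimum_axioms])
      finally show ?thesis .
    qed
    show "0 < x i" if "i \<in> S" for i using that x_nonneg[of i] by (auto simp: S_def supp_in_def less_le)
    have "sum x S = sum x D" using SD finD S_out by (intro sum.mono_neutral_left) auto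
    then show "sum x S = 1" using x by (simp add: probs_def)
    show "odd (G i j) \<and> - 1 \<le> G i j" if "i \<in> S" "j \<in> S" for i j
      using offdiag[of i j] that SD by blast
  qed (use SD diag symG pd l0 in auto)
  have lK: "l * T\<^sup>2 \<le> K" unfolding T_def K_def by (rule l_le[OF z])
  consider "1 \<le> 41 * l" | "1 \<le> (2 * real (card S) - 3) * l" | "59 * l = 1" "\<forall>s\<in>S. 59 * x s \<in> {6, 10, 15}"
    using l_bound by blast
  then show ?thesis
  proof cases
    case 1
    then have "1 * T\<^sup>2 \<le> 41 * l * T\<^sup>2" by (intro mult_right_mono) auto
    then show ?thesis using lK by simp
  next
    case 2
    have "card S \<le> card D" using SD finD by (simp add: card_mono)
    then have "1 \<le> (2 * real (card D) - 3) * l" using 2 mult_right_mono[of "2 * real (card S) - 3" "2 * real (card D) - 3" l] l0 by simp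
    moreover from this have pos: "0 \<le> 2 * real (card D) - 3" using l0 by (smt (verit) mult_nonpos_nonneg)
    ultimately have "1 * T\<^sup>2 \<le> (2 * real (card D) - 3) * l * T\<^sup>2" by (intro mult_right_mono) auto
    also have "\<dots> \<le> (2 * real (card D) - 3) * K" using mult_left_mono[OF lK pos] by (simp add: mult.assoc)
    finally show ?thesis by simp
  next
    case 3
    define n where "n i = \<lfloor>59 * x i\<rfloor>" for i
    have cases: "59 * x i \<in> {0, 6, 10, 15}" if "i \<in> D" for i
      using 3(2) S_out[of i] that by (cases "i \<in> S") auto
    have n: "real_of_int (n i) = 59 * x i" if "i \<in> D" for i
      using cases[OF that] by (auto simp: n_def)
    have "n i \<in> {0, 6, 10, 15}" if "i \<in> D" for i
      using cases[OF that] by (auto simp: n_def)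
    moreover have "real_of_int (sum n D) = real_of_int 59"
      using n x by (simp add: probs_def flip: sum_distrib_left)
    then have "sum n D = 59" unfolding of_int_eq_iff .
    moreover have "1 \<le> (\<Sum>j\<in>D. G i j * n j)" if "i \<in> D" for i
    proof -
      have "real_of_int (\<Sum>j\<in>D. G i j * n j) = (\<Sum>j\<in>D. 59 * (?A i j * x j))"
        unfolding of_int_sum of_int_mult by (intro sum.cong) (auto simp: n)
      also have "\<dots> = 59 * (\<Sum>j\<in>D. ?A i j * x j)" by (simp add: sum_distrib_left)
      also have "\<dots> \<ge> 59 * l"
        using row_ge[OF that] by (simp add: copositive_minimum.row_def[OF copositive_minimum_axioms])
      finally show ?thesis using 3(1) by linarith
    qed
    moreover have "bform D G n n = 59"
    proof -
      have "real_of_int (bform D G n n) = bform D ?A (smul 59 x) (smul 59 x)"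
        unfolding bform_int[symmetric] by (intro bform_cong) (auto simp: n)
      also have "\<dots> = 59 * (59 * l)" by (simp add: bform_smul_left bform_smul_right l_def)
      finally have "real_of_int (bform D G n n) = 59" using 3(1) by simp
      then show ?thesis by simp
    qed
    ultimately have "e8_weights D G n" by (auto simp: e8_weights_def)
    moreover have "T\<^sup>2 \<le> 59 * K"
    proof -
      have "59 * (l * T\<^sup>2) = T\<^sup>2" using 3(1) by (metis mult.assoc mult_1)
      then show ?thesis using lK by linarith
    qed
    ultimately show ?thesis by blast
  qed
qed

section \<open>Multisets of vectors and small integer sums\<close>

lemma sum_mset_eq_sum_count:
  assumes "finite D" "set_mset N \<subseteq> D"
  shows "\<Sum>\<^sub># N = (\<Sum>y\<in>D. smul (int (count N y)) y)"
  using assms(2)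
proof (induction N)
  case empty
  have "smul 0 y = 0" for y :: "'a \<Rightarrow> int" by (simp add: smul_def fun_eq_iff)
  then show ?case by simp
next
  case (add z N)
  have "smul (int (count (add_mset z N) y)) y = (if y = z then z else 0) + smul (int (count N y)) y" for y
    by (auto simp: fun_eq_iff algebra_simps)
  then have "(\<Sum>y\<in>D. smul (int (count (add_mset z N) y)) y) = (\<Sum>y\<in>D. if y = z then z else 0) + (\<Sum>y\<in>D. smul (int (count N y)) y)"
    by (simp only: sum.distrib)
  also have "(\<Sum>y\<in>D. if y = z then z else 0) = z" using assms(1) add.prems by simp
  finally show ?case using add by simp
qed

lemma size_eq_sum_count:
  "finite D \<Longrightarrow> set_mset N \<subseteq> D \<Longrightarrow> (\<Sum>y\<in>D. int (count N y)) = int (size N)"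
  unfolding size_multiset_overloaded_eq of_nat_sum by (intro sum.mono_neutral_right) (auto simp: count_eq_zero_iff)

lemma sum_mset_nonneg_int:
  fixes f :: "'a \<Rightarrow> int"
  shows "(\<And>y. y \<in># Y \<Longrightarrow> 0 \<le> f y) \<Longrightarrow> 0 \<le> (\<Sum>y\<in>#Y. f y)"
  by (induction Y) auto

lemma sum_mset_eq_1_int:
  fixes f :: "'a \<Rightarrow> int"
  assumes nn: "\<And>y. y \<in># Y \<Longrightarrow> 0 \<le> f y" and "(\<Sum>y\<in>#Y. f y) = 1"
  shows "\<exists>e N. Y = add_mset e N \<and> f e = 1 \<and> (\<forall>y\<in>#N. f y = 0)"
proof -
  have "\<exists>e. e \<in># Y \<and> f e \<noteq> 0"
  proof (rule ccontr)
    assume "\<not> ?thesis"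
    then have "image_mset f Y = image_mset (\<lambda>_. 0) Y" by (intro image_mset_cong) auto
    then show False using assms(2) by simp
  qed
  then obtain e where e: "e \<in># Y" "f e \<noteq> 0" by auto
  then obtain N where N: "Y = add_mset e N" using multi_member_split[OF e(1)] by auto
  have N0: "0 \<le> f y" if "y \<in># N" for y using nn that N by simp
  then have "0 \<le> (\<Sum>y\<in>#N. f y)" by (rule sum_mset_nonneg_int)
  then have fe: "f e = 1" "(\<Sum>y\<in>#N. f y) = 0" using assms(2) N nn[OF e(1)] e(2) by auto
  have "f y = 0" if y: "y \<in># N" for y
  proof -
    obtain Z where Z: "N = add_mset y Z" using multi_member_split[OF y] by auto
    then have "0 \<le> (\<Sum>y\<in>#Z. f y)" using N0 by (intro sum_mset_nonneg_int) auto
    then show ?thesis using fe(2) Z N0[OF y] by simp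
  qed
  then show ?thesis using N fe by auto
qed

lemma sum_mset_eq_2_int:
  fixes f :: "'a \<Rightarrow> int"
  assumes nn: "\<And>y. y \<in># Y \<Longrightarrow> 0 \<le> f y" and two: "(\<Sum>y\<in>#Y. f y) = 2"
  shows "(\<exists>e\<in>#Y. f e = 2) \<or> (\<exists>e1 e2 N. Y = add_mset e1 (add_mset e2 N) \<and> f e1 = 1 \<and> f e2 = 1 \<and> (\<forall>y\<in>#N. f y = 0))"
proof -
  have "\<exists>e. e \<in># Y \<and> f e \<noteq> 0"
  proof (rule ccontr)
    assume "\<not> ?thesis"
    then have "image_mset f Y = image_mset (\<lambda>_. 0) Y" by (intro image_mset_cong) auto
    then show False using two by simp
  qed
  then obtain e where e: "e \<in># Y" "f e \<noteq> 0" by auto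
  then obtain N where N: "Y = add_mset e N" using multi_member_split[OF e(1)] by auto
  have N0: "0 \<le> f y" if "y \<in># N" for y using nn that N by simp
  then have "0 \<le> (\<Sum>y\<in>#N. f y)" by (rule sum_mset_nonneg_int)
  moreover have "f e + (\<Sum>y\<in>#N. f y) = 2" using two N by simp
  ultimately consider "f e = 2" | "f e = 1" "(\<Sum>y\<in>#N. f y) = 1" using nn[OF e(1)] e(2) by linarith
  then show ?thesis
  proof cases
    case 1 then show ?thesis using e by auto
  next
    case 2
    then show ?thesis using sum_mset_eq_1_int[of N f, OF N0 2(2)] N by blast
  qed
qed

text \<open>Needed only to see that such a sum can never be 23.\<close>

lemma sum_6_10_15:
  fixes n \<beta> :: "'i \<Rightarrow> int"
  assumes "finite D" "\<And>i. i \<in> D \<Longrightarrow> n i \<in> {0, 6, 10, 15}" "\<And>i. i \<in> D \<Longrightarrow> 0 \<le> \<beta> i"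
  shows "\<exists>A B C. 0 \<le> A \<and> 0 \<le> B \<and> 0 \<le> C \<and> (\<Sum>i\<in>D. n i * \<beta> i) = 6 * A + 10 * B + 15 * C"
  using assms
proof (induction D)
  case empty
  then show ?case by (intro exI[of _ 0]) simp
next
  case (insert i D)
  then obtain A B C where IH: "0 \<le> A" "0 \<le> B" "0 \<le> C" "(\<Sum>i\<in>D. n i * \<beta> i) = 6 * A + 10 * B + 15 * C" by auto
  have "0 \<le> \<beta> i" using insert.prems by simp
  have s: "(\<Sum>i\<in>insert i D. n i * \<beta> i) = n i * \<beta> i + (6 * A + 10 * B + 15 * C)" using insert.hyps IH by simp
  consider "n i = 0" | "n i = 6" | "n i = 10" | "n i = 15" using insert.prems(1)[of i] by auto
  then show ?case
  proof cases
    case 1 then show ?thesis using IH s by (intro exI[of _ A] exI[of _ B] exI[of _ C]) simp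
  next
    case 2 then show ?thesis using IH s \<open>0 \<le> \<beta> i\<close> by (intro exI[of _ "A + \<beta> i"] exI[of _ B] exI[of _ C]) simp
  next
    case 3 then show ?thesis using IH s \<open>0 \<le> \<beta> i\<close> by (intro exI[of _ A] exI[of _ "B + \<beta> i"] exI[of _ C]) simp
  next
    case 4 then show ?thesis using IH s \<open>0 \<le> \<beta> i\<close> by (intro exI[of _ A] exI[of _ B] exI[of _ "C + \<beta> i"]) simp
  qed
qed

section \<open>Combinations of roots having product -1 with a fixed root\<close>

context unit_form
begin

lemma b_sum_left: "b (sum F D) z = (\<Sum>y\<in>D. b (F y) z)"
  by (induction D rule: infinite_finite_induct) (simp_all only: sum.infinite sum.empty sum.insert b_zero_left b_add_left if_True not_False_eq_True simp_thms)

definition comb :: "('v \<Rightarrow> int) \<Rightarrow> ('v \<Rightarrow> int) set \<Rightarrow> int \<Rightarrow> (('v \<Rightarrow> int) \<Rightarrow> int) \<Rightarrow> 'v \<Rightarrow> int" where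
  "comb a D k n = smul k a + (\<Sum>y\<in>D. smul (n y) y)"

lemma b_comb: "b (comb a D k n) z = k * b a z + (\<Sum>y\<in>D. n y * b y z)"
  by (simp add: comb_def b_add_left b_sum_left b_smul_left)

lemma comb_orthant:
  assumes "a \<in> orthant X" "\<And>y. y \<in> D \<Longrightarrow> y \<in> orthant X" "0 \<le> k" "\<And>y. y \<in> D \<Longrightarrow> 0 \<le> n y"
  shows "comb a D k n \<in> orthant X"
proof -
  have "(\<Sum>y\<in>D. smul (n y) y) \<in> orthant X"
    using assms(2,4)
    by (induction D rule: infinite_finite_induct)
      (simp_all only: sum.infinite sum.empty sum.insert orthant_zero orthant_add orthant_smul insertI1 insertI2 if_True not_False_eq_True simp_thms)
  then show ?thesis unfolding comb_def using assms by (intro orthant_add orthant_smul)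
qed

text \<open>Completing the square: y + a/2 is orthogonal to a, and two such vectors have product
  \<open>b y y' - 1/2\<close>. The square is that of \<open>b a\<close> on the combination.\<close>

lemma four_q_comb:
  assumes "q a = 1" "\<And>y. y \<in> D \<Longrightarrow> b a y = - 1"
  shows "4 * q (comb a D k n) = (2 * k - sum n D)\<^sup>2 + bform D (\<lambda>y y'. 2 * b y y' - 1) n n"
proof -
  let ?s = "\<Sum>y\<in>D. \<Sum>y'\<in>D. b y y' * n y * n y'"
  have sq: "(sum n D)\<^sup>2 = (\<Sum>y\<in>D. \<Sum>y'\<in>D. n y * n y')" by (simp add: power2_eq_square sum_product)
  have "bform D (\<lambda>y y'. 2 * b y y' - 1) n n = 2 * ?s - (sum n D)\<^sup>2"
    unfolding sq by (simp add: bform_def algebra_simps sum_subtractf sum_distrib_left)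
  moreover have 1: "b z (comb a D k n) = k * b z a + (\<Sum>y\<in>D. n y * b z y)" for z
    using b_comb[of a D k n z] by (simp add: b_commute)
  have "b a (comb a D k n) = 2 * k - sum n D"
    unfolding 1 using assms by (simp add: b_self sum_negf)
  moreover have by_eq: "b y (comb a D k n) = - k + (\<Sum>y'\<in>D. n y' * b y y')" if "y \<in> D" for y
    unfolding 1 using assms(2)[OF that] by (simp add: b_commute)
  have "(\<Sum>y\<in>D. n y * b y (comb a D k n)) = (\<Sum>y\<in>D. - k * n y + (\<Sum>y'\<in>D. b y y' * n y * n y'))"
    by (intro sum.cong refl, subst by_eq) (simp_all add: algebra_simps sum_distrib_left)
  then have "(\<Sum>y\<in>D. n y * b y (comb a D k n)) = - k * sum n D + ?s"
    by (simp only: sum.distrib sum_distrib_left)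
  ultimately have "b (comb a D k n) (comb a D k n) = k * (2 * k - sum n D) - k * sum n D + ?s"
    by (simp add: b_comb[of a D k n "comb a D k n"])
  then have "2 * q (comb a D k n) = k * (2 * k - sum n D) - k * sum n D + ?s" by (simp add: b_self)
  then show ?thesis using \<open>bform D _ n n = _\<close> by (simp add: power2_eq_square algebra_simps)
qed

text \<open>By \<open>four_q_comb\<close>, \<open>K\<close> is the value of \<open>G\<close> on the
  multiplicities of \<open>N\<close>. The bound uses \<open>size N\<close> because the number of
  distinct roots is at most that.\<close>

lemma star_lower_bound:
  fixes N :: "('v \<Rightarrow> int) multiset" and k :: int
  assumes a: "q a = 1" and roots: "\<And>y. y \<in># N \<Longrightarrow> q y = 1" "\<And>y. y \<in># N \<Longrightarrow> b a y = - 1"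
    and nonneg: "\<And>y y'. y \<in># N \<Longrightarrow> y' \<in># N \<Longrightarrow> y \<noteq> y' \<Longrightarrow> 0 \<le> b y y'"
    and strict: "\<And>k n y. 0 \<le> k \<Longrightarrow> (\<And>y. 0 \<le> n y) \<Longrightarrow> y \<in># N \<Longrightarrow> n y \<noteq> 0 \<Longrightarrow> 0 < q (comb a (set_mset N) k n)"
  defines "W \<equiv> int (size N)" and "K \<equiv> 4 * q (smul k a + \<Sum>\<^sub># N) - (2 * k - int (size N))\<^sup>2"
  shows "W\<^sup>2 \<le> 41 * K \<or> W\<^sup>2 \<le> (2 * W - 3) * K \<or>
    (W\<^sup>2 \<le> 59 * K \<and> (\<exists>n. e8_weights (set_mset N) (\<lambda>y y'. 2 * b y y' - 1) n))"
proof -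
  define D where "D = set_mset N"
  define G where "G y y' = 2 * b y y' - 1" for y y'
  define cnt where "cnt y = int (count N y)" for y
  have D: "finite D" "set_mset N \<subseteq> D" by (simp_all add: D_def)
  have comb_eq: "smul k a + \<Sum>\<^sub># N = comb a D k cnt"
    unfolding comb_def sum_mset_eq_sum_count[OF D] cnt_def ..
  have sum_cnt: "sum cnt D = W" using size_eq_sum_count[OF D] by (simp add: cnt_def W_def)
  have aD: "b a y = - 1" if "y \<in> D" for y using roots that by (simp add: D_def)
  have four: "4 * q (comb a D k n) = (2 * k - sum n D)\<^sup>2 + bform D G n n" for k n
    using four_q_comb[OF a aD, of D k n] by (simp add: G_def[abs_def])
  have K: "K = bform D G cnt cnt"
    unfolding K_def comb_eq four sum_cnt by (simp add: W_def)
  have pos: "0 < bform D G n n" if n: "\<And>i. 0 \<le> n i" and y: "y \<in> D" "n y \<noteq> 0" for n y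
  proof -
    \<comment> \<open>Doubling the coefficients allows the integral choice of the multiple of a for
      which the square vanishes.\<close>
    have "0 < q (comb a D (sum n D) (smul 2 n))"
      unfolding D_def using n y by (intro strict[of _ _ y]) (auto simp: D_def intro: sum_nonneg)
    moreover have "4 * q (comb a D (sum n D) (smul 2 n)) = 4 * bform D G n n"
      unfolding four by (simp add: bform_smul_left bform_smul_right flip: sum_distrib_left)
    ultimately show ?thesis by simp
  qed
  have "(\<Sum>y\<in>D. real_of_int (cnt y))\<^sup>2 \<le> 41 * bform D (\<lambda>i j. real_of_int (G i j)) (\<lambda>y. real_of_int (cnt y)) (\<lambda>y. real_of_int (cnt y))
     \<or> (\<Sum>y\<in>D. real_of_int (cnt y))\<^sup>2 \<le> (2 * real (card D) - 3) * bform D (\<lambda>i j. real_of_int (G i j)) (\<lambda>y. real_of_int (cnt y)) (\<lambda>y. real_of_int (cnt y))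
     \<or> ((\<Sum>y\<in>D. real_of_int (cnt y))\<^sup>2 \<le> 59 * bform D (\<lambda>i j. real_of_int (G i j)) (\<lambda>y. real_of_int (cnt y)) (\<lambda>y. real_of_int (cnt y))
         \<and> (\<exists>n. e8_weights D G n))"
  proof (rule copositive_lower_bound[OF D(1)])
    show "G i j = G j i" for i j by (simp add: G_def b_commute)
    show "G i i = 3" if "i \<in> D" for i using that roots by (simp add: G_def b_self D_def)
    show "odd (G i j) \<and> - 1 \<le> G i j" if "i \<in> D" "j \<in> D" for i j
      using that roots nonneg[of i j] by (cases "i = j") (auto simp: G_def b_self D_def)
    show "0 < bform D G y y" if "\<And>i. 0 \<le> y i" "i \<in> D" "y i \<noteq> 0" for y i
      using pos[of y i] that by blast
  qed (simp add: cnt_def)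
  moreover have "bform D (\<lambda>i j. real_of_int (G i j)) (\<lambda>y. real_of_int (cnt y)) (\<lambda>y. real_of_int (cnt y)) = real_of_int K"
    by (simp add: K bform_def)
  moreover have "(\<Sum>y\<in>D. real_of_int (cnt y)) = real_of_int W" using sum_cnt by (simp flip: of_int_sum)
  ultimately have cases: "real_of_int (W\<^sup>2) \<le> real_of_int (41 * K) \<or> real_of_int (W\<^sup>2) \<le> real_of_int ((2 * int (card D) - 3) * K) \<or>
    (real_of_int (W\<^sup>2) \<le> real_of_int (59 * K) \<and> (\<exists>n. e8_weights D G n))"
    by simp
  have "0 \<le> K"
  proof (cases "D = {}")
    case False
    then obtain y where "y \<in> D" by auto
    then show ?thesis unfolding K using pos[of cnt y] by (simp add: cnt_def D_def)
  qed (simp add: K bform_def)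
  moreover have "card D \<le> size N"
    unfolding size_multiset_overloaded_eq card_eq_sum D_def[symmetric] by (intro sum_mono) (simp add: D_def)
  ultimately have "(2 * int (card D) - 3) * K \<le> (2 * W - 3) * K" by (intro mult_right_mono) (auto simp: W_def)
  then show ?thesis using cases unfolding of_int_le_iff D_def[symmetric] G_def[symmetric] by auto
qed

end

section \<open>The coordinates of a maximal root\<close>

locale wnn_max_root_form = max_root_form X M v for X :: "'v set" and M v +
  assumes q_nonneg: "w \<in> orthant X \<Longrightarrow> 0 \<le> q w"
begin

text \<open>The source of all strictness below: on the cone where \<open>b v\<close> vanishes an
  isotropic vector is 0.\<close>

lemma q_pos: "u \<in> orthant X \<Longrightarrow> b v u = 0 \<Longrightarrow> u \<noteq> 0 \<Longrightarrow> 0 < q u"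
  using q_nonneg[of u] isotropic_b_v_pos[of u] by (cases "q u = 0") auto

lemma nonzero_if_q: "q y = 1 \<Longrightarrow> y \<noteq> 0"
  by auto

lemma add_nonzero: "x \<in> orthant X \<Longrightarrow> y \<in> orthant X \<Longrightarrow> y \<noteq> 0 \<Longrightarrow> x + y \<noteq> 0"
  using orthant_nonneg[of x X] orthant_nonneg[of y X] by (auto simp: fun_eq_iff) (metis add_nonneg_eq_0_iff)

definition decomposition :: "'v \<Rightarrow> ('v \<Rightarrow> int) multiset \<Rightarrow> bool" where
  "decomposition a Y \<longleftrightarrow> (\<forall>y\<in>#Y. y \<in> orthant X \<and> q y = 1 \<and> y a = 0) \<and> v = smul (v a) (unitv a) + \<Sum>\<^sub># Y"

lemma decomposition_exists: "\<exists>Y. decomposition a Y" if a: "a \<in> X"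
proof -
  define Y where "Y = (\<Sum>i\<in>X - {a}. replicate_mset (nat (v i)) (unitv i :: 'v \<Rightarrow> int))"
  have "y \<in> orthant X \<and> q y = 1 \<and> y a = 0" if y: "y \<in># Y" for y
  proof -
    have mem: "\<exists>i\<in>B. y \<in># R i" if "y \<in># sum R B" for R :: "'v \<Rightarrow> ('v \<Rightarrow> int) multiset" and B
      using that by (induction B rule: infinite_finite_induct) auto
    obtain i where "i \<in> X - {a}" "y \<in># replicate_mset (nat (v i)) (unitv i)"
      using mem[OF y[unfolded Y_def]] by blast
    then have "i \<in> X - {a}" "y = unitv i" by (auto split: if_splits)
    then show ?thesis by (auto simp: orthant_unitv q_unitv unitv_apply)
  qed
  moreover have "v = smul (v a) (unitv a) + \<Sum>\<^sub># Y"
  proof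
    fix j
    have rep: "(\<Sum>\<^sub># (replicate_mset k (unitv i :: 'v \<Rightarrow> int))) j = int k * unitv i j" for k i
      by (induction k) (simp_all add: algebra_simps)
    have "(\<Sum>\<^sub># (\<Sum>i\<in>A. replicate_mset (nat (v i)) (unitv i :: 'v \<Rightarrow> int))) j = (\<Sum>i\<in>A. v i * unitv i j)"
      if "finite A" "A \<subseteq> X" for A
      using that
    proof (induction A)
      case (insert i A)
      then have "0 < v i" using v_pos by auto
      then show ?case using insert by (simp add: rep del: sum_mset_replicate_mset)
    qed simp
    then have "(\<Sum>\<^sub># Y) j = (\<Sum>i\<in>X - {a}. v i * unitv i j)" using finX by (simp add: Y_def)
    also have "\<dots> = (\<Sum>i\<in>X - {a}. if i = j then v i else 0)" by (intro sum.cong) (auto simp: unitv_apply)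
    also have "\<dots> = (if j \<in> X - {a} then v j else 0)" using finX by simp
    finally show "v j = (smul (v a) (unitv a) + \<Sum>\<^sub># Y) j"
      using a v_orthant by (auto simp: unitv_apply orthant_def)
  qed
  ultimately show ?thesis unfolding decomposition_def by blast
qed

text \<open>In a shortest decomposition no two summands have product \<open>-1\<close>: otherwise their sum is a
  root that could replace them.\<close>
lemma minimal_decomposition:
  assumes "a \<in> X"
  obtains Y where "decomposition a Y"
    and "\<And>y y' Z. Y = add_mset y (add_mset y' Z) \<Longrightarrow> b y y' \<noteq> - 1"
proof -
  obtain Y where Y: "decomposition a Y" "\<And>Z. decomposition a Z \<Longrightarrow> size Y \<le> size Z"
    using decomposition_exists[OF assms] ex_has_least_nat[of "decomposition a" _ size] by metis
  have "b y y' \<noteq> - 1" if YZ: "Y = add_mset y (add_mset y' Z)" for y y' Z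
  proof
    assume "b y y' = - 1"
    then have "decomposition a (add_mset (y + y') Z)"
      using Y(1) unfolding decomposition_def YZ by (auto simp: q_add add.assoc intro: orthant_add)
    then show False using Y(2)[of "add_mset (y + y') Z"] YZ by simp
  qed
  with Y(1) show thesis by (rule that)
qed

end

section \<open>A shortest decomposition at a coordinate of at least 13\<close>

text \<open>The data are symmetric in \<open>e1\<close> and \<open>e2\<close>, so by
  \<open>swap\<close> each fact about \<open>e1\<close> holds for \<open>e2\<close>. Here
  \<open>m\<close> is the coordinate of \<open>v\<close> at \<open>a\<close>, and
  \<open>inconsistent\<close> shows that no such data exist.\<close>

locale reduced_decomposition = wnn_max_root_form X M v for X :: "'v set" and M v +
  fixes a :: 'v and m :: int and e1 e2 :: "'v \<Rightarrow> int" and N :: "('v \<Rightarrow> int) multiset"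
  assumes a: "a \<in> X" and m: "13 \<le> m" and b_v_a: "b v (unitv a) = 0"
    and roots: "\<And>y. y \<in># add_mset e1 (add_mset e2 N) \<Longrightarrow> y \<in> orthant X \<and> q y = 1 \<and> y a = 0"
    and v_eq: "v = smul m (unitv a) + (e1 + (e2 + \<Sum>\<^sub># N))"
    and b_v_e: "b v e1 = 1" "b v e2 = 1" and b_v_N: "\<And>y. y \<in># N \<Longrightarrow> b v y = 0"
    and unmergeable: "\<And>y y' Z. add_mset e1 (add_mset e2 N) = add_mset y (add_mset y' Z) \<Longrightarrow> b y y' \<noteq> - 1"
begin

abbreviation A :: "'v \<Rightarrow> int" where "A \<equiv> unitv a"

lemma swap: "reduced_decomposition X M v a m e2 e1 N"
proof
  show "b y y' \<noteq> - 1" if "add_mset e2 (add_mset e1 N) = add_mset y (add_mset y' Z)" for y y' Z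
    using unmergeable[of y y' Z] that by (simp add: add_mset_commute)
qed (use a m b_v_a roots v_eq b_v_e b_v_N in \<open>auto simp: add_ac\<close>)

lemma A_facts: "A \<in> orthant X" "q A = 1" "A a = 1"
  using a by (auto simp: orthant_unitv q_unitv unitv_apply)

lemma e_facts: "e1 \<in> orthant X" "q e1 = 1" "e1 a = 0" "e2 \<in> orthant X" "q e2 = 1" "e2 a = 0"
  using roots by auto

lemma N_facts: "y \<in># N \<Longrightarrow> y \<in> orthant X" "y \<in># N \<Longrightarrow> q y = 1" "y \<in># N \<Longrightarrow> y a = 0"
  using roots by auto

lemma sum_orthant: "N' \<subseteq># N \<Longrightarrow> \<Sum>\<^sub># N' \<in> orthant X"
  using N_facts by (intro orthant_sum_mset) (auto dest: mset_subset_eqD)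

text \<open>The value -2 cannot be excluded yet: \<open>e1 + y\<close> has \<open>b v\<close> equal
  to 1, so \<open>q_pos\<close> does not apply and the sum may be isotropic.\<close>

lemma b_e_N_cases:
  assumes y: "y \<in># N"
  shows "b e1 y = - 2 \<or> 0 \<le> b e1 y" "b e2 y = - 2 \<or> 0 \<le> b e2 y"
proof -
  obtain Z where Z: "N = add_mset y Z" using multi_member_split[OF y] by auto
  have "b e1 y \<noteq> - 1" by (rule unmergeable[of _ _ "add_mset e2 Z"]) (simp add: Z add_mset_commute)
  moreover have "b e2 y \<noteq> - 1" by (rule unmergeable[of _ _ "add_mset e1 Z"]) (simp add: Z add_mset_commute)
  moreover have "0 \<le> q (e1 + y)" "0 \<le> q (e2 + y)" using e_facts N_facts y by (auto intro!: q_nonneg orthant_add)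
  ultimately show "b e1 y = - 2 \<or> 0 \<le> b e1 y" "b e2 y = - 2 \<or> 0 \<le> b e2 y"
    using e_facts N_facts y by (auto simp: q_add)
qed

lemma b_ge_minus_1:
  assumes "x \<in> orthant X" "q x = 1" "b v x = 0" "y \<in> orthant X" "q y = 1" "b v y = 0"
  shows "- 1 \<le> b x y"
proof -
  have "0 < q (x + y)"
    using assms by (intro q_pos orthant_add add_nonzero) (auto simp: b_simps nonzero_if_q)
  then show ?thesis using assms by (simp add: q_add)
qed

lemma b_N_nonneg:
  assumes "add_mset y (add_mset y' Z) = N"
  shows "0 \<le> b y y'"
proof -
  have yy: "y \<in># N" "y' \<in># N" using assms by auto
  have "b y y' \<noteq> - 1" by (rule unmergeable[of _ _ "add_mset e1 (add_mset e2 Z)"]) (auto simp flip: assms simp: add_mset_commute)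
  moreover have "- 1 \<le> b y y'" using yy N_facts b_v_N by (intro b_ge_minus_1) auto
  ultimately show ?thesis by simp
qed

lemma b_N_distinct_nonneg: "y \<in># N \<Longrightarrow> y' \<in># N \<Longrightarrow> y \<noteq> y' \<Longrightarrow> 0 \<le> b y y'"
  by (metis b_N_nonneg insert_noteq_member multi_member_split)

text \<open>One copy of y contributes 2 and the rest at least 0. As \<open>b v y = 0\<close>, only
  \<open>A\<close> can compensate, which forces \<open>b A y = - 1\<close>.\<close>

lemma b_sum_N:
  assumes N': "N' \<subseteq># N" and y: "y \<in># N'"
  shows "2 \<le> b (\<Sum>\<^sub># N') y"
proof -
  obtain Z where Z: "N' = add_mset y Z" using multi_member_split[OF y] by auto
  have "0 \<le> b y' y" if y': "y' \<in># Z" for y'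
  proof -
    obtain Z' where Z': "Z = add_mset y' Z'" using multi_member_split[OF y'] by auto
    obtain R where "N = N' + R" using N' by (auto simp: mset_subset_eq_exists_conv)
    then show ?thesis using Z Z' by (intro b_N_nonneg[of _ _ "Z' + R"]) (simp add: add_mset_commute)
  qed
  then have "0 \<le> (\<Sum>y'\<in>#Z. b y' y)" by (rule sum_mset_nonneg_int)
  moreover have "b y y = 2" using N_facts(2) mset_subset_eqD[OF N' y] by (simp add: b_self)
  ultimately show ?thesis by (simp add: b_add_left b_sum_mset_left Z)
qed

lemma comb_positive:
  assumes "N' \<subseteq># N" "0 \<le> k" "\<And>y. 0 \<le> n y" "y \<in># N'" "n y \<noteq> 0"
  shows "0 < q (comb A (set_mset N') k n)"
proof (rule q_pos)
  have mem: "z \<in># N" if "z \<in># N'" for z using that assms(1) by (rule mset_subset_eqD[rotated])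
  show orth: "comb A (set_mset N') k n \<in> orthant X"
    using A_facts N_facts(1) mem assms by (intro comb_orthant) auto
  show "b v (comb A (set_mset N') k n) = 0"
    using b_comb[of A "set_mset N'" k n v] b_v_a b_v_N mem by (simp add: b_commute)
  show "comb A (set_mset N') k n \<noteq> 0"
  proof
    assume z: "comb A (set_mset N') k n = 0"
    have "y \<noteq> 0" using N_facts(2)[OF mem[OF assms(4)]] by auto
    then obtain i where i: "y i \<noteq> 0" by (auto simp: fun_eq_iff)
    then have "0 < y i" using orthant_nonneg[OF N_facts(1)[OF mem[OF assms(4)]], of i] by simp
    then have "0 < n y * y i" using assms(3)[of y] assms(5) by simp
    moreover define R where "R = smul k A + (\<Sum>y\<in>set_mset N' - {y}. smul (n y) y)"
    have "comb A (set_mset N') k n = R + smul (n y) y"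
      unfolding comb_def R_def using assms(4) by (simp only: sum.remove[OF finite_set_mset] add_ac)
    then have "R i + n y * y i = 0" using z by (metis plus_fun_apply smul_apply zero_fun_apply)
    moreover have "R \<in> orthant X"
      using comb_orthant[OF A_facts(1), of "set_mset N' - {y}" k n] N_facts(1) mem assms by (auto simp: comb_def R_def)
    then have "0 \<le> R i" by (rule orthant_nonneg)
    ultimately show False by linarith
  qed
qed

text \<open>If an isotropic \<open>z\<close> splits off, the rest \<open>w\<close> of \<open>v\<close> is isotropic as well, and
  \<open>w - e2 - A\<close> is a root for which the lower bound on \<open>G\<close> already fails.\<close>
lemma no_isotropic_part:
  assumes z: "z \<in> orthant X" "q z = 0" "b v z = 1"
    and N': "N' \<subseteq># N" and k: "12 \<le> k" and vz: "v = z + (smul k A + (e2 + \<Sum>\<^sub># N'))"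
  shows False
proof -
  define w where "w = smul k A + (e2 + \<Sum>\<^sub># N')"
  have w: "w \<in> orthant X" unfolding w_def
    using k A_facts e_facts sum_orthant[OF N'] by (intro orthant_add orthant_smul) auto
  have v_zw: "v = z + w" using vz by (simp add: w_def)
  have mem: "y \<in># N" if "y \<in># N'" for y using that N' by (rule mset_subset_eqD[rotated])
  have "b v z = b z z + b w z" by (subst v_zw) (rule b_add_left)
  then have bzw: "b z w = 1" using z by (simp add: b_self b_commute)
  \<comment> \<open>As z is isotropic, \<open>b z w = b v z = 1\<close>, so 1 = 0 +
    \<open>q w\<close> + 1.\<close>
  have "q v = q z + q w + b z w" by (subst v_zw) (rule q_add)
  then have qw: "q w = 0" using v_root z bzw by simp
  have w_nonneg: "0 \<le> b w u" and z_nonneg: "0 \<le> b z u" if "u \<in> orthant X" for u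
    using isotropic_b_nonneg w qw z that by auto
  have zero: "b w u = 0" "b z u = 0" if "u \<in> orthant X" "b v u = 0" for u
    using w_nonneg[OF that(1)] z_nonneg[OF that(1)] that(2) by (simp_all add: v_zw b_simps)
  have wA: "b w A = 0" using zero A_facts b_v_a by auto
  have wN: "b w y = 0" if "y \<in># N'" for y using zero N_facts b_v_N mem that by auto
  have "b z w = k * b z A + (b z e2 + (\<Sum>y\<in>#N'. b z y))" by (simp add: w_def b_simps b_sum_mset_right)
  also have "(\<Sum>y\<in>#N'. b z y) = 0"
    using zero(2) N_facts(1) b_v_N mem by (intro sum_mset.neutral) auto
  finally have "b z e2 = 1" using bzw zero(2)[OF A_facts(1) b_v_a] by simp
  then have we: "b w e2 = 0" using b_v_e by (simp add: v_zw b_simps)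
  \<comment> \<open>After splitting off another isotropic vector the rest u of w is isotropic with
    \<open>b v u = 0\<close>, hence 0, although its coordinate at \<open>a\<close> is
    positive.\<close>
  have too_small: False if z': "z' \<in> orthant X" "q z' = 0" "b w z' = 0" "b v z' = 1"
    and wz': "w = z' + u" "u \<in> orthant X" "0 < u a" for z' u
  proof -
    have "q u = 0" using wz'(1) q_diff[of w z'] qw z' by simp
    moreover have "b v v = b v z + b v w" by (subst (2) v_zw) (rule b_add_right)
    then have "b v w = 1" using z(3) v_root by (simp add: b_self)
    then have "b v u = 0" using z'(4) wz'(1) by (simp add: b_simps)
    ultimately have "u = 0" using isotropic_b_v_pos[OF wz'(2)] by force
    then show False using wz'(3) by simp
  qed
  have e2N: "0 \<le> b e2 y" if y: "y \<in># N'" for y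
  proof (rule ccontr)
    assume "\<not> ?thesis"
    then have "b e2 y = - 2" using b_e_N_cases(2)[OF mem[OF y]] by auto
    obtain Z where Z: "N' = add_mset y Z" using multi_member_split[OF y] by auto
    have ZN: "Z \<subseteq># N" using N' Z by (metis mset_subset_eq_insertD subset_mset.less_imp_le)
    show False
    proof (rule too_small[of "e2 + y" "smul k A + \<Sum>\<^sub># Z"])
      show "q (e2 + y) = 0" using \<open>b e2 y = - 2\<close> e_facts N_facts mem[OF y] by (simp add: q_add)
      show "w = e2 + y + (smul k A + \<Sum>\<^sub># Z)" by (simp add: w_def Z add_ac)
      show "0 < (smul k A + \<Sum>\<^sub># Z) a"
        using k A_facts orthant_nonneg[OF sum_orthant[OF ZN], of a] by simp
      show "smul k A + \<Sum>\<^sub># Z \<in> orthant X"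
        using k A_facts sum_orthant[OF ZN] by (intro orthant_add orthant_smul) auto
      show "e2 + y \<in> orthant X" using e_facts N_facts mem[OF y] by (intro orthant_add) auto
    qed (use we wN[OF y] b_v_e b_v_N[OF mem[OF y]] in \<open>auto simp: b_simps\<close>)
  qed
  have e2A: "- 1 \<le> b e2 A"
  proof (rule ccontr)
    assume "\<not> ?thesis"
    moreover have "0 \<le> q (e2 + A)" using e_facts A_facts by (intro q_nonneg orthant_add) auto
    ultimately have "b e2 A = - 2" using e_facts A_facts by (simp add: q_add)
    show False
    proof (rule too_small[of "e2 + A" "smul (k - 1) A + \<Sum>\<^sub># N'"])
      show "q (e2 + A) = 0" using \<open>b e2 A = - 2\<close> e_facts A_facts by (simp add: q_add)
      show "w = e2 + A + (smul (k - 1) A + \<Sum>\<^sub># N')" by (auto simp: w_def fun_eq_iff algebra_simps)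
      show "0 < (smul (k - 1) A + \<Sum>\<^sub># N') a"
        using k A_facts orthant_nonneg[OF sum_orthant[OF N'], of a] by simp
      show "smul (k - 1) A + \<Sum>\<^sub># N' \<in> orthant X"
        using k A_facts sum_orthant[OF N'] by (intro orthant_add orthant_smul) auto
      show "e2 + A \<in> orthant X" using e_facts A_facts by (intro orthant_add) auto
    qed (use we wA b_v_e b_v_a in \<open>auto simp: b_simps\<close>)
  qed
  have AN: "b A y = - 1" if y: "y \<in># N'" for y
  proof -
    have "b w y = k * b A y + (b e2 y + b (\<Sum>\<^sub># N') y)" by (simp add: w_def b_simps)
    then have "k * b A y < 0" using wN[OF y] e2N[OF y] b_sum_N[OF N' y] by simp
    then have "b A y < 0" using k by (simp add: mult_less_0_iff)
    moreover have "- 1 \<le> b A y" using A_facts b_v_a N_facts b_v_N mem[OF y] by (intro b_ge_minus_1) auto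
    ultimately show ?thesis by simp
  qed
  have Ae2: "b A e2 = - 1"
  proof -
    have "b w e2 = k * b A e2 + (2 + (\<Sum>y\<in>#N'. b y e2))" using e_facts by (simp add: w_def b_simps b_self b_sum_mset_left)
    moreover have "0 \<le> (\<Sum>y\<in>#N'. b y e2)" using e2N by (intro sum_mset_nonneg_int) (simp add: b_commute)
    ultimately have "k * b A e2 < 0" using we by simp
    then have "b A e2 < 0" using k by (simp add: mult_less_0_iff)
    then show ?thesis using e2A by (simp add: b_commute)
  qed
  have "image_mset (\<lambda>y. b y A) N' = image_mset (\<lambda>_. - 1) N'"
    using AN by (intro image_mset_cong) (simp add: b_commute)
  then have "(\<Sum>y\<in>#N'. b y A) = - int (size N')" by simp
  then have "b w A = 2 * k + (- 1 - int (size N'))"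
    using A_facts Ae2 by (simp add: w_def b_simps b_self b_sum_mset_left b_commute)
  then have size: "int (size N') = 2 * k - 1" using wA by simp
  define u where "u = smul (k - 1) A + \<Sum>\<^sub># N'"
  have "w = u + (e2 + A)" by (auto simp: u_def w_def fun_eq_iff algebra_simps)
  then have "u = w - (e2 + A)" by simp
  then have "q u = 1" using qw we wA Ae2 e_facts A_facts by (simp add: q_diff q_add b_simps b_commute)
  \<comment> \<open>The size 2 k - 1 is odd and misses 2 (k - 1) by one, so the value is 4 - 1 =
    3.\<close>
  then have K: "4 * q (smul (k - 1) A + \<Sum>\<^sub># N') - (2 * (k - 1) - int (size N'))\<^sup>2 = 3"
    by (simp add: u_def size)
  let ?W = "int (size N')"
  have "?W\<^sup>2 \<le> 41 * (4 * q (smul (k - 1) A + \<Sum>\<^sub># N') - (2 * (k - 1) - ?W)\<^sup>2) \<or>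
    ?W\<^sup>2 \<le> (2 * ?W - 3) * (4 * q (smul (k - 1) A + \<Sum>\<^sub># N') - (2 * (k - 1) - ?W)\<^sup>2) \<or>
    (?W\<^sup>2 \<le> 59 * (4 * q (smul (k - 1) A + \<Sum>\<^sub># N') - (2 * (k - 1) - ?W)\<^sup>2) \<and>
      (\<exists>n. e8_weights (set_mset N') (\<lambda>y y'. 2 * b y y' - 1) n))"
    by (rule star_lower_bound) (auto simp: A_facts N_facts mem AN b_N_distinct_nonneg intro: comb_positive[OF N'])
  then have "?W\<^sup>2 \<le> 41 * 3 \<or> ?W\<^sup>2 \<le> (2 * ?W - 3) * 3 \<or> ?W\<^sup>2 \<le> 59 * 3"
    unfolding K by blast
  \<comment> \<open>For W >= 23 the bounds 123, 6 W - 9 and 177 are all below 23 W.\<close>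
  moreover have "23 \<le> int (size N')" using size k by simp
  then have "23 * int (size N') \<le> (int (size N'))\<^sup>2" unfolding power2_eq_square by (intro mult_right_mono) auto
  ultimately show False using \<open>23 \<le> int (size N')\<close> by auto
qed

text \<open>A product -2 would make \<open>e1 + y\<close> or \<open>e1 + A\<close> isotropic with
  \<open>b v\<close> equal to 1. Splitting off \<open>e1 + A\<close> uses one copy of
  \<open>A\<close>, which is why \<open>no_isotropic_part\<close> allows 12.\<close>

lemma no_double_neighbour:
  shows "y \<in># N \<Longrightarrow> 0 \<le> b e1 y" "- 1 \<le> b e1 A"
proof -
  show "0 \<le> b e1 y" if y: "y \<in># N"
  proof (rule ccontr)
    assume "\<not> ?thesis"
    then have "b e1 y = - 2" using b_e_N_cases(1)[OF y] by auto
    obtain Z where Z: "N = add_mset y Z" using multi_member_split[OF y] by auto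
    show False
    proof (rule no_isotropic_part[of "e1 + y" Z m])
      show "v = e1 + y + (smul m A + (e2 + \<Sum>\<^sub># Z))" using v_eq by (simp add: Z add_ac)
    qed (use Z m \<open>b e1 y = - 2\<close> e_facts N_facts[OF y] b_v_e b_v_N[OF y] in \<open>auto simp: q_add b_simps orthant_add\<close>)
  qed
  show "- 1 \<le> b e1 A"
  proof (rule ccontr)
    assume "\<not> ?thesis"
    moreover have "0 \<le> q (e1 + A)" using e_facts A_facts by (intro q_nonneg orthant_add) auto
    ultimately have "b e1 A = - 2" using e_facts A_facts by (simp add: q_add)
    show False
    proof (rule no_isotropic_part[of "e1 + A" N "m - 1"])
      show "v = e1 + A + (smul (m - 1) A + (e2 + \<Sum>\<^sub># N))"
        by (subst v_eq) (auto simp: fun_eq_iff algebra_simps)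
    qed (use m \<open>b e1 A = - 2\<close> e_facts A_facts b_v_e b_v_a in \<open>auto simp: q_add b_simps orthant_add\<close>)
  qed
qed

text \<open>The coefficient 30 satisfies 2 * 30 - 59 = 1. So \<omega> has product 1 with
  \<open>A\<close>, and 4 q(\<omega>) = 1 + 59 gives \<open>b\<close> norm 30, that of the E8
  weight.\<close>

lemma e8_bound:
  assumes n: "e8_weights (set_mset N) (\<lambda>y y'. 2 * b y y' - 1) n"
    and AN: "\<And>y. y \<in># N \<Longrightarrow> b A y = - 1"
    and e: "e \<in> orthant X" "q e = 1" "b A e = - 1" "\<And>y. y \<in># N \<Longrightarrow> 0 \<le> b e y"
  shows "- 6 \<le> b (comb A (set_mset N) 30 n) e"
proof -
  let ?\<omega> = "comb A (set_mset N) 30 n"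
  have n1: "n y \<in> {0, 6, 10, 15}" if "y \<in># N" for y using n that by (auto simp: e8_weights_def)
  have n2: "sum n (set_mset N) = 59" "bform (set_mset N) (\<lambda>y y'. 2 * b y y' - 1) n n = 59"
    using n by (auto simp: e8_weights_def)
  have "0 \<le> n y" if "y \<in># N" for y using n1[OF that] by auto
  then have orth: "?\<omega> \<in> orthant X" using A_facts N_facts by (intro comb_orthant) auto
  have "4 * q ?\<omega> = 60" using four_q_comb[OF A_facts(2), of "set_mset N" 30 n] AN n2 by simp
  then have "q ?\<omega> = 15" by simp
  \<comment> \<open>Testing with t e gives the bound -(t + 15/t), which is best at t = 4 among
    positive integers.\<close>
  moreover have "0 \<le> q (smul 4 e + ?\<omega>)" using orth e by (intro q_nonneg orthant_add orthant_smul) auto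
  ultimately have ge: "- 7 \<le> b ?\<omega> e" using e by (simp add: q_add q_smul b_simps b_commute)
  obtain A' B C where ABC: "0 \<le> A'" "0 \<le> B" "0 \<le> C"
    "(\<Sum>y\<in>set_mset N. n y * b y e) = 6 * A' + 10 * B + 15 * C"
    using sum_6_10_15[of "set_mset N" n "\<lambda>y. b y e"] n1 e(4) by (auto simp: b_commute)
  have "b ?\<omega> e = - 30 + (6 * A' + 10 * B + 15 * C)" by (simp add: b_comb e ABC)
  \<comment> \<open>weak non-negativity only gives \<open>-7\<close>, but 23 is not a combination of 6, 10 and 15\<close>
  moreover have "6 * A' + 10 * B + 15 * C \<noteq> 23" using ABC(1-3) by presburger
  ultimately show ?thesis using ge by linarith
qed

lemma inconsistent: False
proof -
  interpret sw: reduced_decomposition X M v a m e2 e1 N by (rule swap)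
  note e1 = no_double_neighbour and e2 = sw.no_double_neighbour
  have AN: "b A y = - 1" if y: "y \<in># N" for y
  proof -
    have "b v y = m * b A y + (b e1 y + (b e2 y + b (\<Sum>\<^sub># N) y))" by (subst v_eq) (simp add: b_simps)
    then have "m * b A y < 0" using b_v_N[OF y] e1(1)[OF y] e2(1)[OF y] b_sum_N[OF _ y] by simp
    then have "b A y < 0" using m by (simp add: mult_less_0_iff)
    moreover have "- 1 \<le> b A y" using A_facts b_v_a N_facts b_v_N y by (intro b_ge_minus_1) auto
    ultimately show ?thesis by simp
  qed
  define d where "d = b e1 e2"
  have d0: "0 \<le> d"
  proof -
    have "d \<noteq> - 1" unfolding d_def by (rule unmergeable) simp
    moreover have "- 2 \<le> d" using q_nonneg[OF orthant_add, of e1 e2] e_facts by (simp add: q_add d_def)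
    \<comment> \<open>Otherwise \<open>e1 + e2\<close> is isotropic and
      \<open>v - (e1 + e2)\<close>, which lies in the orthant, has value 1 + 0 - 2 = -1.\<close>
    moreover have "d \<noteq> - 2"
    proof
      assume "d = - 2"
      have "v - (e1 + e2) = smul m A + \<Sum>\<^sub># N" by (subst v_eq) simp
      then have "0 \<le> q (v - (e1 + e2))" using m A_facts sum_orthant[of N] by (auto intro!: q_nonneg orthant_add orthant_smul)
      then show False using \<open>d = - 2\<close> e_facts b_v_e v_root by (simp add: q_diff q_add b_simps d_def)
    qed
    ultimately show ?thesis by simp
  qed
  have Ae1: "b A e1 = - 1"
  proof -
    have "b v e1 = m * b A e1 + (2 + (d + (\<Sum>y\<in>#N. b y e1)))"
      using e_facts by (subst v_eq) (simp add: b_simps b_self b_sum_mset_left d_def b_commute[of e2 e1])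
    moreover have "0 \<le> (\<Sum>y\<in>#N. b y e1)" using e1(1) by (intro sum_mset_nonneg_int) (simp add: b_commute)
    ultimately have "m * b A e1 < 0" using b_v_e d0 by simp
    then have "b A e1 < 0" using m by (simp add: mult_less_0_iff)
    then show ?thesis using e1(2) by (simp add: b_commute)
  qed
  have Ae2: "b A e2 = - 1"
  proof -
    have "b v e2 = m * b A e2 + (d + (2 + (\<Sum>y\<in>#N. b y e2)))"
      using e_facts by (subst v_eq) (simp add: b_simps b_self b_sum_mset_left d_def)
    moreover have "0 \<le> (\<Sum>y\<in>#N. b y e2)" using e2(1) by (intro sum_mset_nonneg_int) (simp add: b_commute)
    ultimately have "m * b A e2 < 0" using b_v_e d0 by simp
    then have "b A e2 < 0" using m by (simp add: mult_less_0_iff)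
    then show ?thesis using e2(2) by (simp add: b_commute)
  qed
  have "image_mset (\<lambda>y. b y A) N = image_mset (\<lambda>_. - 1) N"
    using AN by (intro image_mset_cong) (simp add: b_commute)
  then have "(\<Sum>y\<in>#N. b y A) = - int (size N)" by simp
  then have "b v A = 2 * m - 2 - int (size N)"
    using A_facts Ae1 Ae2 by (subst v_eq) (simp add: b_simps b_self b_sum_mset_left b_commute)
  then have size: "int (size N) = 2 * m - 2" using b_v_a by simp
  \<comment> \<open>Trading \<open>e2\<close> for a second copy of \<open>e1\<close> stays in the
    orthant and gives the value 3 - d.\<close>
  have d3: "d \<le> 3"
  proof -
    have "v - e2 + e1 = smul m A + (smul 2 e1 + \<Sum>\<^sub># N)" by (subst v_eq) (auto simp: fun_eq_iff fun_diff_def)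
    then have "0 \<le> q (v - e2 + e1)" using m A_facts e_facts sum_orthant[of N] by (auto intro!: q_nonneg orthant_add orthant_smul)
    then show ?thesis using e_facts b_v_e v_root by (simp add: q_diff q_add b_simps d_def b_commute)
  qed
  have "smul (m - 1) A + \<Sum>\<^sub># N = v - (A + (e1 + e2))"
    by (subst v_eq) (auto simp: fun_eq_iff fun_diff_def algebra_simps)
  \<comment> \<open>The value is 1 + (1 + d) - 2 = d. Dropping one copy of \<open>A\<close> makes
    the square vanish, because the size is 2 (m - 1).\<close>
  then have "q (smul (m - 1) A + \<Sum>\<^sub># N) = d"
    using A_facts e_facts b_v_e b_v_a v_root Ae1 Ae2 by (simp add: q_diff q_add b_simps d_def)
  then have K: "4 * q (smul (m - 1) A + \<Sum>\<^sub># N) - (2 * (m - 1) - int (size N))\<^sup>2 = 4 * d"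
    by (simp add: size)
  let ?W = "int (size N)"
  have W: "24 \<le> ?W" using size m by simp
  then have W2: "24 * ?W \<le> ?W\<^sup>2" unfolding power2_eq_square by (intro mult_right_mono) auto
  \<comment> \<open>12 (2 W - 3) = 24 W - 36 is less than 24 W, and 41 * 12 = 492 is less than 576.
    But 59 * 12 = 708 is not, so only the exceptional alternative remains.\<close>
  have "(2 * ?W - 3) * (4 * d) \<le> (2 * ?W - 3) * 12" using d3 W by (intro mult_left_mono) auto
  then have "\<not> ?W\<^sup>2 \<le> 41 * (4 * d)" "\<not> ?W\<^sup>2 \<le> (2 * ?W - 3) * (4 * d)" using W W2 d3 by auto
  moreover have "?W\<^sup>2 \<le> 41 * (4 * q (smul (m - 1) A + \<Sum>\<^sub># N) - (2 * (m - 1) - ?W)\<^sup>2) \<or>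
    ?W\<^sup>2 \<le> (2 * ?W - 3) * (4 * q (smul (m - 1) A + \<Sum>\<^sub># N) - (2 * (m - 1) - ?W)\<^sup>2) \<or>
    (?W\<^sup>2 \<le> 59 * (4 * q (smul (m - 1) A + \<Sum>\<^sub># N) - (2 * (m - 1) - ?W)\<^sup>2) \<and>
      (\<exists>n. e8_weights (set_mset N) (\<lambda>y y'. 2 * b y y' - 1) n))"
    by (rule star_lower_bound) (auto simp: A_facts N_facts AN b_N_distinct_nonneg intro: comb_positive)
  ultimately obtain n where n: "e8_weights (set_mset N) (\<lambda>y y'. 2 * b y y' - 1) n"
    unfolding K by blast
  \<comment> \<open>Pairing \<omega> with the decomposition of \<open>v\<close> gives 0 = m + (at
    least -6) + (at least -6) + (at least 0), so m <= 12.\<close>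
  define \<omega> where "\<omega> = comb A (set_mset N) 30 n"
  have n_sum: "sum n (set_mset N) = 59" using n by (simp add: e8_weights_def)
  have "b A v = 0" "\<And>y. y \<in># N \<Longrightarrow> b y v = 0" using b_v_a b_v_N by (simp_all add: b_commute[of _ v])
  then have "b \<omega> v = 0" by (simp add: \<omega>_def b_comb)
  moreover have "b \<omega> v = m * b \<omega> A + (b \<omega> e1 + (b \<omega> e2 + (\<Sum>y\<in>#N. b \<omega> y)))"
    by (subst v_eq) (simp add: b_simps b_sum_mset_right)
  moreover have "b \<omega> A = 1"
  proof -
    have "(\<Sum>y\<in>set_mset N. n y * b y A) = - sum n (set_mset N)"
      unfolding sum_negf[symmetric] using AN by (intro sum.cong) (simp_all add: b_commute)
    then show ?thesis using A_facts by (simp add: \<omega>_def b_comb b_self n_sum)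
  qed
  moreover have "0 \<le> (\<Sum>y\<in>#N. b \<omega> y)"
  proof (rule sum_mset_nonneg_int)
    fix y assume y: "y \<in># N"
    have "1 \<le> (\<Sum>y'\<in>set_mset N. (2 * b y y' - 1) * n y')" using n y by (simp add: e8_weights_def)
    also have "\<dots> = 2 * (\<Sum>y'\<in>set_mset N. n y' * b y' y) - 59"
      unfolding n_sum[symmetric] by (simp add: algebra_simps sum_subtractf sum_distrib_left b_commute)
    finally show "0 \<le> b \<omega> y" using AN[OF y] by (simp add: \<omega>_def b_comb)
  qed
  moreover have "- 6 \<le> b \<omega> e1" unfolding \<omega>_def using e_facts Ae1 e1 by (intro e8_bound[OF n AN]) auto
  moreover have "- 6 \<le> b \<omega> e2" unfolding \<omega>_def using e_facts Ae2 e2 by (intro e8_bound[OF n AN]) auto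
  ultimately show False using m by simp
qed

end

context wnn_max_root_form
begin

theorem v_le_12:
  assumes a: "a \<in> X"
  shows "v a \<le> 12"
proof (rule ccontr)
  assume "\<not> ?thesis"
  then have m: "13 \<le> v a" by simp
  have two: "b v v = 2" by (simp add: b_self v_root)
  \<comment> \<open>The single terms of \<open>b v v = 2\<close> are non-negative, so a coordinate
    above 2 has \<open>b v\<close> equal to 0 on its unit vector.\<close>
  have "v a * b v (unitv a) \<le> (\<Sum>i\<in>X. v i * b v (unitv i))"
    using a finX v_pos b_v_unitv_nonneg by (intro member_le_sum) (auto simp: less_imp_le)
  also have "\<dots> = 2" using b_expand[of v v] two by (simp add: b_commute)
  finally have "v a * b v (unitv a) \<le> 2" .
  moreover have "v a * 1 \<le> v a * b v (unitv a)" if "1 \<le> b v (unitv a)"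
    using that m by (intro mult_left_mono) auto
  ultimately have "\<not> 1 \<le> b v (unitv a)" using m by linarith
  then have bva: "b v (unitv a) = 0" using b_v_unitv_nonneg[OF a] by simp
  obtain Y where Y: "decomposition a Y"
    and merge: "\<And>y y' Z. Y = add_mset y (add_mset y' Z) \<Longrightarrow> b y y' \<noteq> - 1"
    using minimal_decomposition[OF a] by metis
  have v_eq: "v = smul (v a) (unitv a) + \<Sum>\<^sub># Y" and roots: "\<And>y. y \<in># Y \<Longrightarrow> y \<in> orthant X \<and> q y = 1 \<and> y a = 0"
    using Y by (auto simp: decomposition_def)
  have "b v v = v a * b v (unitv a) + (\<Sum>y\<in>#Y. b v y)"
    by (subst (2) v_eq) (simp add: b_simps b_sum_mset_right)
  then have "(\<Sum>y\<in>#Y. b v y) = 2" using two bva by simp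
  moreover have "0 \<le> b v y" if "y \<in># Y" for y using roots[OF that] b_v_nonneg by simp
  ultimately consider e where "e \<in># Y" "b v e = 2"
    | e1 e2 N where "Y = add_mset e1 (add_mset e2 N)" "b v e1 = 1" "b v e2 = 1" "\<forall>y\<in>#N. b v y = 0"
    using sum_mset_eq_2_int[of Y "b v"] by blast
  then show False
  proof cases
    \<comment> \<open>A summand carrying the whole value 2 leaves an isotropic rest u with
      \<open>b v u = 0\<close>; so u = 0, although its coordinate at \<open>a\<close> is
      \<open>v a\<close>.\<close>
    case (1 e)
    obtain Z where Z: "Y = add_mset e Z" using multi_member_split[OF 1(1)] by auto
    define u where "u = smul (v a) (unitv a) + \<Sum>\<^sub># Z"
    have u: "v = e + u" using v_eq by (simp add: u_def Z add_ac)
    then have ud: "u = v - e" by simp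
    have "u \<in> orthant X" unfolding u_def
      using m a roots Z by (intro orthant_add orthant_smul orthant_unitv orthant_sum_mset) auto
    moreover have "q u = 0" "b v u = 0" unfolding ud using 1 roots[OF 1(1)] two v_root by (simp_all add: q_diff b_simps)
    ultimately have "u = 0" using isotropic_b_v_pos[of u] by force
    moreover have "u a = v a" using roots[OF 1(1)] by (simp add: ud fun_diff_def)
    ultimately show False using m by simp
  next
    case (2 e1 e2 N)
    interpret reduced_decomposition X M v a "v a" e1 e2 N
      using a m bva roots v_eq 2 merge by unfold_locales (auto simp: 2(1))
    show False by (rule inconsistent)
  qed
qed

end

sublocale slender_max_root_form \<subseteq> wnn_max_root_form
  by unfold_locales (rule weakly_nonneg_q)

section \<open>The Tits form\<close>

text \<open>Every ideal contains 0, so dropping it from \<open>R\<close> does not change the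
  generated ideal.\<close>

lemma minimal_relations_no_zero:
  assumes "minimal_relations Q0 Q1 s t I R"
  shows "(\<lambda>_. 0) \<notin> R"
proof
  assume zero: "(\<lambda>_. 0) \<in> R"
  have "{J. is_ideal Q0 Q1 s t J \<and> R - {\<lambda>_. 0} \<subseteq> J} = {J. is_ideal Q0 Q1 s t J \<and> R \<subseteq> J}"
    by (auto simp: is_ideal_def)
  then have "ideal_gen Q0 Q1 s t (R - {\<lambda>_. 0}) = ideal_gen Q0 Q1 s t R"
    by (simp add: ideal_gen_def)
  then show False using assms zero unfolding minimal_relations_def by blast
qed

text \<open>A non-zero relation from i to i involves a path of length at least 2 from i to i. Its
  absence makes the Tits form a unit form.\<close>

lemma no_relations_on_cycles:
  assumes "triangular Q0 Q1 s t" "admissible Q0 Q1 s t I" "minimal_relations Q0 Q1 s t I R"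
  shows "R \<inter> Iij I i i = {}"
proof (rule ccontr)
  assume "\<not> ?thesis"
  then obtain f where f: "f \<in> R" "f \<in> Iij I i i" by auto
  then have "f \<noteq> (\<lambda>_. 0)" using minimal_relations_no_zero[OF assms(3)] by auto
  then obtain p where p: "f p \<noteq> 0" using ext[of f "\<lambda>_. 0"] by blast
  obtain i' as j where p_eq: "p = (i', as, j)" by (cases p)
  have "f \<in> arrow_pow Q0 Q1 s t 2" using f assms(2) by (auto simp: Iij_def admissible_def)
  then have "2 \<le> length (fst (snd p))" "is_path Q0 Q1 s t p"
    using p unfolding arrow_pow_def path_alg_def by blast+
  then have "2 \<le> length as" "is_path Q0 Q1 s t p" by (simp_all add: p_eq)
  moreover have "i' = i" "j = i" using f(2) p p_eq by (auto simp: Iij_def)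
  ultimately show False using assms(1) p_eq unfolding triangular_def by (metis list.size(3) not_numeral_le_zero)
qed

definition tits_matrix :: "'v set \<Rightarrow> 'a set \<Rightarrow> ('a \<Rightarrow> 'v) \<Rightarrow> ('a \<Rightarrow> 'v)
    \<Rightarrow> ('v \<times> 'a list \<times> 'v \<Rightarrow> 'k::field) set \<Rightarrow> ('v \<times> 'a list \<times> 'v \<Rightarrow> 'k) set \<Rightarrow> 'v \<Rightarrow> 'v \<Rightarrow> int" where
  "tits_matrix Q0 Q1 s t I R i j = (if i = j then 1 else 0) - int (card {\<alpha>\<in>Q1. s \<alpha> = i \<and> t \<alpha> = j})
     + int (card (R \<inter> Iij I i j))"

text \<open>The sum over arrows is regrouped by the pair of source and target.\<close>

lemma tits_form_eq_bform:
  assumes "quiver Q0 Q1 s t"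
  shows "tits_form Q0 Q1 s t I R x = bform Q0 (tits_matrix Q0 Q1 s t I R) x x"
proof -
  have fin: "finite Q0" "finite Q1" and st: "\<And>\<alpha>. \<alpha> \<in> Q1 \<Longrightarrow> s \<alpha> \<in> Q0 \<and> t \<alpha> \<in> Q0"
    using assms by (auto simp: quiver_def)
  have "(\<Sum>\<alpha>\<in>Q1. x (s \<alpha>) * x (t \<alpha>)) = (\<Sum>p\<in>Q0 \<times> Q0. \<Sum>\<alpha>\<in>{\<alpha>\<in>Q1. (s \<alpha>, t \<alpha>) = p}. x (s \<alpha>) * x (t \<alpha>))"
    using fin st by (subst sum.group) auto
  also have "\<dots> = (\<Sum>(i, j)\<in>Q0 \<times> Q0. int (card {\<alpha>\<in>Q1. s \<alpha> = i \<and> t \<alpha> = j}) * x i * x j)"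
    by (intro sum.cong) auto
  also have "\<dots> = (\<Sum>i\<in>Q0. \<Sum>j\<in>Q0. int (card {\<alpha>\<in>Q1. s \<alpha> = i \<and> t \<alpha> = j}) * x i * x j)"
    by (simp add: sum.cartesian_product)
  finally have arrows: "(\<Sum>\<alpha>\<in>Q1. x (s \<alpha>) * x (t \<alpha>)) = \<dots>" .
  have "(\<Sum>i\<in>Q0. (x i)\<^sup>2) = (\<Sum>i\<in>Q0. \<Sum>j\<in>Q0. (if i = j then 1 else 0) * x i * x j)"
    using fin by (intro sum.cong) (auto simp: power2_eq_square if_distrib[of "\<lambda>c. c * _"] cong: if_cong)
  then show ?thesis
    unfolding tits_form_def arrows by (simp add: bform_def tits_matrix_def algebra_simps sum.distrib sum_subtractf)
qed

lemma tits_matrix_diag: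
  assumes "quiver Q0 Q1 s t" "triangular Q0 Q1 s t" "admissible Q0 Q1 s t I" "minimal_relations Q0 Q1 s t I R"
  shows "tits_matrix Q0 Q1 s t I R i i = 1"
proof -
  have "\<not> (s \<alpha> = i \<and> t \<alpha> = i)" if "\<alpha> \<in> Q1" for \<alpha>
  proof
    assume "s \<alpha> = i \<and> t \<alpha> = i"
    then have "is_path Q0 Q1 s t (i, [\<alpha>], i)" using assms(1) that by (auto simp: is_path_def quiver_def)
    then show False using assms(2) by (auto simp: triangular_def)
  qed
  then have "{\<alpha>\<in>Q1. s \<alpha> = i \<and> t \<alpha> = i} = {}" by auto
  then show ?thesis by (simp add: tits_matrix_def no_relations_on_cycles[OF assms(2-4)] del: Collect_empty_eq)
qed

theorem theorem0:
  fixes Q0 :: "'v set" and Q1 :: "'a set" and s t :: "'a \<Rightarrow> 'v"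
    and I R :: "('v \<times> 'a list \<times> 'v \<Rightarrow> 'k::field) set"
    and v :: "'v \<Rightarrow> int"
  assumes "alg_closed_type TYPE('k)"
    and "quiver Q0 Q1 s t"
    and "triangular Q0 Q1 s t"
    and "admissible Q0 Q1 s t I"
    and "minimal_relations Q0 Q1 s t I R"
    and "slender Q0 (tits_form Q0 Q1 s t I R)"
    and "maximal_root Q0 (tits_form Q0 Q1 s t I R) v"
    and "omnipresent Q0 v"
  shows "weakly_nonneg Q0 (tits_form Q0 Q1 s t I R) \<and> (\<forall>i\<in>Q0. v i \<le> 12)"
proof -
  let ?q = "tits_form Q0 Q1 s t I R" and ?M = "tits_matrix Q0 Q1 s t I R"
  interpret unit_form Q0 ?M
    using assms(2) tits_matrix_diag[OF assms(2-5)] by unfold_locales (auto simp: quiver_def)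
  have q_eq: "?q = q" using tits_form_eq_bform[OF assms(2), of I R] by (simp add: fun_eq_iff q_def)
  have root_iff: "is_root Q0 ?q w \<longleftrightarrow> w \<in> orthant Q0 \<and> q w = 1" for w
    by (auto simp: is_root_def orthant_def q_eq)
  interpret slender_max_root_form Q0 ?M v
  proof
    show "v \<in> orthant Q0" "q v = 1" using assms(7) root_iff by (auto simp: maximal_root_def)
    show "0 < v i" if "i \<in> Q0" for i using assms(8) that by (simp add: omnipresent_def)
    show "w = v" if "w \<in> orthant Q0" "q w = 1" "v \<le> w" for w
      using assms(7) that root_iff by (auto simp: maximal_root_def le_fun_def)
    show "- 1 \<le> ?M i j + ?M j i" if ij: "i \<in> Q0" "j \<in> Q0" "i \<noteq> j" for i j
    proof -
      have "bilin ?q (unit_vec i) (unit_vec j) = b (unitv i) (unitv j)"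
        using q_add[of "unitv i" "unitv j"]
        by (simp add: bilin_def q_eq unit_vec_def unitv_def plus_fun_def)
      then show ?thesis using assms(6) ij by (metis b_unitv slender_def)
    qed
  qed
  have "weakly_nonneg Q0 ?q"
    using q_nonneg by (auto simp: weakly_nonneg_def orthant_def q_eq)
  then show ?thesis using v_le_12 by blast
qed

end
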